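(* Let $\mathcal D=\langle\mathcal D_1,\mathcal D_2\rangle$ be a semiorthogonal decomposition of a triangulated category $\mathcal D$. Let $U\subset\operatorname{Stab}(\mathcal D_1)\times\operatorname{Stab}(\mathcal D_2)$ denote the set of pairs of reasonable stability conditions $(\sigma_1=(Z_1,P_1),\ \sigma_2=(Z_2,P_2))$ such that for some $\epsilon>0$ one has $$\operatorname{Hom}_{\mathcal D}^{\le 0}(P_1(-\epsilon,1],P_2(0,1+\epsilon))=0.$$ Then $U$ is open and the gluing map $\operatorname{gl}:U\to\operatorname{Stab}(\mathcal D)$, associating to $(\sigma_1,\sigma_2)$ the stability condition on $\mathcal D$ glued from $\sigma_1$ and $\sigma_2$, is (well defined and) continuous.
   Context: $\operatorname{Hom}^i(A,B)=\operatorname{Hom}(A,B[i])$; $\operatorname{Hom}^{\le m}(\mathcal A,\mathcal B)=0$ means $\operatorname{Hom}^i(A,B)=0$ for all $A\in\mathcal A$, $B\in\mathcal B$, $i\le m$. Stability conditions. A stability condition $\sigma=(Z,P)$ on a triangulated category $\mathcal D$ is a homomorphism $Z:K_0(\mathcal D)\to\mathbb C$ and a slicing $P$: full additive subcategories $P(\phi)\subset\mathcal D$, $\phi\in\mathbb R$ (semistable objects of phase $\phi$), with $P(\phi)[1]=P(\phi+1)$, $\operatorname{Hom}(P(\phi_1),P(\phi_2))=0$ for $\phi_1>\phi_2$, $Z(E)\in\mathbb R_{>0}e^{i\pi\phi}$ for $0\ne E\in P(\phi)$, and such that every nonzero object has a finite Harder-Narasimhan filtration by exact triangles with semistable factors of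 decreasing phases. For an interval $I\subset\mathbb R$, $PI$ (e.g. $P(0,1]$) is the extension-closed full subcategory generated by the $P(\phi)$, $\phi\in I$. The heart of $\sigma$ is $P(0,1]$. $\sigma$ is reasonable if $\inf|Z(E)|>0$ over all nonzero $\sigma$-semistable $E$. $\sigma$ is locally finite if there is $\eta>0$ such that each quasi-abelian category $P(\phi-\eta,\phi+\eta)$ is of finite length (chains of strict subobjects stabilize). $\operatorname{Stab}(\mathcal D)$ is the space of locally finite stability conditions, with the topology having as a basis of neighborhoods of $\sigma=(Z,P)$ the sets $B_\epsilon(\sigma)=\{\tau=(U,Q):\|U-Z\|_\sigma<\sin(\pi\epsilon),\ d(P,Q)<\epsilon\}$ (for small $\epsilon>0$), where $\|U\|_\sigma=\sup\{|U(E)|/|Z(E)|: E\ne0\ \sigma\text{-semistable}\}$ and $d(P,Q)=\inf\{\epsilon\ge0: Q(\phi)\subset P[\phi-\epsilon,\phi+\epsilon]\text{ for all }\phi\}$. Gluing. $\mathcal D=\langle\mathcal D_1,\mathcal D_2\rangle$ is a semiorthogonal decomposition if $\mathcal D_1,\mathcal D_2$ are triangulated subcategories, $\operatorname{Hom}(E_2,E_1)=0$ for $E_i\in\mathcal D_i$, and each $E\in\mathcal D$ fits into an exact triangle $E_2\to E\to E_1\to E_2[1]$ with $E_i\in\mathcal D_i$. Then $E_1=\lambda_1(E)$, $E_2=\rho_2(E)$, where $\lambda_1$ is left adjoint to $\mathcal D_1\hookrightarrow\mathcal D$ and $\rho_2$ is right adjoint to $\mathcal D_2\hookrightarrow\mathcal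 D$. A stability condition $\sigma=(Z,P)$ on $\mathcal D$ is glued from $\sigma_1=(Z_1,P_1)$ and $\sigma_2=(Z_2,P_2)$ if the hearts $H_i=P_i(0,1]$ satisfy $\operatorname{Hom}^{\le 0}(H_1,H_2)=0$, $P(0,1]=\{E\in\mathcal D:\lambda_1(E)\in H_1,\ \rho_2(E)\in H_2\}$, and $Z(E)=Z_1(\lambda_1(E))+Z_2(\rho_2(E))$ for all $E$. It is uniquely determined by $\sigma_1,\sigma_2$ if it exists. *)

theory Defs
  imports "HOL-Analysis.Analysis" "HOL-Algebra.Free_Abelian_Groups"
begin

section \<open>Triangulated categories\<close>

text \<open>
  A distinguished triangle \<open>A \<rightarrow> B \<rightarrow> C \<rightarrow> A[1]\<close> is stored as the triple of its three arrows.
  \<open>Shift\<close> and \<open>ShiftA\<close> are the shift \<open>[1]\<close> on objects and arrows, and \<open>Zer A B\<close> is the zero arrow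
  from \<open>A\<close> to \<open>B\<close>.
\<close>

record ('o, 'm) tcat =
  Ob     :: "'o set"
  Arr    :: "'m set"
  Src    :: "'m \<Rightarrow> 'o"
  Tgt    :: "'m \<Rightarrow> 'o"
  Idn    :: "'o \<Rightarrow> 'm"
  Comp   :: "'m \<Rightarrow> 'm \<Rightarrow> 'm" (infixl "\<cdot>\<index>" 75)
  Add    :: "'m \<Rightarrow> 'm \<Rightarrow> 'm" (infixl "\<boxplus>\<index>" 65)
  Zer    :: "'o \<Rightarrow> 'o \<Rightarrow> 'm"
  Shift  :: "'o \<Rightarrow> 'o"
  ShiftA :: "'m \<Rightarrow> 'm"
  Tri    :: "('m \<times> 'm \<times> 'm) set"

definition Hom :: "('o, 'm) tcat \<Rightarrow> 'o \<Rightarrow> 'o \<Rightarrow> 'm set" where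
  "Hom D A B = {f \<in> Arr D. Src D f = A \<and> Tgt D f = B}"

definition hom_group :: "('o, 'm) tcat \<Rightarrow> 'o \<Rightarrow> 'o \<Rightarrow> 'm monoid" where
  "hom_group D A B = \<lparr>carrier = Hom D A B, monoid.mult = Add D, one = Zer D A B\<rparr>"

definition Neg :: "('o, 'm) tcat \<Rightarrow> 'm \<Rightarrow> 'm" where
  "Neg D f = m_inv (hom_group D (Src D f) (Tgt D f)) f"

definition is_iso :: "('o, 'm) tcat \<Rightarrow> 'm \<Rightarrow> bool" where
  "is_iso D f \<longleftrightarrow> f \<in> Arr D \<and>
     (\<exists>g \<in> Hom D (Tgt D f) (Src D f). g \<cdot>\<^bsub>D\<^esub> f = Idn D (Src D f) \<and> f \<cdot>\<^bsub>D\<^esub> g = Idn D (Tgt D f))"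

definition isomorphic :: "('o, 'm) tcat \<Rightarrow> 'o \<Rightarrow> 'o \<Rightarrow> bool" where
  "isomorphic D A B \<longleftrightarrow> (\<exists>f \<in> Hom D A B. is_iso D f)"

definition zero_object :: "('o, 'm) tcat \<Rightarrow> 'o \<Rightarrow> bool" where
  "zero_object D X \<longleftrightarrow> X \<in> Ob D \<and>
     (\<forall>Y \<in> Ob D. Hom D X Y = {Zer D X Y} \<and> Hom D Y X = {Zer D Y X})"

definition biproduct :: "('o, 'm) tcat \<Rightarrow> 'o \<Rightarrow> 'o \<Rightarrow> 'o \<Rightarrow> bool" where
  "biproduct D A B S \<longleftrightarrow> A \<in> Ob D \<and> B \<in> Ob D \<and> S \<in> Ob D \<and>
     (\<exists>i \<in> Hom D A S. \<exists>j \<in> Hom D B S. \<exists>p \<in> Hom D S A. \<exists>q \<in> Hom D S B.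
        p \<cdot>\<^bsub>D\<^esub> i = Idn D A \<and> q \<cdot>\<^bsub>D\<^esub> j = Idn D B \<and>
        p \<cdot>\<^bsub>D\<^esub> j = Zer D B A \<and> q \<cdot>\<^bsub>D\<^esub> i = Zer D A B \<and>
        (i \<cdot>\<^bsub>D\<^esub> p) \<boxplus>\<^bsub>D\<^esub> (j \<cdot>\<^bsub>D\<^esub> q) = Idn D S)"

text \<open>\<open>(f, g, h)\<close> is a (not necessarily distinguished) triangle \<open>A \<rightarrow> B \<rightarrow> C \<rightarrow> A[1]\<close>.\<close>

definition tri_shape :: "('o, 'm) tcat \<Rightarrow> 'o \<Rightarrow> 'o \<Rightarrow> 'o \<Rightarrow> 'm \<Rightarrow> 'm \<Rightarrow> 'm \<Rightarrow> bool" where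
  "tri_shape D A B C f g h \<longleftrightarrow>
     f \<in> Hom D A B \<and> g \<in> Hom D B C \<and> h \<in> Hom D C (Shift D A)"

text \<open>\<open>A \<rightarrow> B \<rightarrow> C \<rightarrow> A[1]\<close> are the vertices of some distinguished triangle.\<close>

definition exact_triangle :: "('o, 'm) tcat \<Rightarrow> 'o \<Rightarrow> 'o \<Rightarrow> 'o \<Rightarrow> bool" where
  "exact_triangle D A B C \<longleftrightarrow> (\<exists>f g h. tri_shape D A B C f g h \<and> (f, g, h) \<in> Tri D)"

locale additive_category =
  fixes D :: "('o, 'm) tcat"
  assumes src_ob: "f \<in> Arr D \<Longrightarrow> Src D f \<in> Ob D"
    and tgt_ob: "f \<in> Arr D \<Longrightarrow> Tgt D f \<in> Ob D"
    and id_hom: "A \<in> Ob D \<Longrightarrow> Idn D A \<in> Hom D A A"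
    and comp_hom: "f \<in> Hom D A B \<Longrightarrow> g \<in> Hom D B C \<Longrightarrow> g \<cdot>\<^bsub>D\<^esub> f \<in> Hom D A C"
    and id_left: "f \<in> Hom D A B \<Longrightarrow> Idn D B \<cdot>\<^bsub>D\<^esub> f = f"
    and id_right: "f \<in> Hom D A B \<Longrightarrow> f \<cdot>\<^bsub>D\<^esub> Idn D A = f"
    and comp_assoc: "f \<in> Hom D A B \<Longrightarrow> g \<in> Hom D B C \<Longrightarrow> h \<in> Hom D C E \<Longrightarrow>
           (h \<cdot>\<^bsub>D\<^esub> g) \<cdot>\<^bsub>D\<^esub> f = h \<cdot>\<^bsub>D\<^esub> (g \<cdot>\<^bsub>D\<^esub> f)"
    and hom_comm_group: "A \<in> Ob D \<Longrightarrow> B \<in> Ob D \<Longrightarrow> comm_group (hom_group D A B)"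
    and comp_add_left: "f \<in> Hom D A B \<Longrightarrow> g \<in> Hom D B C \<Longrightarrow> g' \<in> Hom D B C \<Longrightarrow>
           (g \<boxplus>\<^bsub>D\<^esub> g') \<cdot>\<^bsub>D\<^esub> f = (g \<cdot>\<^bsub>D\<^esub> f) \<boxplus>\<^bsub>D\<^esub> (g' \<cdot>\<^bsub>D\<^esub> f)"
    and comp_add_right: "f \<in> Hom D A B \<Longrightarrow> f' \<in> Hom D A B \<Longrightarrow> g \<in> Hom D B C \<Longrightarrow>
           g \<cdot>\<^bsub>D\<^esub> (f \<boxplus>\<^bsub>D\<^esub> f') = (g \<cdot>\<^bsub>D\<^esub> f) \<boxplus>\<^bsub>D\<^esub> (g \<cdot>\<^bsub>D\<^esub> f')"
    and ex_zero_object: "\<exists>X. zero_object D X"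
    and ex_biproduct: "A \<in> Ob D \<Longrightarrow> B \<in> Ob D \<Longrightarrow> \<exists>S. biproduct D A B S"

text \<open>Verdier's axioms; the shift is an automorphism of the category, not just an autoequivalence.\<close>

locale triangulated_category = additive_category +
  assumes shift_ob: "bij_betw (Shift D) (Ob D) (Ob D)"
    and shift_hom: "A \<in> Ob D \<Longrightarrow> B \<in> Ob D \<Longrightarrow>
           bij_betw (ShiftA D) (Hom D A B) (Hom D (Shift D A) (Shift D B))"
    and shift_id: "A \<in> Ob D \<Longrightarrow> ShiftA D (Idn D A) = Idn D (Shift D A)"
    and shift_comp: "f \<in> Hom D A B \<Longrightarrow> g \<in> Hom D B C \<Longrightarrow>
           ShiftA D (g \<cdot>\<^bsub>D\<^esub> f) = ShiftA D g \<cdot>\<^bsub>D\<^esub> ShiftA D f"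
    and shift_add: "f \<in> Hom D A B \<Longrightarrow> g \<in> Hom D A B \<Longrightarrow>
           ShiftA D (f \<boxplus>\<^bsub>D\<^esub> g) = ShiftA D f \<boxplus>\<^bsub>D\<^esub> ShiftA D g"
    and tri_typed: "(f, g, h) \<in> Tri D \<Longrightarrow> \<exists>A B C. tri_shape D A B C f g h"
    and TR1_iso: "(f, g, h) \<in> Tri D \<Longrightarrow> tri_shape D A B C f g h \<Longrightarrow> tri_shape D A' B' C' f' g' h' \<Longrightarrow>
           a \<in> Hom D A A' \<Longrightarrow> b \<in> Hom D B B' \<Longrightarrow> c \<in> Hom D C C' \<Longrightarrow>
           is_iso D a \<Longrightarrow> is_iso D b \<Longrightarrow> is_iso D c \<Longrightarrow>
           b \<cdot>\<^bsub>D\<^esub> f = f' \<cdot>\<^bsub>D\<^esub> a \<Longrightarrow> c \<cdot>\<^bsub>D\<^esub> g = g' \<cdot>\<^bsub>D\<^esub> b \<Longrightarrow> ShiftA D a \<cdot>\<^bsub>D\<^esub> h = h' \<cdot>\<^bsub>D\<^esub> c \<Longrightarrow>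
           (f', g', h') \<in> Tri D"
    and TR1_id: "A \<in> Ob D \<Longrightarrow> zero_object D X \<Longrightarrow>
           (Idn D A, Zer D A X, Zer D X (Shift D A)) \<in> Tri D"
    and TR1_cone: "f \<in> Hom D A B \<Longrightarrow> \<exists>C g h. tri_shape D A B C f g h \<and> (f, g, h) \<in> Tri D"
    and TR2: "tri_shape D A B C f g h \<Longrightarrow>
           (f, g, h) \<in> Tri D \<longleftrightarrow> (g, h, Neg D (ShiftA D f)) \<in> Tri D"
    and TR3: "(f, g, h) \<in> Tri D \<Longrightarrow> tri_shape D A B C f g h \<Longrightarrow>
           (f', g', h') \<in> Tri D \<Longrightarrow> tri_shape D A' B' C' f' g' h' \<Longrightarrow>
           a \<in> Hom D A A' \<Longrightarrow> b \<in> Hom D B B' \<Longrightarrow> b \<cdot>\<^bsub>D\<^esub> f = f' \<cdot>\<^bsub>D\<^esub> a \<Longrightarrow>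
           \<exists>c \<in> Hom D C C'. c \<cdot>\<^bsub>D\<^esub> g = g' \<cdot>\<^bsub>D\<^esub> b \<and> ShiftA D a \<cdot>\<^bsub>D\<^esub> h = h' \<cdot>\<^bsub>D\<^esub> c"
    and TR4: "(f, u1, v1) \<in> Tri D \<Longrightarrow> tri_shape D X Y Z' f u1 v1 \<Longrightarrow>
           (g, u2, v2) \<in> Tri D \<Longrightarrow> tri_shape D Y Z X' g u2 v2 \<Longrightarrow>
           (g \<cdot>\<^bsub>D\<^esub> f, u3, v3) \<in> Tri D \<Longrightarrow> tri_shape D X Z Y' (g \<cdot>\<^bsub>D\<^esub> f) u3 v3 \<Longrightarrow>
           \<exists>m \<in> Hom D Z' Y'. \<exists>n \<in> Hom D Y' X'.
             (m, n, ShiftA D u1 \<cdot>\<^bsub>D\<^esub> v2) \<in> Tri D \<and>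
             m \<cdot>\<^bsub>D\<^esub> u1 = u3 \<cdot>\<^bsub>D\<^esub> g \<and> v3 \<cdot>\<^bsub>D\<^esub> m = v1 \<and>
             n \<cdot>\<^bsub>D\<^esub> u3 = u2 \<and> v2 \<cdot>\<^bsub>D\<^esub> n = ShiftA D f \<cdot>\<^bsub>D\<^esub> v3"

definition shift_pow :: "('o, 'm) tcat \<Rightarrow> int \<Rightarrow> 'o \<Rightarrow> 'o" where
  "shift_pow D i B = (if 0 \<le> i then (Shift D ^^ nat i) B
                      else (inv_into (Ob D) (Shift D) ^^ nat (- i)) B)"

text \<open>\<open>Hom\<^sup>i(A, B) = 0\<close> for all \<open>A \<in> S\<close>, \<open>B \<in> T\<close>, \<open>i \<le> m\<close>.\<close>

definition Hom_le_vanishes :: "('o, 'm) tcat \<Rightarrow> int \<Rightarrow> 'o set \<Rightarrow> 'o set \<Rightarrow> bool" where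
  "Hom_le_vanishes D m S T \<longleftrightarrow>
     (\<forall>A \<in> S. \<forall>B \<in> T. \<forall>i \<le> m. Hom D A (shift_pow D i B) = {Zer D A (shift_pow D i B)})"

text \<open>
  Full subcategories are given by their sets of objects. The shift is only restricted
  implicitly, which is meaningful for shift-invariant \<open>S\<close>.
\<close>

definition full_subcategory :: "('o, 'm) tcat \<Rightarrow> 'o set \<Rightarrow> ('o, 'm) tcat" where
  "full_subcategory D S = D\<lparr>Ob := S,
     Arr := {f \<in> Arr D. Src D f \<in> S \<and> Tgt D f \<in> S},
     Tri := {(f, g, h) \<in> Tri D. Src D f \<in> S \<and> Tgt D f \<in> S \<and> Tgt D g \<in> S}\<rparr>"

definition iso_closed :: "('o, 'm) tcat \<Rightarrow> 'o set \<Rightarrow> bool" where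
  "iso_closed D S \<longleftrightarrow> (\<forall>A \<in> S. \<forall>B. isomorphic D A B \<longrightarrow> B \<in> S)"

definition full_additive_subcategory :: "('o, 'm) tcat \<Rightarrow> 'o set \<Rightarrow> bool" where
  "full_additive_subcategory D S \<longleftrightarrow> S \<subseteq> Ob D \<and> iso_closed D S \<and>
     (\<forall>X. zero_object D X \<longrightarrow> X \<in> S) \<and>
     (\<forall>A \<in> S. \<forall>B \<in> S. \<forall>C. biproduct D A B C \<longrightarrow> C \<in> S)"

definition triangulated_subcategory :: "('o, 'm) tcat \<Rightarrow> 'o set \<Rightarrow> bool" where
  "triangulated_subcategory D S \<longleftrightarrow> full_additive_subcategory D S \<and> Shift D ` S = S \<and>
     (\<forall>A B C. exact_triangle D A B C \<longrightarrow> A \<in> S \<longrightarrow> B \<in> S \<longrightarrow> C \<in> S)"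


section \<open>The Grothendieck group\<close>

definition K0_relations :: "('o, 'm) tcat \<Rightarrow> ('o \<Rightarrow>\<^sub>0 int) set" where
  "K0_relations D = generate (free_Abelian_group (Ob D))
     {frag_of B - frag_of A - frag_of C | A B C. exact_triangle D A B C}"

definition K0 :: "('o, 'm) tcat \<Rightarrow> ('o \<Rightarrow>\<^sub>0 int) set monoid" where
  "K0 D = free_Abelian_group (Ob D) Mod K0_relations D"

definition K0_class :: "('o, 'm) tcat \<Rightarrow> 'o \<Rightarrow> ('o \<Rightarrow>\<^sub>0 int) set" where
  "K0_class D E = K0_relations D #>\<^bsub>free_Abelian_group (Ob D)\<^esub> frag_of E"

definition complex_add_group :: "complex monoid" where
  "complex_add_group = \<lparr>carrier = UNIV, monoid.mult = (+), one = 0\<rparr>"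


section \<open>Stability conditions\<close>

inductive_set ext_closure :: "('o, 'm) tcat \<Rightarrow> 'o set \<Rightarrow> 'o set"
  for D :: "('o, 'm) tcat" and X :: "'o set" where
  base: "E \<in> X \<Longrightarrow> E \<in> ext_closure D X"
| ext: "A \<in> ext_closure D X \<Longrightarrow> C \<in> ext_closure D X \<Longrightarrow> exact_triangle D A B C \<Longrightarrow>
          B \<in> ext_closure D X"

text \<open>The subcategory \<open>PI\<close> for an interval \<open>I\<close>.\<close>

definition phase_range :: "('o, 'm) tcat \<Rightarrow> (real \<Rightarrow> 'o set) \<Rightarrow> real set \<Rightarrow> 'o set" where
  "phase_range D P I = ext_closure D (\<Union>\<phi> \<in> I. P \<phi>)"

text \<open>
  \<open>F i \<rightarrow> F (i+1) \<rightarrow> A i\<close> for \<open>i < n\<close> are the triangles of a filtration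
  \<open>0 = F 0 \<rightarrow> \<dots> \<rightarrow> F n = E\<close>.
\<close>

definition has_HN_filtration :: "('o, 'm) tcat \<Rightarrow> (real \<Rightarrow> 'o set) \<Rightarrow> 'o \<Rightarrow> bool" where
  "has_HN_filtration D P E \<longleftrightarrow>
     (\<exists>(n::nat) F A (\<phi> :: nat \<Rightarrow> real). zero_object D (F 0) \<and> F n = E \<and>
        (\<forall>i<n. A i \<in> P (\<phi> i) \<and> \<not> zero_object D (A i) \<and>
                exact_triangle D (F i) (F (Suc i)) (A i)) \<and>
        (\<forall>i j. i < j \<and> j < n \<longrightarrow> \<phi> i > \<phi> j))"

definition slicing :: "('o, 'm) tcat \<Rightarrow> (real \<Rightarrow> 'o set) \<Rightarrow> bool" where
  "slicing D P \<longleftrightarrow>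
     (\<forall>\<phi>. full_additive_subcategory D (P \<phi>)) \<and>
     (\<forall>\<phi>. Shift D ` P \<phi> = P (\<phi> + 1)) \<and>
     (\<forall>\<phi>1 \<phi>2. \<phi>1 > \<phi>2 \<longrightarrow> (\<forall>A \<in> P \<phi>1. \<forall>B \<in> P \<phi>2. Hom D A B = {Zer D A B})) \<and>
     (\<forall>E \<in> Ob D. \<not> zero_object D E \<longrightarrow> has_HN_filtration D P E)"

text \<open>
  A stability condition is a pair \<open>(Z, P)\<close>. As HOL functions are total, \<open>Z\<close> is normalised to be
  \<open>undefined\<close> outside of \<open>K\<^sub>0\<close>, so that equality of pairs is equality of stability conditions.
\<close>

type_synonym 'o stab = "(('o \<Rightarrow>\<^sub>0 int) set \<Rightarrow> complex) \<times> (real \<Rightarrow> 'o set)"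

abbreviation slices :: "'o stab \<Rightarrow> real \<Rightarrow> 'o set" where
  "slices \<sigma> \<equiv> snd \<sigma>"

definition charge :: "('o, 'm) tcat \<Rightarrow> 'o stab \<Rightarrow> 'o \<Rightarrow> complex" where
  "charge D \<sigma> E = fst \<sigma> (K0_class D E)"

definition stability_condition :: "('o, 'm) tcat \<Rightarrow> 'o stab \<Rightarrow> bool" where
  "stability_condition D \<sigma> \<longleftrightarrow>
     fst \<sigma> \<in> hom (K0 D) complex_add_group \<inter> extensional (carrier (K0 D)) \<and>
     slicing D (slices \<sigma>) \<and>
     (\<forall>\<phi>. \<forall>E \<in> slices \<sigma> \<phi>. \<not> zero_object D E \<longrightarrow>
        (\<exists>m>0. charge D \<sigma> E = complex_of_real m * exp (\<i> * complex_of_real (pi * \<phi>))))"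

definition heart :: "('o, 'm) tcat \<Rightarrow> 'o stab \<Rightarrow> 'o set" where
  "heart D \<sigma> = phase_range D (slices \<sigma>) {0<..1}"

definition nonzero_semistable :: "('o, 'm) tcat \<Rightarrow> 'o stab \<Rightarrow> 'o set" where
  "nonzero_semistable D \<sigma> = {E. \<not> zero_object D E \<and> (\<exists>\<phi>. E \<in> slices \<sigma> \<phi>)}"

text \<open>Infima and suprema are taken in \<open>[0, \<infinity>]\<close>, so \<open>inf \<emptyset> = \<infinity>\<close> and \<open>sup \<emptyset> = 0\<close>.\<close>

definition reasonable :: "('o, 'm) tcat \<Rightarrow> 'o stab \<Rightarrow> bool" where
  "reasonable D \<sigma> \<longleftrightarrow> (INF E \<in> nonzero_semistable D \<sigma>. ennreal (cmod (charge D \<sigma> E))) > 0"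


subsection \<open>Local finiteness\<close>

definition is_kernel :: "('o, 'm) tcat \<Rightarrow> 'm \<Rightarrow> 'm \<Rightarrow> bool" where
  "is_kernel C k f \<longleftrightarrow> k \<in> Arr C \<and> f \<in> Arr C \<and> Tgt C k = Src C f \<and>
     f \<cdot>\<^bsub>C\<^esub> k = Zer C (Src C k) (Tgt C f) \<and>
     (\<forall>t \<in> Arr C. Tgt C t = Src C f \<and> f \<cdot>\<^bsub>C\<^esub> t = Zer C (Src C t) (Tgt C f) \<longrightarrow>
        (\<exists>!u. u \<in> Hom C (Src C t) (Src C k) \<and> k \<cdot>\<^bsub>C\<^esub> u = t))"

definition is_cokernel :: "('o, 'm) tcat \<Rightarrow> 'm \<Rightarrow> 'm \<Rightarrow> bool" where
  "is_cokernel C p f \<longleftrightarrow> p \<in> Arr C \<and> f \<in> Arr C \<and> Src C p = Tgt C f \<and>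
     p \<cdot>\<^bsub>C\<^esub> f = Zer C (Src C f) (Tgt C p) \<and>
     (\<forall>t \<in> Arr C. Src C t = Tgt C f \<and> t \<cdot>\<^bsub>C\<^esub> f = Zer C (Src C f) (Tgt C t) \<longrightarrow>
        (\<exists>!u. u \<in> Hom C (Tgt C p) (Tgt C t) \<and> u \<cdot>\<^bsub>C\<^esub> p = t))"

definition is_mono :: "('o, 'm) tcat \<Rightarrow> 'm \<Rightarrow> bool" where
  "is_mono C f \<longleftrightarrow> f \<in> Arr C \<and>
     (\<forall>s \<in> Arr C. \<forall>t \<in> Arr C. Tgt C s = Src C f \<and> Tgt C t = Src C f \<and> Src C s = Src C t \<and>
        f \<cdot>\<^bsub>C\<^esub> s = f \<cdot>\<^bsub>C\<^esub> t \<longrightarrow> s = t)"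

text \<open>
  \<open>f\<close> is strict if the canonical map \<open>u\<close> from its coimage (the target of \<open>p\<close>) to its image
  (the source of \<open>m\<close>) is an isomorphism.
\<close>

definition is_strict :: "('o, 'm) tcat \<Rightarrow> 'm \<Rightarrow> bool" where
  "is_strict C f \<longleftrightarrow> (\<exists>k p c m u.
     is_kernel C k f \<and> is_cokernel C p k \<and> is_cokernel C c f \<and> is_kernel C m c \<and>
     u \<in> Hom C (Tgt C p) (Src C m) \<and> is_iso C u \<and> f = m \<cdot>\<^bsub>C\<^esub> (u \<cdot>\<^bsub>C\<^esub> p))"

definition strict_subobject :: "('o, 'm) tcat \<Rightarrow> 'o \<Rightarrow> 'm \<Rightarrow> bool" where
  "strict_subobject C E i \<longleftrightarrow> is_mono C i \<and> is_strict C i \<and> Tgt C i = E"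

definition subobject_le :: "('o, 'm) tcat \<Rightarrow> 'm \<Rightarrow> 'm \<Rightarrow> bool" where
  "subobject_le C i j \<longleftrightarrow> (\<exists>k \<in> Hom C (Src C i) (Src C j). i = j \<cdot>\<^bsub>C\<^esub> k)"

definition finite_length :: "('o, 'm) tcat \<Rightarrow> bool" where
  "finite_length C \<longleftrightarrow> (\<forall>E \<in> Ob C. \<forall>s :: nat \<Rightarrow> 'm. (\<forall>n. strict_subobject C E (s n)) \<longrightarrow>
     ((\<forall>n. subobject_le C (s n) (s (Suc n))) \<longrightarrow> (\<exists>N. \<forall>n\<ge>N. subobject_le C (s n) (s N))) \<and>
     ((\<forall>n. subobject_le C (s (Suc n)) (s n)) \<longrightarrow> (\<exists>N. \<forall>n\<ge>N. subobject_le C (s N) (s n))))"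

text \<open>The bound \<open>\<eta> < 1/2\<close> is what makes the categories \<open>P(\<phi>-\<eta>, \<phi>+\<eta>)\<close> quasi-abelian.\<close>

definition locally_finite_stab :: "('o, 'm) tcat \<Rightarrow> 'o stab \<Rightarrow> bool" where
  "locally_finite_stab D \<sigma> \<longleftrightarrow> (\<exists>\<eta>. 0 < \<eta> \<and> \<eta> < 1/2 \<and>
     (\<forall>\<phi>. finite_length (full_subcategory D (phase_range D (slices \<sigma>) {\<phi> - \<eta> <..< \<phi> + \<eta>}))))"

definition Stab :: "('o, 'm) tcat \<Rightarrow> 'o stab set" where
  "Stab D = {\<sigma>. stability_condition D \<sigma> \<and> locally_finite_stab D \<sigma>}"


subsection \<open>The topology\<close>

text \<open>\<open>charge_dist D \<sigma> \<tau>\<close> is \<open>\<parallel>U - Z\<parallel>\<^sub>\<sigma>\<close> for \<open>\<sigma> = (Z, P)\<close>, \<open>\<tau> = (U, Q)\<close>.\<close>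

definition charge_dist :: "('o, 'm) tcat \<Rightarrow> 'o stab \<Rightarrow> 'o stab \<Rightarrow> ennreal" where
  "charge_dist D \<sigma> \<tau> = (SUP E \<in> nonzero_semistable D \<sigma>.
     ennreal (cmod (charge D \<tau> E - charge D \<sigma> E) / cmod (charge D \<sigma> E)))"

definition slicing_dist :: "('o, 'm) tcat \<Rightarrow> (real \<Rightarrow> 'o set) \<Rightarrow> (real \<Rightarrow> 'o set) \<Rightarrow> ennreal" where
  "slicing_dist D P Q =
     (INF \<epsilon> \<in> {\<epsilon>. 0 \<le> \<epsilon> \<and> (\<forall>\<phi>. Q \<phi> \<subseteq> phase_range D P {\<phi> - \<epsilon> .. \<phi> + \<epsilon>})}. ennreal \<epsilon>)"

definition stab_ball :: "('o, 'm) tcat \<Rightarrow> real \<Rightarrow> 'o stab \<Rightarrow> 'o stab set" where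
  "stab_ball D \<epsilon> \<sigma> = {\<tau> \<in> Stab D.
     charge_dist D \<sigma> \<tau> < ennreal (sin (pi * \<epsilon>)) \<and>
     slicing_dist D (slices \<sigma>) (slices \<tau>) < ennreal \<epsilon>}"

text \<open>
  The balls \<open>B\<^sub>\<epsilon>(\<sigma>)\<close> with \<open>\<epsilon> < 1/8\<close> form a neighbourhood basis at \<open>\<sigma>\<close>: a set is open if and only
  if it contains a ball around each of its points.
\<close>

definition stab_topology :: "('o, 'm) tcat \<Rightarrow> 'o stab topology" where
  "stab_topology D = topology (\<lambda>V. V \<subseteq> Stab D \<and>
     (\<forall>\<sigma> \<in> V. \<exists>\<epsilon>. 0 < \<epsilon> \<and> \<epsilon> < 1/8 \<and> stab_ball D \<epsilon> \<sigma> \<subseteq> V))"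

lemma stab_ball_mono:
  assumes "\<delta> \<le> \<epsilon>" "0 < \<delta>" "\<epsilon> < 1/8"
  shows "stab_ball D \<delta> \<sigma> \<subseteq> stab_ball D \<epsilon> \<sigma>"
proof -
  have "pi * \<epsilon> \<le> pi * (1/8)"
    using assms by (intro mult_left_mono) auto
  moreover have "pi * \<delta> \<le> pi * \<epsilon>" "0 \<le> pi * \<delta>"
    using assms by auto
  moreover have "pi * (1/8) \<le> pi / 2" by simp
  moreover have "- (pi / 2) \<le> pi * \<delta>"
    using \<open>0 \<le> pi * \<delta>\<close> pi_gt_zero by linarith
  ultimately have "sin (pi * \<delta>) \<le> sin (pi * \<epsilon>)"
    by (intro sin_monotone_2pi_le) linarith+
  then have "ennreal (sin (pi * \<delta>)) \<le> ennreal (sin (pi * \<epsilon>))" "ennreal \<delta> \<le> ennreal \<epsilon>"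
    using assms by (auto intro: ennreal_leI)
  then show ?thesis
    unfolding stab_ball_def by (auto intro: less_le_trans)
qed

lemma openin_stab_topology:
  "openin (stab_topology D) V \<longleftrightarrow> V \<subseteq> Stab D \<and>
     (\<forall>\<sigma> \<in> V. \<exists>\<epsilon>. 0 < \<epsilon> \<and> \<epsilon> < 1/8 \<and> stab_ball D \<epsilon> \<sigma> \<subseteq> V)"
proof -
  let ?op = "\<lambda>V. V \<subseteq> Stab D \<and> (\<forall>\<sigma> \<in> V. \<exists>\<epsilon>. 0 < \<epsilon> \<and> \<epsilon> < 1/8 \<and> stab_ball D \<epsilon> \<sigma> \<subseteq> V)"
  have "?op (S \<inter> T)" if S: "?op S" and T: "?op T" for S T
  proof (intro conjI ballI)
    show "S \<inter> T \<subseteq> Stab D" using S by blast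
    fix \<sigma> assume "\<sigma> \<in> S \<inter> T"
    then obtain \<delta> \<epsilon> where de: "0 < \<delta>" "\<delta> < 1/8" "stab_ball D \<delta> \<sigma> \<subseteq> S"
      "0 < \<epsilon>" "\<epsilon> < 1/8" "stab_ball D \<epsilon> \<sigma> \<subseteq> T"
      using S T by blast
    have "stab_ball D (min \<delta> \<epsilon>) \<sigma> \<subseteq> stab_ball D \<delta> \<sigma>" "stab_ball D (min \<delta> \<epsilon>) \<sigma> \<subseteq> stab_ball D \<epsilon> \<sigma>"
      by (rule stab_ball_mono; use de in auto)+
    then show "\<exists>\<epsilon>. 0 < \<epsilon> \<and> \<epsilon> < 1/8 \<and> stab_ball D \<epsilon> \<sigma> \<subseteq> S \<inter> T"
      using de by (intro exI[of _ "min \<delta> \<epsilon>"]) auto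
  qed
  moreover have "?op (\<Union>K)" if "\<forall>V\<in>K. ?op V" for K
  proof (intro conjI ballI)
    show "\<Union>K \<subseteq> Stab D" using that by blast
    fix \<sigma> assume "\<sigma> \<in> \<Union>K"
    then obtain V where "V \<in> K" "\<sigma> \<in> V" by blast
    then show "\<exists>\<epsilon>. 0 < \<epsilon> \<and> \<epsilon> < 1/8 \<and> stab_ball D \<epsilon> \<sigma> \<subseteq> \<Union>K"
      using that by (meson Union_upper subset_trans)
  qed
  ultimately have "istopology ?op"
    unfolding istopology_def by blast
  then show ?thesis
    unfolding stab_topology_def by (simp add: topology_inverse')
qed


section \<open>Gluing\<close>

text \<open>\<open>E\<^sub>2 \<rightarrow> E \<rightarrow> E\<^sub>1 \<rightarrow> E\<^sub>2[1]\<close> is the decomposition triangle of \<open>E\<close>.\<close>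

definition decomposition_triangle ::
    "('o, 'm) tcat \<Rightarrow> 'o set \<Rightarrow> 'o set \<Rightarrow> 'o \<Rightarrow> 'o \<Rightarrow> 'o \<Rightarrow> bool" where
  "decomposition_triangle D D1 D2 E E1 E2 \<longleftrightarrow> E1 \<in> D1 \<and> E2 \<in> D2 \<and> exact_triangle D E2 E E1"

definition semiorthogonal_decomposition :: "('o, 'm) tcat \<Rightarrow> 'o set \<Rightarrow> 'o set \<Rightarrow> bool" where
  "semiorthogonal_decomposition D D1 D2 \<longleftrightarrow>
     triangulated_subcategory D D1 \<and> triangulated_subcategory D D2 \<and>
     (\<forall>E1 \<in> D1. \<forall>E2 \<in> D2. Hom D E2 E1 = {Zer D E2 E1}) \<and>
     (\<forall>E \<in> Ob D. \<exists>E1 E2. decomposition_triangle D D1 D2 E E1 E2)"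

text \<open>
  The values of the adjoints \<open>\<lambda>\<^sub>1\<close> and \<open>\<rho>\<^sub>2\<close> of the inclusions on objects. They are determined only
  up to isomorphism; they are used below only through classes in \<open>K\<^sub>0\<close> and membership in
  isomorphism-closed subcategories.
\<close>

definition lambda1 :: "('o, 'm) tcat \<Rightarrow> 'o set \<Rightarrow> 'o set \<Rightarrow> 'o \<Rightarrow> 'o" where
  "lambda1 D D1 D2 E = (SOME E1. \<exists>E2. decomposition_triangle D D1 D2 E E1 E2)"

definition rho2 :: "('o, 'm) tcat \<Rightarrow> 'o set \<Rightarrow> 'o set \<Rightarrow> 'o \<Rightarrow> 'o" where
  "rho2 D D1 D2 E = (SOME E2. \<exists>E1. decomposition_triangle D D1 D2 E E1 E2)"

definition glued_from ::
    "('o, 'm) tcat \<Rightarrow> 'o set \<Rightarrow> 'o set \<Rightarrow> 'o stab \<Rightarrow> 'o stab \<Rightarrow> 'o stab \<Rightarrow> bool" where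
  "glued_from D D1 D2 \<sigma>1 \<sigma>2 \<sigma> \<longleftrightarrow>
     (let C1 = full_subcategory D D1; C2 = full_subcategory D D2;
          H1 = heart C1 \<sigma>1; H2 = heart C2 \<sigma>2
      in stability_condition D \<sigma> \<and>
         Hom_le_vanishes D 0 H1 H2 \<and>
         heart D \<sigma> = {E \<in> Ob D. lambda1 D D1 D2 E \<in> H1 \<and> rho2 D D1 D2 E \<in> H2} \<and>
         (\<forall>E \<in> Ob D. charge D \<sigma> E =
            charge C1 \<sigma>1 (lambda1 D D1 D2 E) + charge C2 \<sigma>2 (rho2 D D1 D2 E)))"

definition gluing_domain :: "('o, 'm) tcat \<Rightarrow> 'o set \<Rightarrow> 'o set \<Rightarrow> ('o stab \<times> 'o stab) set" where
  "gluing_domain D D1 D2 =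
     (let C1 = full_subcategory D D1; C2 = full_subcategory D D2
      in {(\<sigma>1, \<sigma>2). \<sigma>1 \<in> Stab C1 \<and> \<sigma>2 \<in> Stab C2 \<and> reasonable C1 \<sigma>1 \<and> reasonable C2 \<sigma>2 \<and>
            (\<exists>\<epsilon>>0. Hom_le_vanishes D 0 (phase_range C1 (slices \<sigma>1) {- \<epsilon> <.. 1})
                                        (phase_range C2 (slices \<sigma>2) {0 <..< 1 + \<epsilon>}))})"

definition gluing_map ::
    "('o, 'm) tcat \<Rightarrow> 'o set \<Rightarrow> 'o set \<Rightarrow> 'o stab \<times> 'o stab \<Rightarrow> 'o stab" where
  "gluing_map D D1 D2 = (\<lambda>(\<sigma>1, \<sigma>2). THE \<sigma>. glued_from D D1 D2 \<sigma>1 \<sigma>2 \<sigma>)"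

end

theory Submission
  imports Defs
begin

text \<open>
  The vanishing condition on a pair \<open>(\<sigma>\<^sub>1, \<sigma>\<^sub>2)\<close> in \<open>U\<close> is equivalent to \<open>Hom(A, B) = 0\<close> for all
  \<open>A \<in> P\<^sub>1(>-\<epsilon>)\<close> and \<open>B \<in> P\<^sub>2(<1+\<epsilon>)\<close> (\<open>compatible_iff\<close>). For every real \<open>t\<close> within \<open>\<epsilon>\<close> of an
  integer this is what is needed to glue the t-structures that the two slicings define at the
  phase \<open>t\<close>: the objects \<open>E\<close> with \<open>\<lambda>\<^sub>1(E) \<in> P\<^sub>1(>t)\<close> and \<open>\<rho>\<^sub>2(E) \<in> P\<^sub>2(>t)\<close> are the positive part
  of a t-structure on the whole category (\<open>GG_ts\<close>). The proof uses these t-structures for all such \<open>t\<close>,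
  and not only the glued heart, which belongs to \<open>t = 0\<close>. Write \<open>D(b, c]\<close> for the objects \<open>E\<close>
  with \<open>\<lambda>\<^sub>1(E) \<in> P\<^sub>1(b, c]\<close> and \<open>\<rho>\<^sub>2(E) \<in> P\<^sub>2(b, c]\<close>.

  \<^emph>\<open>Existence.\<close> Fix \<open>0 < a < 1\<close> with \<open>a\<close> within \<open>\<epsilon>\<close> of an integer. The heart \<open>D(0, 1]\<close> is cut into
  \<open>D(0, a]\<close> and \<open>D(a, 1]\<close>, and the central charge of every nonzero object of \<open>D(a, 1]\<close> has larger phase
  than that of any nonzero object of \<open>D(0, a]\<close>. So Harder-Narasimhan filtrations can be constructed in the two pieces
  separately and then concatenated. Each piece has width less than \<open>1\<close>; all values of the central charge on it lie
  in a proper sector, and since \<open>\<sigma>\<^sub>1\<close>, \<open>\<sigma>\<^sub>2\<close> are reasonable, a suitable rotated real part of the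
  charge is an additive function with a positive lower bound on nonzero objects. This function bounds
  the length of chains of strict subobjects, so the classical argument with maximal destabilizing
  quotients works in the quasi-abelian category \<open>D(b, c]\<close> (\<open>hn_in_piece\<close>). The same length
  function shows that the resulting stability condition is reasonable, and that reasonable stability conditions are
  locally finite (\<open>reasonable_locally_finite\<close>).

  \<^emph>\<open>Comparison of slicings.\<close> Let \<open>E\<close> be semistable of phase \<open>\<phi>\<close> for one stability condition and let
  \<open>T \<rightarrow> E \<rightarrow> F\<close> be its truncation at a phase \<open>t\<close> for another slicing. If all three objects lie in a common
  half-open interval \<open>(b, b+1]\<close> of the first slicing, then \<open>T\<close> lies in \<open>(b, \<phi>]\<close>, whence its charge is
  not above the ray of phase \<open>\<phi>\<close>; if the semistable objects of phase greater than \<open>t\<close> for the second slicing have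
  charge above that ray, then \<open>T = 0\<close> (\<open>truncation_upper\<close>, \<open>truncation_lower\<close>). For equal charges
  and \<open>t = \<phi>\<close> this shows that a stability condition is determined by its heart and its charge, so the
  glued one is unique and independent of \<open>a\<close>. For nearby charges and \<open>t = \<phi> \<plusminus> d\<close> it bounds the distance of
  two glued slicings (\<open>glued_slicing_close\<close>).

  \<^emph>\<open>Continuity.\<close> For all \<open>b < c\<close> near integers, \<open>D(b, c]\<close> consists of the objects with phases in \<open>(b, c]\<close>
  for the glued stability condition, so a semistable object with phase in \<open>(0, 1]\<close> lies in \<open>D(0, 1-e]\<close> or in \<open>D(e, 1]\<close> for a fixed \<open>e > 0\<close>
  (\<open>window\<close>). In such a window no cancellation is possible between the charges of the Harder-Narasimhan factors
  of \<open>\<lambda>\<^sub>1(E)\<close> and \<open>\<rho>\<^sub>2(E)\<close>, so small relative perturbations of \<open>Z\<^sub>1\<close> and \<open>Z\<^sub>2\<close> give a small relative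
  perturbation of \<open>Z\<close> (\<open>glued_charge_close\<close>), and the comparison of slicings applies. Openness of \<open>U\<close> holds because
  perturbing the slicings by less than \<open>\<epsilon>/2\<close> preserves the vanishing with \<open>\<epsilon>/2\<close> in place of \<open>\<epsilon>\<close>, and a
  perturbation that is small relative to the charge preserves reasonableness.
\<close>

section \<open>Triangulated categories\<close>

text \<open>
  Almost all arguments below are about vertices of triangles and vanishing of Hom groups, and do not
  name arrows. If an object is missing from the category, its Hom sets are empty, so \<open>orth\<close>
  also records that both arguments are objects.
\<close>

definition orth :: "('o, 'm) tcat \<Rightarrow> 'o \<Rightarrow> 'o \<Rightarrow> bool" where
  "orth D A B \<longleftrightarrow> Hom D A B = {Zer D A B}"

definition Unshift :: "('o, 'm) tcat \<Rightarrow> 'o \<Rightarrow> 'o" where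
  "Unshift D A = inv_into (Ob D) (Shift D) A"

context additive_category
begin

abbreviation compose (infixl "\<odot>" 75) where "g \<odot> f \<equiv> Comp D g f"
abbreviation plus_arr (infixl "\<oplus>\<oplus>" 65) where "f \<oplus>\<oplus> g \<equiv> Add D f g"

lemma Hom_obs: "f \<in> Hom D A B \<Longrightarrow> A \<in> Ob D \<and> B \<in> Ob D"
  using src_ob tgt_ob by (auto simp: Hom_def)

lemma Hom_arr: "f \<in> Hom D A B \<Longrightarrow> f \<in> Arr D \<and> Src D f = A \<and> Tgt D f = B"
  by (auto simp: Hom_def)

lemma zer_hom [intro]: "A \<in> Ob D \<Longrightarrow> B \<in> Ob D \<Longrightarrow> Zer D A B \<in> Hom D A B"
  using monoid.one_closed[of "hom_group D A B"] hom_comm_group[of A B]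
  by (simp add: hom_group_def comm_group_def group_def)

lemma add_hom: "f \<in> Hom D A B \<Longrightarrow> g \<in> Hom D A B \<Longrightarrow> f \<oplus>\<oplus> g \<in> Hom D A B"
  using monoid.m_closed[of "hom_group D A B" f g] hom_comm_group[of A B] Hom_obs[of f A B]
  by (simp add: hom_group_def comm_group_def group_def)

lemma add_zer: assumes "f \<in> Hom D A B" shows "f \<oplus>\<oplus> Zer D A B = f" "Zer D A B \<oplus>\<oplus> f = f"
  using monoid.r_one[of "hom_group D A B" f] monoid.l_one[of "hom_group D A B" f]
    hom_comm_group[of A B] Hom_obs[OF assms] assms
  by (simp_all add: hom_group_def comm_group_def group_def)

lemma add_self_zer: assumes "f \<in> Hom D A B" "f \<oplus>\<oplus> f = f" shows "f = Zer D A B"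
  using group.l_cancel_one[of "hom_group D A B" f f] hom_comm_group[of A B] Hom_obs[OF assms(1)] assms
  by (simp add: hom_group_def comm_group_def)

lemma neg_hom: assumes "f \<in> Hom D A B" shows "Neg D f \<in> Hom D A B"
  using group.inv_closed[of "hom_group D A B" f] hom_comm_group[of A B] Hom_obs[OF assms] Hom_arr[OF assms] assms
  by (simp add: hom_group_def comm_group_def Neg_def)

lemma add_neg: assumes "f \<in> Hom D A B" shows "f \<oplus>\<oplus> Neg D f = Zer D A B"
  using group.r_inv[of "hom_group D A B" f] hom_comm_group[of A B] Hom_obs[OF assms] Hom_arr[OF assms] assms
  by (simp add: hom_group_def comm_group_def Neg_def)

lemma neg_unique:
  assumes "f \<in> Hom D A B" "g \<in> Hom D A B" "f \<oplus>\<oplus> g = Zer D A B" shows "f = Neg D g"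
  using group.inv_equality[of "hom_group D A B" f g] hom_comm_group[of A B] Hom_obs[OF assms(1)]
    Hom_arr[OF assms(2)] assms
  by (simp add: hom_group_def comm_group_def Neg_def)

lemma neg_neg: assumes "f \<in> Hom D A B" shows "Neg D (Neg D f) = f"
  using neg_unique[OF assms neg_hom[OF assms] add_neg[OF assms]] by simp

lemma eq_if_sub_zer:
  assumes "f \<in> Hom D A B" "g \<in> Hom D A B" "f \<oplus>\<oplus> Neg D g = Zer D A B" shows "f = g"
  using neg_unique[OF assms(1) neg_hom[OF assms(2)] assms(3)] neg_neg[OF assms(2)] by simp

lemma comp_zer: assumes "g \<in> Hom D B C" "A \<in> Ob D" shows "g \<odot> Zer D A B = Zer D A C"
proof (rule add_self_zer)
  have B: "B \<in> Ob D" using Hom_obs[OF assms(1)] by simp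
  have z: "Zer D A B \<in> Hom D A B" using assms(2) B by blast
  show "g \<odot> Zer D A B \<in> Hom D A C" using comp_hom[OF z assms(1)] .
  show "g \<odot> Zer D A B \<oplus>\<oplus> g \<odot> Zer D A B = g \<odot> Zer D A B"
    using comp_add_right[OF z z assms(1)] add_zer[OF z] by simp
qed

lemma zer_comp: assumes "f \<in> Hom D A B" "C \<in> Ob D" shows "Zer D B C \<odot> f = Zer D A C"
proof (rule add_self_zer)
  have B: "B \<in> Ob D" using Hom_obs[OF assms(1)] by simp
  have z: "Zer D B C \<in> Hom D B C" using assms(2) B by blast
  show "Zer D B C \<odot> f \<in> Hom D A C" using comp_hom[OF assms(1) z] .
  show "Zer D B C \<odot> f \<oplus>\<oplus> Zer D B C \<odot> f = Zer D B C \<odot> f"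
    using comp_add_left[OF assms(1) z z] add_zer[OF z] by simp
qed

lemma comp_neg: assumes "f \<in> Hom D A B" "g \<in> Hom D B C" shows "g \<odot> Neg D f = Neg D (g \<odot> f)"
proof -
  have "g \<odot> f \<oplus>\<oplus> g \<odot> Neg D f = Zer D A C"
    using comp_add_right[OF assms(1) neg_hom[OF assms(1)] assms(2)] add_neg[OF assms(1)]
      comp_zer[OF assms(2)] Hom_obs[OF assms(1)] by simp
  then show ?thesis
    using neg_unique[OF comp_hom[OF assms] comp_hom[OF neg_hom[OF assms(1)] assms(2)]]
      neg_neg[OF comp_hom[OF neg_hom[OF assms(1)] assms(2)]] by simp
qed

lemma neg_comp: assumes "f \<in> Hom D A B" "g \<in> Hom D B C" shows "Neg D g \<odot> f = Neg D (g \<odot> f)"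
proof -
  have "g \<odot> f \<oplus>\<oplus> Neg D g \<odot> f = Zer D A C"
    using comp_add_left[OF assms(1) assms(2) neg_hom[OF assms(2)]] add_neg[OF assms(2)]
      zer_comp[OF assms(1)] Hom_obs[OF assms(2)] by simp
  then show ?thesis
    using neg_unique[OF comp_hom[OF assms] comp_hom[OF assms(1) neg_hom[OF assms(2)]]]
      neg_neg[OF comp_hom[OF assms(1) neg_hom[OF assms(2)]]] by simp
qed

lemma neg_zer: assumes "A \<in> Ob D" "B \<in> Ob D" shows "Neg D (Zer D A B) = Zer D A B"
  using neg_unique[of "Zer D A B" A B "Zer D A B"] add_zer zer_hom[OF assms] by metis

lemma comp_left_cancelI:
  assumes "s \<in> Hom D A B" "t \<in> Hom D A B" "g \<in> Hom D B C" "g \<odot> s = g \<odot> t"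
  shows "g \<odot> (s \<oplus>\<oplus> Neg D t) = Zer D A C"
  using comp_add_right[OF assms(1) neg_hom[OF assms(2)] assms(3)] comp_neg[OF assms(2,3)] assms(4)
    add_neg[OF comp_hom[OF assms(2,3)]] by simp

lemma comp_right_cancelI:
  assumes "s \<in> Hom D B C" "t \<in> Hom D B C" "f \<in> Hom D A B" "s \<odot> f = t \<odot> f"
  shows "(s \<oplus>\<oplus> Neg D t) \<odot> f = Zer D A C"
  using comp_add_left[OF assms(3) assms(1) neg_hom[OF assms(2)]] neg_comp[OF assms(3,2)] assms(4)
    add_neg[OF comp_hom[OF assms(3,2)]] by simp

lemma orthI: assumes "A \<in> Ob D" "B \<in> Ob D" "\<And>f. f \<in> Hom D A B \<Longrightarrow> f = Zer D A B" shows "orth D A B"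
  unfolding orth_def using assms(3) zer_hom[OF assms(1,2)] by blast

lemma orthD: "orth D A B \<Longrightarrow> f \<in> Hom D A B \<Longrightarrow> f = Zer D A B"
  by (auto simp: orth_def)

lemma orth_obs: "orth D A B \<Longrightarrow> A \<in> Ob D \<and> B \<in> Ob D"
  using Hom_obs[of "Zer D A B" A B] by (auto simp: orth_def)

lemma zero_object_iff: "zero_object D X \<longleftrightarrow> X \<in> Ob D \<and> Idn D X = Zer D X X"
proof
  assume "zero_object D X" then show "X \<in> Ob D \<and> Idn D X = Zer D X X"
    using id_hom[of X] by (auto simp: zero_object_def)
next
  assume X: "X \<in> Ob D \<and> Idn D X = Zer D X X"
  have 1: "f = Zer D X Y" if "f \<in> Hom D X Y" for f Y
    using id_right[OF that] comp_zer[OF that] X by metis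
  have 2: "f = Zer D Y X" if "f \<in> Hom D Y X" for f Y
    using id_left[OF that] zer_comp[OF that] X by metis
  have "Hom D X Y = {Zer D X Y} \<and> Hom D Y X = {Zer D Y X}" if "Y \<in> Ob D" for Y
    using 1[of _ Y] 2[of _ Y] zer_hom[of X Y] zer_hom[of Y X] X that by blast
  then show "zero_object D X" using X by (simp add: zero_object_def)
qed

lemma zero_object_orth: "zero_object D X \<longleftrightarrow> orth D X X"
proof
  assume "zero_object D X" then show "orth D X X" by (simp add: zero_object_def orth_def)
next
  assume o: "orth D X X"
  then have "X \<in> Ob D" using orth_obs by blast
  then show "zero_object D X" using orthD[OF o id_hom] zero_object_iff by blast
qed

lemma zero_orth: "zero_object D X \<Longrightarrow> Y \<in> Ob D \<Longrightarrow> orth D X Y" "zero_object D X \<Longrightarrow> Y \<in> Ob D \<Longrightarrow> orth D Y X"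
  by (auto simp: zero_object_def orth_def)

lemma zero_ob: "zero_object D X \<Longrightarrow> X \<in> Ob D" by (simp add: zero_object_def)

lemma id_iso: assumes "A \<in> Ob D" shows "is_iso D (Idn D A)"
  using id_hom[OF assms] id_left[OF id_hom[OF assms]] Hom_arr[OF id_hom[OF assms]]
  unfolding is_iso_def by auto

lemma isoI: assumes "f \<in> Hom D A B" "g \<in> Hom D B A" "g \<odot> f = Idn D A" "f \<odot> g = Idn D B"
  shows "is_iso D f"
  unfolding is_iso_def using assms Hom_arr[OF assms(1)] by blast

lemma isoE: assumes "is_iso D f" "f \<in> Hom D A B"
  obtains g where "g \<in> Hom D B A" "g \<odot> f = Idn D A" "f \<odot> g = Idn D B"
proof -
  have "Src D f = A" "Tgt D f = B" using Hom_arr[OF assms(2)] by auto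
  then show ?thesis using assms(1) that unfolding is_iso_def by blast
qed

lemma isomorphicI: assumes "f \<in> Hom D A B" "g \<in> Hom D B A" "g \<odot> f = Idn D A" "f \<odot> g = Idn D B"
  shows "isomorphic D A B"
  using isoI[OF assms] assms(1) unfolding isomorphic_def by auto

lemma isomorphicE: assumes "isomorphic D A B"
  obtains f g where "f \<in> Hom D A B" "g \<in> Hom D B A" "g \<odot> f = Idn D A" "f \<odot> g = Idn D B"
  using assms unfolding isomorphic_def by (metis isoE)

lemma isomorphic_refl: "A \<in> Ob D \<Longrightarrow> isomorphic D A A"
  using id_iso id_hom unfolding isomorphic_def by blast

lemma isomorphic_sym: "isomorphic D A B \<Longrightarrow> isomorphic D B A"
  by (metis isomorphicE isomorphicI)

lemma isomorphic_obs: "isomorphic D A B \<Longrightarrow> A \<in> Ob D \<and> B \<in> Ob D"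
  using Hom_obs unfolding isomorphic_def by blast

end

context triangulated_category
begin

abbreviation tri where "tri A B C f g h \<equiv> tri_shape D A B C f g h \<and> (f, g, h) \<in> Tri D"

lemma triD: assumes "tri_shape D A B C f g h"
  shows "f \<in> Hom D A B" "g \<in> Hom D B C" "h \<in> Hom D C (Shift D A)" "A \<in> Ob D" "B \<in> Ob D" "C \<in> Ob D"
  using assms Hom_obs unfolding tri_shape_def by blast+

lemma triE: assumes "tri A B C f g h"
  shows "f \<in> Hom D A B" "g \<in> Hom D B C" "h \<in> Hom D C (Shift D A)" "A \<in> Ob D" "B \<in> Ob D" "C \<in> Ob D"
  using triD[OF conjunct1[OF assms]] by auto

lemma exact_obs: "exact_triangle D A B C \<Longrightarrow> A \<in> Ob D \<and> B \<in> Ob D \<and> C \<in> Ob D"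
  unfolding exact_triangle_def by (auto dest: triD)

lemma Shift_ob [intro]: "A \<in> Ob D \<Longrightarrow> Shift D A \<in> Ob D"
  using shift_ob by (auto simp: bij_betw_def)

lemma Unshift_ob [intro]: "A \<in> Ob D \<Longrightarrow> Unshift D A \<in> Ob D"
  unfolding Unshift_def using shift_ob by (metis bij_betw_def inv_into_into)

lemma Shift_Unshift [simp]: "A \<in> Ob D \<Longrightarrow> Shift D (Unshift D A) = A"
  unfolding Unshift_def using shift_ob by (metis bij_betw_def f_inv_into_f)

lemma Unshift_Shift [simp]: "A \<in> Ob D \<Longrightarrow> Unshift D (Shift D A) = A"
  unfolding Unshift_def using shift_ob by (metis bij_betw_def inv_into_f_f)

lemma ShiftA_hom: "f \<in> Hom D A B \<Longrightarrow> ShiftA D f \<in> Hom D (Shift D A) (Shift D B)"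
  using shift_hom[of A B] Hom_obs[of f A B] by (auto simp: bij_betw_def)

lemma ShiftA_inj: "f \<in> Hom D A B \<Longrightarrow> g \<in> Hom D A B \<Longrightarrow> ShiftA D f = ShiftA D g \<Longrightarrow> f = g"
  using shift_hom[of A B] Hom_obs[of f A B] by (auto simp: bij_betw_def inj_on_def)

lemma ShiftA_surj: assumes "A \<in> Ob D" "B \<in> Ob D" "k \<in> Hom D (Shift D A) (Shift D B)"
  obtains f where "f \<in> Hom D A B" "ShiftA D f = k"
proof -
  have "k \<in> ShiftA D ` Hom D A B" using shift_hom[OF assms(1,2)] assms(3) by (simp add: bij_betw_def)
  then show ?thesis using that by auto
qed

lemma ShiftA_zer: assumes "A \<in> Ob D" "B \<in> Ob D"
  shows "ShiftA D (Zer D A B) = Zer D (Shift D A) (Shift D B)"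
  using shift_add[OF zer_hom[OF assms] zer_hom[OF assms]] add_zer[OF zer_hom[OF assms]]
    add_self_zer[OF ShiftA_hom[OF zer_hom[OF assms]]] by simp

lemma orth_shift: assumes "A \<in> Ob D" "B \<in> Ob D"
  shows "orth D (Shift D A) (Shift D B) \<longleftrightarrow> orth D A B"
proof
  assume o: "orth D (Shift D A) (Shift D B)"
  show "orth D A B"
  proof (rule orthI[OF assms])
    fix f assume f: "f \<in> Hom D A B"
    have "ShiftA D f = ShiftA D (Zer D A B)" using orthD[OF o ShiftA_hom[OF f]] ShiftA_zer[OF assms] by simp
    then show "f = Zer D A B" using ShiftA_inj[OF f zer_hom[OF assms]] by simp
  qed
next
  assume o: "orth D A B"
  show "orth D (Shift D A) (Shift D B)"
  proof (rule orthI[OF Shift_ob[OF assms(1)] Shift_ob[OF assms(2)]])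
    fix k assume "k \<in> Hom D (Shift D A) (Shift D B)"
    then obtain f where f: "f \<in> Hom D A B" "ShiftA D f = k" using ShiftA_surj[OF assms] by blast
    show "k = Zer D (Shift D A) (Shift D B)" using f(2) orthD[OF o f(1)] ShiftA_zer[OF assms] by simp
  qed
qed

lemma zero_shift: assumes "zero_object D X" shows "zero_object D (Shift D X)"
  using assms orth_shift[of X X] zero_ob[OF assms] by (simp add: zero_object_orth)

lemma tri_rot: assumes "tri A B C f g h"
  shows "tri B C (Shift D A) g h (Neg D (ShiftA D f))"
  using assms TR2[of A B C f g h] triE[OF assms] neg_hom[OF ShiftA_hom[OF triE(1)[OF assms]]]
  by (simp add: tri_shape_def)

lemma tri_unrot: assumes "tri B C (Shift D A) g h k" "A \<in> Ob D"
  obtains f where "tri A B C f g h"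
proof -
  have k: "k \<in> Hom D (Shift D A) (Shift D B)" and B: "B \<in> Ob D" using triE[OF assms(1)] by simp_all
  obtain f where f: "f \<in> Hom D A B" "ShiftA D f = Neg D k"
    using ShiftA_surj[OF assms(2) B neg_hom[OF k]] .
  then have "Neg D (ShiftA D f) = k" using neg_neg[OF k] by simp
  moreover have "tri_shape D A B C f g h" using assms f by (auto simp: tri_shape_def)
  ultimately show ?thesis using TR2[of A B C f g h] assms that by auto
qed

lemma obtain_zero: obtains Z0 where "zero_object D Z0" using ex_zero_object by blast

lemma tri_id: assumes "A \<in> Ob D" "zero_object D X"
  shows "tri A A X (Idn D A) (Zer D A X) (Zer D X (Shift D A))"
  using TR1_id[OF assms] assms id_hom zero_ob by (auto simp: tri_shape_def)

lemma tri_id': assumes "A \<in> Ob D" "zero_object D X"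
  shows "tri X A A (Zer D X A) (Idn D A) (Zer D A (Shift D X))"
proof -
  have z: "zero_object D (Shift D X)" and X: "X \<in> Ob D" using assms zero_shift zero_ob by blast+
  have sh: "tri_shape D X A A (Zer D X A) (Idn D A) (Zer D A (Shift D X))"
    using assms X id_hom by (auto simp: tri_shape_def)
  have "Neg D (ShiftA D (Zer D X A)) = Zer D (Shift D X) (Shift D A)"
    using ShiftA_zer[OF X assms(1)] neg_zer assms X by auto
  then show ?thesis using TR2[OF sh] TR1_id[OF assms(1) z] sh by simp
qed

lemma tri_comp_zer: assumes "tri A B C f g h" shows "g \<odot> f = Zer D A C"
proof -
  obtain Z0 where z: "zero_object D Z0" by (rule obtain_zero)
  have A: "A \<in> Ob D" and C: "C \<in> Ob D" and f: "f \<in> Hom D A B" using triE[OF assms] by simp_all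
  have t: "tri A A Z0 (Idn D A) (Zer D A Z0) (Zer D Z0 (Shift D A))" using tri_id[OF A z] .
  obtain c where c: "c \<in> Hom D Z0 C" "c \<odot> Zer D A Z0 = g \<odot> f"
    using TR3[OF conjunct2[OF t] conjunct1[OF t] conjunct2[OF assms] conjunct1[OF assms] id_hom[OF A] f] by blast
  then show ?thesis using comp_zer[OF c(1) A] by simp
qed

text \<open>
  Exactness of \<open>Hom(X, A) \<rightarrow> Hom(X, B) \<rightarrow> Hom(X, C)\<close>: map the rotated identity triangle
  \<open>X \<rightarrow> 0 \<rightarrow> X[1]\<close> to the rotated given triangle and take the third component.
\<close>

lemma lift_covariant:
  assumes T: "tri A B C f g h" and t: "t \<in> Hom D X B" and z: "g \<odot> t = Zer D X C"
  obtains s where "s \<in> Hom D X A" "f \<odot> s = t"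
proof -
  obtain Z0 where z0: "zero_object D Z0" by (rule obtain_zero)
  have X: "X \<in> Ob D" and A: "A \<in> Ob D" and C: "C \<in> Ob D" and f: "f \<in> Hom D A B"
    and h: "h \<in> Hom D C (Shift D A)"
    using Hom_obs[OF t] triE[OF T] by simp_all
  have Z: "Z0 \<in> Ob D" using z0 zero_ob by blast
  have R1: "tri X Z0 (Shift D X) (Zer D X Z0) (Zer D Z0 (Shift D X)) (Neg D (ShiftA D (Idn D X)))"
    using tri_rot[OF tri_id[OF X z0]] .
  have R2: "tri B C (Shift D A) g h (Neg D (ShiftA D f))" using tri_rot[OF T] .
  have b: "Zer D Z0 C \<in> Hom D Z0 C" using Z C by blast
  have "Zer D Z0 C \<odot> Zer D X Z0 = g \<odot> t" using z comp_zer[OF b X] by simp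
  then obtain c where c: "c \<in> Hom D (Shift D X) (Shift D A)"
      "ShiftA D t \<odot> Neg D (ShiftA D (Idn D X)) = Neg D (ShiftA D f) \<odot> c"
    using TR3[OF conjunct2[OF R1] conjunct1[OF R1] conjunct2[OF R2] conjunct1[OF R2] t b] by blast
  obtain s where s: "s \<in> Hom D X A" "ShiftA D s = c" using ShiftA_surj[OF X A c(1)] .
  have "Neg D (ShiftA D t) = Neg D (ShiftA D (f \<odot> s))"
    using c(2) s comp_neg[OF ShiftA_hom[OF id_hom[OF X]] ShiftA_hom[OF t]] shift_comp[OF id_hom[OF X] t]
      id_right[OF t] neg_comp[OF ShiftA_hom[OF s(1)] ShiftA_hom[OF f]] shift_comp[OF s(1) f] by simp
  then have "ShiftA D t = ShiftA D (f \<odot> s)"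
    using neg_neg[OF ShiftA_hom[OF t]] neg_neg[OF ShiftA_hom[OF comp_hom[OF s(1) f]]] by metis
  then have "f \<odot> s = t" using ShiftA_inj[OF t comp_hom[OF s(1) f]] by simp
  then show ?thesis using that s(1) by blast
qed

lemma lift_contravariant:
  assumes T: "tri A B C f g h" and t: "t \<in> Hom D B X" and z: "t \<odot> f = Zer D A X"
  obtains s where "s \<in> Hom D C X" "s \<odot> g = t"
proof -
  obtain Z0 where z0: "zero_object D Z0" by (rule obtain_zero)
  have X: "X \<in> Ob D" and A: "A \<in> Ob D" using Hom_obs[OF t] triE[OF T] by simp_all
  have Z: "Z0 \<in> Ob D" using z0 zero_ob by blast
  have R: "tri Z0 X X (Zer D Z0 X) (Idn D X) (Zer D X (Shift D Z0))" using tri_id'[OF X z0] .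
  have a: "Zer D A Z0 \<in> Hom D A Z0" using A Z by blast
  have "t \<odot> f = Zer D Z0 X \<odot> Zer D A Z0" using z comp_zer[OF zer_hom[OF Z X] A] by simp
  then obtain c where "c \<in> Hom D C X" "c \<odot> g = Idn D X \<odot> t"
    using TR3[OF conjunct2[OF T] conjunct1[OF T] conjunct2[OF R] conjunct1[OF R] a t] by blast
  then show ?thesis using that id_left[OF t] by simp
qed

lemma exact_rot: "exact_triangle D A B C \<Longrightarrow> exact_triangle D B C (Shift D A)"
  unfolding exact_triangle_def using tri_rot by blast

text \<open>
  Inverse rotation changes the sign of an arrow, which the vertices of the triangle do not see.
\<close>

lemma exact_unrot: "exact_triangle D B C (Shift D A) \<Longrightarrow> A \<in> Ob D \<Longrightarrow> exact_triangle D A B C"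
  unfolding exact_triangle_def using tri_unrot by metis

lemma exact_rot_back: "exact_triangle D A B C \<Longrightarrow> exact_triangle D (Unshift D C) A B"
  using exact_unrot[of A B "Unshift D C"] exact_obs[of A B C] by (simp add: Unshift_ob)

lemma exact_shift: "exact_triangle D A B C \<Longrightarrow> exact_triangle D (Shift D A) (Shift D B) (Shift D C)"
  using exact_rot by blast

lemma exact_unshift: "exact_triangle D (Shift D A) (Shift D B) (Shift D C) \<Longrightarrow>
    A \<in> Ob D \<Longrightarrow> B \<in> Ob D \<Longrightarrow> C \<in> Ob D \<Longrightarrow> exact_triangle D A B C"
  using exact_unrot by blast

lemma exact_Unshift: "exact_triangle D A B C \<Longrightarrow> exact_triangle D (Unshift D A) (Unshift D B) (Unshift D C)"
  using exact_unshift[of "Unshift D A" "Unshift D B" "Unshift D C"] exact_obs[of A B C]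
  by (simp add: Unshift_ob)

lemma orth_ext_left: assumes "exact_triangle D A B C" "orth D A Y" "orth D C Y" shows "orth D B Y"
proof -
  obtain f g h where T: "tri A B C f g h" using assms(1) unfolding exact_triangle_def by blast
  show ?thesis
  proof (rule orthI)
    show "B \<in> Ob D" "Y \<in> Ob D" using exact_obs[OF assms(1)] orth_obs[OF assms(2)] by auto
    fix t assume t: "t \<in> Hom D B Y"
    have "t \<odot> f = Zer D A Y" using orthD[OF assms(2) comp_hom[OF _ t]] T triD by blast
    then obtain s where "s \<in> Hom D C Y" "s \<odot> g = t" using lift_contravariant[OF T t] by metis
    then show "t = Zer D B Y"
      using orthD[OF assms(3)] zer_comp[of g B C Y] T triD orth_obs[OF assms(2)] by metis
  qed
qed

lemma orth_ext_right: assumes "exact_triangle D A B C" "orth D X A" "orth D X C" shows "orth D X B"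
proof -
  obtain f g h where T: "tri A B C f g h" using assms(1) unfolding exact_triangle_def by blast
  show ?thesis
  proof (rule orthI)
    show "B \<in> Ob D" "X \<in> Ob D" using exact_obs[OF assms(1)] orth_obs[OF assms(2)] by auto
    fix t assume t: "t \<in> Hom D X B"
    have "g \<odot> t = Zer D X C" using orthD[OF assms(3) comp_hom[OF t]] T triD by blast
    then obtain s where "s \<in> Hom D X A" "f \<odot> s = t" using lift_covariant[OF T t] by metis
    then show "t = Zer D X B"
      using orthD[OF assms(2)] comp_zer[of f A B X] T triD orth_obs[OF assms(2)] by metis
  qed
qed

lemma exact_zero_right: "A \<in> Ob D \<Longrightarrow> zero_object D Z0 \<Longrightarrow> exact_triangle D A A Z0"
  using tri_id unfolding exact_triangle_def by blast

lemma exact_zero_left: "A \<in> Ob D \<Longrightarrow> zero_object D Z0 \<Longrightarrow> exact_triangle D Z0 A A"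
  using tri_id' unfolding exact_triangle_def by blast

lemma exact_iso:
  assumes "exact_triangle D A B C" "isomorphic D A A'" "isomorphic D B B'" "isomorphic D C C'"
  shows "exact_triangle D A' B' C'"
proof -
  obtain f g h where T: "tri A B C f g h" using assms(1) unfolding exact_triangle_def by blast
  note [simp] = triD[OF conjunct1[OF T]]
  obtain a a' where a: "a \<in> Hom D A A'" "a' \<in> Hom D A' A" "a' \<odot> a = Idn D A" "a \<odot> a' = Idn D A'"
    using isomorphicE[OF assms(2)] .
  obtain b b' where b: "b \<in> Hom D B B'" "b' \<in> Hom D B' B" "b' \<odot> b = Idn D B" "b \<odot> b' = Idn D B'"
    using isomorphicE[OF assms(3)] .
  obtain c c' where c: "c \<in> Hom D C C'" "c' \<in> Hom D C' C" "c' \<odot> c = Idn D C" "c \<odot> c' = Idn D C'"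
    using isomorphicE[OF assms(4)] .
  let ?f = "b \<odot> (f \<odot> a')" and ?g = "c \<odot> (g \<odot> b')" and ?h = "ShiftA D a \<odot> (h \<odot> c')"
  have sh: "tri_shape D A' B' C' ?f ?g ?h"
    unfolding tri_shape_def using a b c comp_hom ShiftA_hom by (meson T triD)
  have cancel: "(q \<odot> (p \<odot> r')) \<odot> r = q \<odot> p" if "r' \<odot> r = Idn D R" "r \<in> Hom D R R'" "r' \<in> Hom D R' R"
    "p \<in> Hom D R S" "q \<in> Hom D S S'" for q p r' r R R' S S'
    using comp_assoc[OF that(2) comp_hom[OF that(3,4)] that(5)] comp_assoc[OF that(2,3,4)]
      id_right[OF that(4)] that(1) by simp
  have "(?f, ?g, ?h) \<in> Tri D"
  proof (rule TR1_iso[OF conjunct2[OF T] conjunct1[OF T] sh a(1) b(1) c(1)])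
    show "is_iso D a" "is_iso D b" "is_iso D c" using isoI a b c by blast+
    show "b \<odot> f = ?f \<odot> a" using cancel[OF a(3,1,2) triE(1)[OF T] b(1)] by simp
    show "c \<odot> g = ?g \<odot> b" using cancel[OF b(3,1,2) triE(2)[OF T] c(1)] by simp
    show "ShiftA D a \<odot> h = ?h \<odot> c" using cancel[OF c(3,1,2) triE(3)[OF T] ShiftA_hom[OF a(1)]] by simp
  qed
  then show ?thesis using sh unfolding exact_triangle_def by blast
qed

text \<open>
  Lifting the identity of \<open>B\<close> gives a right inverse of \<open>f\<close>; lifting the identity of \<open>A[1]\<close> on the rotated
  triangle gives a left inverse.
\<close>

lemma tri_zero_cone_iso: assumes T: "tri A B C f g h" and z: "zero_object D C"
  obtains r where "r \<in> Hom D B A" "r \<odot> f = Idn D A" "f \<odot> r = Idn D B"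
proof -
  note t = triD[OF conjunct1[OF T]]
  have "g \<odot> Idn D B = Zer D B C" using zero_orth(2)[OF z t(5)] id_right t(2) orthD by metis
  then obtain s where s: "s \<in> Hom D B A" "f \<odot> s = Idn D B"
    using lift_covariant[OF T id_hom[OF t(5)]] by metis
  have R: "tri C (Shift D A) (Shift D B) h (Neg D (ShiftA D f)) (Neg D (ShiftA D g))"
    using tri_rot[OF tri_rot[OF T]] .
  have SA: "Shift D A \<in> Ob D" using t by blast
  have "Idn D (Shift D A) \<odot> h = Zer D C (Shift D A)"
    using zero_orth(1)[OF z SA] id_left[OF t(3)] orthD t(3) by metis
  then obtain q where q: "q \<in> Hom D (Shift D B) (Shift D A)"
     "q \<odot> Neg D (ShiftA D f) = Idn D (Shift D A)"
    using lift_contravariant[OF R id_hom[OF SA]] by metis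
  obtain r where r: "r \<in> Hom D B A" "ShiftA D r = Neg D q" using ShiftA_surj[OF t(5,4) neg_hom[OF q(1)]] .
  have "ShiftA D (r \<odot> f) = ShiftA D (Idn D A)"
    using shift_comp[OF t(1) r(1)] r(2) neg_comp[OF ShiftA_hom[OF t(1)] q(1)]
      comp_neg[OF ShiftA_hom[OF t(1)] q(1)] q(2) shift_id[OF t(4)] by simp
  then have rf: "r \<odot> f = Idn D A" using ShiftA_inj[OF comp_hom[OF t(1) r(1)] id_hom[OF t(4)]] by simp
  have "r = s"
    using comp_assoc[OF s(1) t(1) r(1)] rf s id_left[OF s(1)] id_right[OF r(1)] by simp
  then show ?thesis using that r rf s by blast
qed

lemma exact_cone_zero: assumes "exact_triangle D A B C" "zero_object D C" shows "isomorphic D A B"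
proof -
  obtain f g h where T: "tri A B C f g h" using assms(1) unfolding exact_triangle_def by blast
  then show ?thesis using tri_zero_cone_iso[OF T assms(2)] isomorphicI triD(1) by metis
qed

lemma exact_fibre_zero: assumes "exact_triangle D A B C" "zero_object D A" shows "isomorphic D B C"
  using exact_cone_zero[OF exact_rot[OF assms(1)] zero_shift[OF assms(2)]] .

lemma isomorphic_exact: assumes "isomorphic D A B" "zero_object D Z0" shows "exact_triangle D A B Z0"
  using exact_iso[OF exact_zero_right[OF _ assms(2)] isomorphic_refl assms(1) isomorphic_refl]
    isomorphic_obs[OF assms(1)] zero_ob[OF assms(2)] by blast

lemma orth_iso_left: assumes "isomorphic D A B" "orth D A Y" shows "orth D B Y"
proof -
  obtain Z0 where z: "zero_object D Z0" by (rule obtain_zero)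
  show ?thesis using orth_ext_left[OF isomorphic_exact[OF assms(1) z] assms(2)] zero_orth[OF z] orth_obs[OF assms(2)] by blast
qed

lemma orth_iso_right: assumes "isomorphic D A B" "orth D Y A" shows "orth D Y B"
proof -
  obtain Z0 where z: "zero_object D Z0" by (rule obtain_zero)
  show ?thesis using orth_ext_right[OF isomorphic_exact[OF assms(1) z] assms(2)] zero_orth[OF z] orth_obs[OF assms(2)] by blast
qed

lemma zero_iso: assumes "isomorphic D A B" "zero_object D A" shows "zero_object D B"
  using assms orth_iso_left orth_iso_right unfolding zero_object_orth by blast

lemma octahedron_tri:
  assumes "tri X Y Z' f u1 v1" "tri Y Z X' g u2 v2" "tri X Z Y' (g \<odot> f) u3 v3"
  shows "exact_triangle D Z' Y' X'"
proof -
  obtain m n where mn: "m \<in> Hom D Z' Y'" "n \<in> Hom D Y' X'" "(m, n, ShiftA D u1 \<odot> v2) \<in> Tri D"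
    using TR4[of f u1 v1 X Y Z' g u2 v2 Z X' u3 v3 Y'] assms by blast
  have "ShiftA D u1 \<odot> v2 \<in> Hom D X' (Shift D Z')"
    using assms comp_hom ShiftA_hom by (meson triD)
  then show ?thesis using mn unfolding exact_triangle_def tri_shape_def by blast
qed

text \<open>
  The octahedral axiom as an operation on filtrations: a two-step filtration \<open>X \<rightarrow> Y \<rightarrow> Z\<close> makes the
  cone of the composite an extension of the two cones.
\<close>

lemma octahedron:
  assumes "exact_triangle D X Y Z'" "exact_triangle D Y Z X'"
  obtains Y' where "exact_triangle D X Z Y'" "exact_triangle D Z' Y' X'"
proof -
  obtain f u1 v1 where 1: "tri X Y Z' f u1 v1" using assms unfolding exact_triangle_def by blast
  obtain g u2 v2 where 2: "tri Y Z X' g u2 v2" using assms unfolding exact_triangle_def by blast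
  have "g \<odot> f \<in> Hom D X Z" using 1 2 comp_hom by (meson triD)
  then obtain Y' u3 v3 where 3: "tri X Z Y' (g \<odot> f) u3 v3" using TR1_cone by metis
  show ?thesis using that octahedron_tri[OF 1 2 3] 3 unfolding exact_triangle_def by blast
qed

text \<open>
  The same for quotients: the fibre of a composite \<open>E \<rightarrow> E' \<rightarrow> B\<close> is an extension of the two fibres.
\<close>

lemma octahedron_fibre:
  assumes "exact_triangle D A E E'" "exact_triangle D K' E' B"
  obtains K where "exact_triangle D K E B" "exact_triangle D A K K'"
proof -
  have obs: "A \<in> Ob D" "K' \<in> Ob D" using assms exact_obs by blast+
  obtain Y where Y: "exact_triangle D E B Y" "exact_triangle D (Shift D A) Y (Shift D K')"
    using octahedron[OF exact_rot[OF assms(1)] exact_rot[OF assms(2)]] .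
  have YO: "Y \<in> Ob D" using Y exact_obs by blast
  show ?thesis
  proof (rule that[of "Unshift D Y"])
    show "exact_triangle D (Unshift D Y) E B" using exact_rot_back[OF Y(1)] .
    show "exact_triangle D A (Unshift D Y) K'"
      using exact_unshift[of A "Unshift D Y" K'] Y YO obs by (simp add: Unshift_ob)
  qed
qed

text \<open>
  A version that remembers the arrow \<open>S' \<rightarrow> Q\<close>. In applications \<open>C' \<rightarrow> C \<rightarrow> Q\<close> is the truncation
  of the cone of \<open>f\<close>, so that \<open>I\<close> plays the role of the image of \<open>f\<close>.
\<close>

lemma octahedron_fibre_map:
  assumes T: "tri S S' C f g h" and e: "tri C' C Q a q b"
  obtains I j k where "tri I S' Q j (q \<odot> g) k" "exact_triangle D S I C'"
proof -
  note t = triD[OF conjunct1[OF T]] and te = triD[OF conjunct1[OF e]]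
  have qg: "q \<odot> g \<in> Hom D S' Q" using comp_hom[OF t(2) te(2)] .
  obtain Y u v where 3: "tri S' Q Y (q \<odot> g) u v" using TR1_cone[OF qg] by metis
  have Y: "exact_triangle D (Shift D S) Y (Shift D C')"
    using octahedron_tri[OF tri_rot[OF T] tri_rot[OF e] 3] .
  have YO: "Y \<in> Ob D" using Y exact_obs by blast
  have "tri S' Q (Shift D (Unshift D Y)) (q \<odot> g) u v" using 3 YO by simp
  then obtain j where j: "tri (Unshift D Y) S' Q j (q \<odot> g) u" using tri_unrot[OF _ Unshift_ob[OF YO]] by metis
  have "exact_triangle D S (Unshift D Y) C'"
    using exact_unshift[of S "Unshift D Y" C'] Y YO t te by (simp add: Unshift_ob)
  then show ?thesis using that j by blast
qed

text \<open>
  If the connecting arrow vanishes, \<open>Y \<rightarrow> C\<close> has a section, and the octahedron on the section followed by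
  \<open>Y \<rightarrow> C\<close> identifies the cone of the section with \<open>A\<close>.
\<close>

lemma split_triangle:
  assumes e: "exact_triangle D A Y C" and o: "orth D C (Shift D A)" shows "exact_triangle D C Y A"
proof -
  obtain f g h where T: "tri A Y C f g h" using e unfolding exact_triangle_def by blast
  note t = triD[OF conjunct1[OF T]]
  obtain Z0 where z: "zero_object D Z0" by (rule obtain_zero)
  have h: "h = Zer D C (Shift D A)" using orthD[OF o t(3)] .
  have "h \<odot> Idn D C = Zer D C (Shift D A)" using id_right[OF t(3)] h by simp
  then obtain s where s: "s \<in> Hom D C Y" "g \<odot> s = Idn D C"
    using lift_covariant[OF tri_rot[OF T] id_hom[OF t(6)]] by metis
  obtain S u v where S: "tri C Y S s u v" using TR1_cone[OF s(1)] by metis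
  have "tri C C Z0 (g \<odot> s) (Zer D C Z0) (Zer D Z0 (Shift D C))" using tri_id[OF t(6) z] s by simp
  then have "exact_triangle D S Z0 (Shift D A)" using octahedron_tri[OF S tri_rot[OF T]] by blast
  then have "exact_triangle D A S Z0" using exact_unrot t(4) by blast
  then have "isomorphic D S A" using exact_cone_zero z isomorphic_sym by blast
  moreover have "exact_triangle D C Y S" using S unfolding exact_triangle_def by blast
  ultimately show ?thesis using exact_iso isomorphic_refl t(5,6) by blast
qed

text \<open>
  The slices of the glued slicing are closed under extensions, hence by this lemma under biproducts.
\<close>

lemma biproduct_exact: assumes "biproduct D A B S" shows "exact_triangle D A S B"
proof -
  obtain i j p q where AB: "A \<in> Ob D" "B \<in> Ob D" "S \<in> Ob D" and
    b: "i \<in> Hom D A S" "j \<in> Hom D B S" "p \<in> Hom D S A" "q \<in> Hom D S B"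
    "p \<odot> i = Idn D A" "q \<odot> j = Idn D B" "p \<odot> j = Zer D B A" "q \<odot> i = Zer D A B"
    "i \<odot> p \<oplus>\<oplus> j \<odot> q = Idn D S"
    using assms unfolding biproduct_def by blast
  obtain C g h where T: "tri A S C i g h" using TR1_cone[OF b(1)] by metis
  note t = triD[OF conjunct1[OF T]]
  obtain s where s: "s \<in> Hom D C B" "s \<odot> g = q" using lift_contravariant[OF T b(4,8)] .
  have gj: "g \<odot> j \<in> Hom D B C" using comp_hom b t by blast
  have 1: "s \<odot> (g \<odot> j) = Idn D B" using comp_assoc[OF b(2) t(2) s(1)] s(2) b(6) by simp
  have gi: "g \<odot> i = Zer D A C" using tri_comp_zer[OF T] .
  have h0: "h = Zer D C (Shift D A)"
  proof -
    have "Neg D (ShiftA D i) \<odot> h = Zer D C (Shift D S)"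
      using tri_comp_zer[OF tri_rot[OF tri_rot[OF T]]] .
    then have "Neg D (ShiftA D i \<odot> h) = Zer D C (Shift D S)" using neg_comp[OF t(3) ShiftA_hom[OF b(1)]] by simp
    then have ih: "ShiftA D i \<odot> h = Zer D C (Shift D S)"
      using neg_neg[OF comp_hom[OF t(3) ShiftA_hom[OF b(1)]]] neg_zer[OF t(6) Shift_ob[OF AB(3)]] by simp
    have "h = ShiftA D (p \<odot> i) \<odot> h" using b(5) shift_id[OF AB(1)] id_left[OF t(3)] by simp
    also have "\<dots> = ShiftA D p \<odot> (ShiftA D i \<odot> h)"
      using shift_comp[OF b(1,3)] comp_assoc[OF t(3) ShiftA_hom[OF b(1)] ShiftA_hom[OF b(3)]] by simp
    also have "\<dots> = Zer D C (Shift D A)" using ih comp_zer[OF ShiftA_hom[OF b(3)] t(6)] by simp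
    finally show ?thesis .
  qed
  have 2: "(g \<odot> j) \<odot> s = Idn D C"
  proof -
    have gS: "g = g \<odot> (i \<odot> p) \<oplus>\<oplus> g \<odot> (j \<odot> q)"
      using comp_add_right[OF comp_hom[OF b(3,1)] comp_hom[OF b(4,2)] t(2)] b(9) id_right[OF t(2)] by simp
    have "g \<odot> (i \<odot> p) = Zer D S C" using comp_assoc[OF b(3,1) t(2)] gi zer_comp[OF b(3) t(6)] by simp
    then have "g = g \<odot> (j \<odot> q)" using gS add_zer(2)[OF comp_hom[OF comp_hom[OF b(4,2)] t(2)]] by simp
    then have "((g \<odot> j) \<odot> s) \<odot> g = Idn D C \<odot> g"
      using comp_assoc[OF t(2) s(1) gj] s(2) comp_assoc[OF b(4,2) t(2)] id_left[OF t(2)] by simp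
    then have "((g \<odot> j) \<odot> s \<oplus>\<oplus> Neg D (Idn D C)) \<odot> g = Zer D S C"
      using comp_right_cancelI[OF comp_hom[OF s(1) gj] id_hom[OF t(6)] t(2)] by simp
    then obtain w where w: "w \<in> Hom D (Shift D A) C" "w \<odot> h = (g \<odot> j) \<odot> s \<oplus>\<oplus> Neg D (Idn D C)"
      using lift_contravariant[OF tri_rot[OF T] add_hom[OF comp_hom[OF s(1) gj] neg_hom[OF id_hom[OF t(6)]]]] by metis
    then have "(g \<odot> j) \<odot> s \<oplus>\<oplus> Neg D (Idn D C) = Zer D C C" using h0 comp_zer[OF w(1) t(6)] by simp
    then show ?thesis using eq_if_sub_zer[OF comp_hom[OF s(1) gj] id_hom[OF t(6)]] by simp
  qed
  have "isomorphic D C B" using isomorphicI[OF s(1) gj 2 1] .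
  moreover have "exact_triangle D A S C" using T unfolding exact_triangle_def by blast
  ultimately show ?thesis using exact_iso isomorphic_refl AB by blast
qed

lemma comp_left_inj: assumes T: "tri T E F f g h" and o: "orth D X (Unshift D F)"
   and s: "s \<in> Hom D X T" "s' \<in> Hom D X T" "f \<odot> s = f \<odot> s'" shows "s = s'"
proof -
  note t = triD[OF conjunct1[OF T]]
  have "tri T E (Shift D (Unshift D F)) f g h" using T t by simp
  then obtain k where R: "tri (Unshift D F) T E k f g" using tri_unrot[OF _ Unshift_ob[OF t(6)]] by metis
  have "f \<odot> (s \<oplus>\<oplus> Neg D s') = Zer D X E" using comp_left_cancelI[OF s(1,2) t(1) s(3)] .
  then obtain w where w: "w \<in> Hom D X (Unshift D F)" "k \<odot> w = s \<oplus>\<oplus> Neg D s'"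
    using lift_covariant[OF R add_hom[OF s(1) neg_hom[OF s(2)]]] by metis
  have "s \<oplus>\<oplus> Neg D s' = Zer D X T"
    using w orthD[OF o w(1)] comp_zer[of k "Unshift D F" T X] triD(1)[OF conjunct1[OF R]] Hom_obs[OF s(1)] by simp
  then show ?thesis using eq_if_sub_zer[OF s(1,2)] by simp
qed

lemma comp_right_inj: assumes T: "tri T E F f g h" and o: "orth D (Shift D T) X"
   and s: "s \<in> Hom D F X" "s' \<in> Hom D F X" "s \<odot> g = s' \<odot> g" shows "s = s'"
proof -
  note t = triD[OF conjunct1[OF T]]
  have "(s \<oplus>\<oplus> Neg D s') \<odot> g = Zer D E X" using comp_right_cancelI[OF s(1,2) t(2) s(3)] .
  then obtain w where w: "w \<in> Hom D (Shift D T) X" "w \<odot> h = s \<oplus>\<oplus> Neg D s'"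
    using lift_contravariant[OF tri_rot[OF T] add_hom[OF s(1) neg_hom[OF s(2)]]] by metis
  have "s \<oplus>\<oplus> Neg D s' = Zer D F X"
    using w orthD[OF o w(1)] zer_comp[OF t(3), of X] Hom_obs[OF s(1)] by simp
  then show ?thesis using eq_if_sub_zer[OF s(1,2)] by simp
qed

lemma decomposition_unique:
  assumes "exact_triangle D T E F" "exact_triangle D T' E F'"
    and o: "\<And>X Y. X \<in> {T, T'} \<Longrightarrow> Y \<in> {F, F'} \<Longrightarrow> orth D X Y \<and> orth D (Shift D X) Y"
  shows "isomorphic D T T' \<and> isomorphic D F F'"
proof -
  obtain f g h where T: "tri T E F f g h" using assms(1) unfolding exact_triangle_def by blast
  obtain f' g' h' where T': "tri T' E F' f' g' h'" using assms(2) unfolding exact_triangle_def by blast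
  note t = triD[OF conjunct1[OF T]] and t' = triD[OF conjunct1[OF T']]
  have ou: "orth D X (Unshift D Y)" if "X \<in> {T, T'}" "Y \<in> {F, F'}" for X Y
    using o[OF that] orth_shift[of X "Unshift D Y"] that t t' by (auto simp: Unshift_ob)
  obtain u where u: "u \<in> Hom D T T'" "f' \<odot> u = f"
    using lift_covariant[OF T' t(1) orthD[OF _ comp_hom[OF t(1) t'(2)]]] o by (metis insertCI)
  obtain v where v: "v \<in> Hom D T' T" "f \<odot> v = f'"
    using lift_covariant[OF T t'(1) orthD[OF _ comp_hom[OF t'(1) t(2)]]] o by (metis insertCI)
  have "f \<odot> (v \<odot> u) = f \<odot> Idn D T" using comp_assoc[OF u(1) v(1) t(1)] u v id_right[OF t(1)] by simp
  then have 1: "v \<odot> u = Idn D T"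
    using comp_left_inj[OF T ou comp_hom[OF u(1) v(1)] id_hom[OF t(4)]] by blast
  have "f' \<odot> (u \<odot> v) = f' \<odot> Idn D T'" using comp_assoc[OF v(1) u(1) t'(1)] u v id_right[OF t'(1)] by simp
  then have 2: "u \<odot> v = Idn D T'"
    using comp_left_inj[OF T' ou comp_hom[OF v(1) u(1)] id_hom[OF t'(4)]] by blast
  obtain p where p: "p \<in> Hom D F F'" "p \<odot> g = g'"
    using lift_contravariant[OF T t'(2) orthD[OF _ comp_hom[OF t(1) t'(2)]]] o by (metis insertCI)
  obtain q where q: "q \<in> Hom D F' F" "q \<odot> g' = g"
    using lift_contravariant[OF T' t(2) orthD[OF _ comp_hom[OF t'(1) t(2)]]] o by (metis insertCI)
  have "(q \<odot> p) \<odot> g = Idn D F \<odot> g" using comp_assoc[OF t(2) p(1) q(1)] p q id_left[OF t(2)] by simp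
  then have 3: "q \<odot> p = Idn D F"
    using comp_right_inj[OF T _ comp_hom[OF p(1) q(1)] id_hom[OF t(6)]] o by blast
  have "(p \<odot> q) \<odot> g' = Idn D F' \<odot> g'" using comp_assoc[OF t'(2) q(1) p(1)] p q id_left[OF t'(2)] by simp
  then have 4: "p \<odot> q = Idn D F'"
    using comp_right_inj[OF T' _ comp_hom[OF q(1) p(1)] id_hom[OF t'(6)]] o by blast
  show ?thesis using isomorphicI[OF u(1) v(1) 1 2] isomorphicI[OF p(1) q(1) 3 4] by blast
qed

text \<open>
  Exactness of the two projections of a semiorthogonal decomposition. The composites \<open>A2 \<rightarrow> A \<rightarrow> B\<close> and
  \<open>A2 \<rightarrow> B2 \<rightarrow> B\<close> agree; let \<open>X\<close> be the cone. The octahedra on the two factorizations give triangles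
  \<open>A1 \<rightarrow> X \<rightarrow> C\<close> and \<open>C2 \<rightarrow> X \<rightarrow> B1\<close>, and a third octahedron, on \<open>C2 \<rightarrow> X \<rightarrow> C\<close>, produces the
  decomposition of \<open>C\<close>. This replaces the nine-term diagram.
\<close>

lemma decomposition_of_triangle:
  assumes e: "exact_triangle D A B C" and A: "exact_triangle D A2 A A1" and B: "exact_triangle D B2 B B1"
    and o: "orth D A2 B1"
  obtains C1 C2 where "exact_triangle D A2 B2 C2" "exact_triangle D A1 B1 C1" "exact_triangle D C2 C C1"
proof -
  obtain f u1 v1 where T: "tri A B C f u1 v1" using e unfolding exact_triangle_def by blast
  obtain a u2 v2 where TA: "tri A2 A A1 a u2 v2" using A unfolding exact_triangle_def by blast
  obtain b u3 v3 where TB: "tri B2 B B1 b u3 v3" using B unfolding exact_triangle_def by blast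
  note t = triD[OF conjunct1[OF T]] and ta = triD[OF conjunct1[OF TA]] and tb = triD[OF conjunct1[OF TB]]
  have fa: "f \<odot> a \<in> Hom D A2 B" using comp_hom[OF ta(1) t(1)] .
  obtain r where r: "r \<in> Hom D A2 B2" "b \<odot> r = f \<odot> a"
    using lift_covariant[OF TB fa orthD[OF o comp_hom[OF fa tb(2)]]] .
  obtain X u4 v4 where X: "tri A2 B X (f \<odot> a) u4 v4" using TR1_cone[OF fa] by metis
  obtain C2 u5 v5 where C2: "tri A2 B2 C2 r u5 v5" using TR1_cone[OF r(1)] by metis
  have 1: "exact_triangle D A1 X C" using octahedron_tri[OF TA T X] .
  have "tri A2 B X (b \<odot> r) u4 v4" using X r by simp
  then have 2: "exact_triangle D C2 X B1" using octahedron_tri[OF C2 TB] by blast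
  obtain C1 where C1: "exact_triangle D C2 C C1" "exact_triangle D B1 C1 (Shift D A1)"
    using octahedron[OF 2 exact_rot[OF 1]] .
  have "exact_triangle D A2 B2 C2" using C2 unfolding exact_triangle_def by blast
  then show ?thesis using that C1 exact_unrot[OF C1(2) ta(6)] by blast
qed

end

section \<open>Full triangulated subcategories\<close>

context triangulated_category
begin

lemma iso_closedD: "iso_closed D S \<Longrightarrow> isomorphic D A B \<Longrightarrow> A \<in> S \<Longrightarrow> B \<in> S"
  unfolding iso_closed_def by blast

lemma full_subcategory_sel:
  "Ob (full_subcategory D S) = S"
  "Src (full_subcategory D S) = Src D" "Tgt (full_subcategory D S) = Tgt D"
  "Idn (full_subcategory D S) = Idn D" "Comp (full_subcategory D S) = Comp D"
  "Add (full_subcategory D S) = Add D" "Zer (full_subcategory D S) = Zer D"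
  "Shift (full_subcategory D S) = Shift D" "ShiftA (full_subcategory D S) = ShiftA D"
  by (simp_all add: full_subcategory_def)

lemma Hom_full: "Hom (full_subcategory D S) A B = (if A \<in> S \<and> B \<in> S then Hom D A B else {})"
  by (auto simp: Hom_def full_subcategory_def)

lemma Arr_full: "f \<in> Arr (full_subcategory D S) \<longleftrightarrow> f \<in> Arr D \<and> Src D f \<in> S \<and> Tgt D f \<in> S"
  by (auto simp: full_subcategory_def)

lemma hom_group_full: "A \<in> S \<Longrightarrow> B \<in> S \<Longrightarrow> hom_group (full_subcategory D S) A B = hom_group D A B"
  by (simp add: hom_group_def Hom_full full_subcategory_sel)

lemma Neg_full: "f \<in> Hom D A B \<Longrightarrow> A \<in> S \<Longrightarrow> B \<in> S \<Longrightarrow> Neg (full_subcategory D S) f = Neg D f"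
  using Hom_arr[of f A B] by (simp add: Neg_def full_subcategory_sel hom_group_full)

lemma is_iso_full: "f \<in> Hom D A B \<Longrightarrow> A \<in> S \<Longrightarrow> B \<in> S \<Longrightarrow> is_iso (full_subcategory D S) f = is_iso D f"
  using Hom_arr[of f A B] by (simp add: is_iso_def full_subcategory_sel Hom_full Arr_full)

lemma isomorphic_full: "isomorphic (full_subcategory D S) A B \<longleftrightarrow> A \<in> S \<and> B \<in> S \<and> isomorphic D A B"
  unfolding isomorphic_def Hom_full using is_iso_full by auto

lemma orth_full: "orth (full_subcategory D S) A B \<longleftrightarrow> A \<in> S \<and> B \<in> S \<and> orth D A B"
  by (auto simp: orth_def Hom_full full_subcategory_sel)

lemma zero_full: assumes "S \<subseteq> Ob D" "\<And>X. zero_object D X \<Longrightarrow> X \<in> S"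
  shows "zero_object (full_subcategory D S) X \<longleftrightarrow> zero_object D X"
proof
  assume "zero_object (full_subcategory D S) X"
  then have "X \<in> S" "Hom D X X = {Zer D X X}"
    by (auto simp: zero_object_def Hom_full full_subcategory_sel)
  then show "zero_object D X" by (simp add: zero_object_orth orth_def)
next
  assume z: "zero_object D X"
  then show "zero_object (full_subcategory D S) X"
    using assms(2)[OF z] assms(1) by (auto simp: zero_object_def Hom_full full_subcategory_sel)
qed

lemma biproduct_full: "biproduct (full_subcategory D S) A B C \<longleftrightarrow> A \<in> S \<and> B \<in> S \<and> C \<in> S \<and> biproduct D A B C"
  if "S \<subseteq> Ob D"
  using that unfolding biproduct_def full_subcategory_sel Hom_full by auto

lemma tri_shape_full: "tri_shape (full_subcategory D S) A B C f g h \<longleftrightarrow>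
    A \<in> S \<and> B \<in> S \<and> C \<in> S \<and> Shift D A \<in> S \<and> tri_shape D A B C f g h"
  by (auto simp: tri_shape_def Hom_full full_subcategory_sel)

lemma Tri_full: assumes "tri_shape D A B C f g h"
  shows "(f, g, h) \<in> Tri (full_subcategory D S) \<longleftrightarrow> (f, g, h) \<in> Tri D \<and> A \<in> S \<and> B \<in> S \<and> C \<in> S"
  using assms by (auto simp: tri_shape_def full_subcategory_def Hom_def)

lemma exact_full: assumes "\<And>A. A \<in> S \<Longrightarrow> Shift D A \<in> S"
  shows "exact_triangle (full_subcategory D S) A B C \<longleftrightarrow> A \<in> S \<and> B \<in> S \<and> C \<in> S \<and> exact_triangle D A B C"
  unfolding exact_triangle_def tri_shape_full using assms Tri_full by blast

end

locale triangulated_subcategory_of = triangulated_category +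
  fixes S :: "'a set"
  assumes sub: "triangulated_subcategory D S"
begin

abbreviation "C \<equiv> full_subcategory D S"

lemma sub_ob: "S \<subseteq> Ob D" using sub by (simp add: triangulated_subcategory_def full_additive_subcategory_def)
lemma sub_iso: "iso_closed D S" using sub by (simp add: triangulated_subcategory_def full_additive_subcategory_def)
lemma sub_zero: "zero_object D X \<Longrightarrow> X \<in> S" using sub by (simp add: triangulated_subcategory_def full_additive_subcategory_def)
lemma sub_biproduct: "A \<in> S \<Longrightarrow> B \<in> S \<Longrightarrow> biproduct D A B E \<Longrightarrow> E \<in> S"
  using sub unfolding triangulated_subcategory_def full_additive_subcategory_def by blast
lemma sub_shift: "A \<in> S \<Longrightarrow> Shift D A \<in> S" using sub unfolding triangulated_subcategory_def by blast
lemma sub_unshift: assumes "A \<in> S" shows "Unshift D A \<in> S"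
proof -
  obtain B where "B \<in> S" "A = Shift D B" using assms sub unfolding triangulated_subcategory_def by blast
  then show ?thesis using sub_ob by auto
qed
lemma sub_cone: "exact_triangle D A B E \<Longrightarrow> A \<in> S \<Longrightarrow> B \<in> S \<Longrightarrow> E \<in> S"
  using sub unfolding triangulated_subcategory_def by blast
text \<open>
  The cone of an arrow of the subcategory exists in the ambient category and has its third vertex in the subcategory;
  all other axioms are inherited.
\<close>

lemma sub_triangulated: "triangulated_category C"
proof (intro triangulated_category.intro additive_category.intro triangulated_category_axioms.intro)
  note sel = full_subcategory_sel
  have obD: "A \<in> Ob D" if "A \<in> S" for A using that sub_ob by blast
  have homD: "A \<in> S \<and> B \<in> S \<and> f \<in> Hom D A B" if "f \<in> Hom C A B" for A B f
    using that by (simp add: Hom_full split: if_splits)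
  have homI: "f \<in> Hom C A B" if "A \<in> S" "B \<in> S" "f \<in> Hom D A B" for A B f
    using that by (simp add: Hom_full)
  show "Src C f \<in> Ob C" if "f \<in> Arr C" for f using that by (simp add: Arr_full sel)
  show "Tgt C f \<in> Ob C" if "f \<in> Arr C" for f using that by (simp add: Arr_full sel)
  show "Idn C A \<in> Hom C A A" if "A \<in> Ob C" for A using that id_hom obD by (simp add: Hom_full sel)
  show "Comp C g f \<in> Hom C A E" if "f \<in> Hom C A B" "g \<in> Hom C B E" for f g A B E
    using homD[OF that(1)] homD[OF that(2)] comp_hom[of f A B g E] homI by (simp add: sel)
  show "Comp C (Idn C B) f = f" if "f \<in> Hom C A B" for f A B
    using homD[OF that] id_left[of f A B] by (simp add: sel)
  show "Comp C f (Idn C A) = f" if "f \<in> Hom C A B" for f A B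
    using homD[OF that] id_right[of f A B] by (simp add: sel)
  show "Comp C (Comp C h g) f = Comp C h (Comp C g f)" if "f \<in> Hom C A B" "g \<in> Hom C B E" "h \<in> Hom C E F" for f g h A B E F
    using homD[OF that(1)] homD[OF that(2)] homD[OF that(3)] comp_assoc[of f A B g E h F] by (simp add: sel)
  show "comm_group (hom_group C A B)" if "A \<in> Ob C" "B \<in> Ob C" for A B
    using that hom_comm_group obD by (simp add: sel hom_group_full)
  show "Comp C (Add C g g') f = Add C (Comp C g f) (Comp C g' f)"
    if "f \<in> Hom C A B" "g \<in> Hom C B E" "g' \<in> Hom C B E" for f g g' A B E
    using homD[OF that(1)] homD[OF that(2)] homD[OF that(3)] comp_add_left[of f A B g E g'] by (simp add: sel)
  show "Comp C g (Add C f f') = Add C (Comp C g f) (Comp C g f')"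
    if "f \<in> Hom C A B" "f' \<in> Hom C A B" "g \<in> Hom C B E" for f f' g A B E
    using homD[OF that(1)] homD[OF that(2)] homD[OF that(3)] comp_add_right[of f A B f' g E] by (simp add: sel)
  have zC: "zero_object C X = zero_object D X" for X using zero_full[OF sub_ob sub_zero] .
  show "\<exists>X. zero_object C X" using ex_zero_object zC by simp
  show "\<exists>E. biproduct C A B E" if AB: "A \<in> Ob C" "B \<in> Ob C" for A B
  proof -
    have "A \<in> S" "B \<in> S" using AB by (simp_all add: sel)
    then obtain E where "biproduct D A B E" using ex_biproduct obD by blast
    then show ?thesis using sub_biproduct \<open>A \<in> S\<close> \<open>B \<in> S\<close> biproduct_full[OF sub_ob] by blast
  qed
  have "Shift D ` S = S" using sub by (simp add: triangulated_subcategory_def)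
  moreover have "inj_on (Shift D) S" using shift_ob sub_ob by (auto simp: bij_betw_def intro: inj_on_subset)
  ultimately show "bij_betw (Shift C) (Ob C) (Ob C)" by (simp add: bij_betw_def sel)
  show "bij_betw (ShiftA C) (Hom C A B) (Hom C (Shift C A) (Shift C B))" if "A \<in> Ob C" "B \<in> Ob C" for A B
    using that shift_hom[of A B] obD sub_shift by (simp add: sel Hom_full)
  show "ShiftA C (Idn C A) = Idn C (Shift C A)" if "A \<in> Ob C" for A using that shift_id obD by (simp add: sel)
  show "ShiftA C (Comp C g f) = Comp C (ShiftA C g) (ShiftA C f)"
    if "f \<in> Hom C A B" "g \<in> Hom C B E" for f g A B E
    using homD[OF that(1)] homD[OF that(2)] shift_comp[of f A B g E] by (simp add: sel)
  show "ShiftA C (Add C f g) = Add C (ShiftA C f) (ShiftA C g)"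
    if "f \<in> Hom C A B" "g \<in> Hom C A B" for f g A B
    using homD[OF that(1)] homD[OF that(2)] shift_add[of f A B g] by (simp add: sel)
  have TD: "(f, g, h) \<in> Tri D" if "(f, g, h) \<in> Tri C" for f g h using that by (simp add: full_subcategory_def)
  have shI: "tri_shape C A B E f g h" if "tri_shape D A B E f g h" "A \<in> S" "B \<in> S" "E \<in> S" for A B E f g h
    using that sub_shift by (simp add: tri_shape_full)
  have shD: "tri_shape D A B E f g h \<and> A \<in> S \<and> B \<in> S \<and> E \<in> S" if "tri_shape C A B E f g h" for A B E f g h
    using that by (simp add: tri_shape_full)
  show "\<exists>A B E. tri_shape C A B E f g h" if T: "(f, g, h) \<in> Tri C" for f g h
  proof -
    obtain A B E where s: "tri_shape D A B E f g h" using tri_typed[OF TD[OF T]] by blast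
    then show ?thesis using shI[OF s] T Tri_full[OF s] by blast
  qed
  show "(f', g', h') \<in> Tri C"
    if "(f, g, h) \<in> Tri C" "tri_shape C A B E f g h" "tri_shape C A' B' E' f' g' h'"
      "a \<in> Hom C A A'" "b \<in> Hom C B B'" "c \<in> Hom C E E'" "is_iso C a" "is_iso C b" "is_iso C c"
      "Comp C b f = Comp C f' a" "Comp C c g = Comp C g' b" "Comp C (ShiftA C a) h = Comp C h' c"
    for f g h A B E A' B' E' f' g' h' a b c
  proof -
    note s = shD[OF that(2)] and s' = shD[OF that(3)]
    have i: "is_iso D a" "is_iso D b" "is_iso D c"
      using is_iso_full[of a A A'] is_iso_full[of b B B'] is_iso_full[of c E E'] s s' that(7-9)
        homD[OF that(4)] homD[OF that(5)] homD[OF that(6)] by auto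
    have "(f', g', h') \<in> Tri D"
      by (rule TR1_iso[OF TD[OF that(1)] conjunct1[OF s] conjunct1[OF s'] _ _ _ i])
        (use homD[OF that(4)] homD[OF that(5)] homD[OF that(6)] that(10-12) in \<open>simp_all add: sel\<close>)
    then show ?thesis using Tri_full[OF conjunct1[OF s']] s' by blast
  qed
  show "(Idn C A, Zer C A X, Zer C X (Shift C A)) \<in> Tri C" if "A \<in> Ob C" "zero_object C X" for A X
  proof -
    have A: "A \<in> S" "zero_object D X" using that zC by (simp_all add: sel)
    note T = tri_id[OF obD[OF A(1)] A(2)]
    show ?thesis using T Tri_full[OF conjunct1[OF T], of S] A sub_zero by (simp add: sel)
  qed
  show "\<exists>E g h. tri_shape C A B E f g h \<and> (f, g, h) \<in> Tri C" if f: "f \<in> Hom C A B" for f A B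
  proof -
    obtain E g h where T: "tri A B E f g h" using TR1_cone homD[OF f] by blast
    then have "E \<in> S" using sub_cone homD[OF f] unfolding exact_triangle_def by blast
    then show ?thesis using T shI Tri_full homD[OF f] by blast
  qed
  show "((f, g, h) \<in> Tri C) = ((g, h, Neg C (ShiftA C f)) \<in> Tri C)" if "tri_shape C A B E f g h" for A B E f g h
  proof -
    note s = shD[OF that]
    note t = triD[OF conjunct1[OF s]]
    have n: "Neg C (ShiftA C f) = Neg D (ShiftA D f)"
      using Neg_full[OF ShiftA_hom[OF t(1)]] s sub_shift by (simp add: sel)
    have sh: "tri_shape D B E (Shift D A) g h (Neg D (ShiftA D f))"
      unfolding tri_shape_def using t neg_hom[OF ShiftA_hom[OF t(1)]] by simp
    show ?thesis unfolding n using Tri_full[OF conjunct1[OF s]] Tri_full[OF sh] s sub_shift TR2[OF conjunct1[OF s]] by blast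
  qed
  show "\<exists>c \<in> Hom C E E'. Comp C c g = Comp C g' b \<and> Comp C (ShiftA C a) h = Comp C h' c"
    if "(f, g, h) \<in> Tri C" "tri_shape C A B E f g h" "(f', g', h') \<in> Tri C" "tri_shape C A' B' E' f' g' h'"
      "a \<in> Hom C A A'" "b \<in> Hom C B B'" "Comp C b f = Comp C f' a"
    for f g h A B E f' g' h' A' B' E' a b
  proof -
    note prems = that
    note s = shD[OF prems(2)] and s' = shD[OF prems(4)]
    obtain c where "c \<in> Hom D E E'" "Comp D c g = Comp D g' b" "Comp D (ShiftA D a) h = Comp D h' c"
      using TR3[OF TD[OF prems(1)] conjunct1[OF s] TD[OF prems(3)] conjunct1[OF s'], of a b]
        homD[OF prems(5)] homD[OF prems(6)] prems(7) by (auto simp: sel)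
    then show ?thesis using homI[of E E' c] s s' by (auto simp: sel)
  qed
  show "\<exists>m \<in> Hom C Z' Y'. \<exists>n \<in> Hom C Y' X'. (m, n, Comp C (ShiftA C u1) v2) \<in> Tri C \<and>
      Comp C m u1 = Comp C u3 g \<and> Comp C v3 m = v1 \<and> Comp C n u3 = u2 \<and> Comp C v2 n = Comp C (ShiftA C f) v3"
    if "(f, u1, v1) \<in> Tri C" "tri_shape C X Y Z' f u1 v1" "(g, u2, v2) \<in> Tri C" "tri_shape C Y Z X' g u2 v2"
       "(Comp C g f, u3, v3) \<in> Tri C" "tri_shape C X Z Y' (Comp C g f) u3 v3"
    for f u1 v1 X Y Z' g u2 v2 Z X' u3 v3 Y'
  proof -
    note prems = that
    note s1 = shD[OF prems(2)] and s2 = shD[OF prems(4)] and s3 = shD[OF prems(6), unfolded sel]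
    obtain m n where mn: "m \<in> Hom D Z' Y'" "n \<in> Hom D Y' X'" "(m, n, Comp D (ShiftA D u1) v2) \<in> Tri D"
      "Comp D m u1 = Comp D u3 g" "Comp D v3 m = v1" "Comp D n u3 = u2" "Comp D v2 n = Comp D (ShiftA D f) v3"
      using TR4[OF TD[OF prems(1)] conjunct1[OF s1] TD[OF prems(3)] conjunct1[OF s2]
        TD[OF prems(5), unfolded sel] conjunct1[OF s3]] by blast
    have "tri_shape D Z' Y' X' m n (Comp D (ShiftA D u1) v2)"
      unfolding tri_shape_def using mn comp_hom[OF triD(3)[OF conjunct1[OF s2]] ShiftA_hom[OF triD(2)[OF conjunct1[OF s1]]]] by simp
    then have "(m, n, Comp D (ShiftA D u1) v2) \<in> Tri C" using Tri_full mn(3) s1 s2 s3 by blast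
    moreover have "m \<in> Hom C Z' Y'" "n \<in> Hom C Y' X'" using homI mn s1 s2 s3 by blast+
    ultimately show ?thesis using mn by (auto simp: sel)
  qed
qed

lemma zero_sub: "zero_object C X \<longleftrightarrow> zero_object D X" using zero_full[OF sub_ob sub_zero] .

lemma exact_sub: "exact_triangle C A B E \<longleftrightarrow> A \<in> S \<and> B \<in> S \<and> E \<in> S \<and> exact_triangle D A B E"
  using exact_full sub_shift by blast

end

section \<open>t-structures\<close>

text \<open>
  \<open>G\<close> and \<open>L\<close> are the aisle and the coaisle shifted so that they are each other's orthogonal. Stating them as
  orthogonals makes closure under extensions and isomorphisms automatic. In the applications they consist of the objects with
  phases above, and not above, a given bound.
\<close>

definition t_structure :: "('o, 'm) tcat \<Rightarrow> 'o set \<Rightarrow> 'o set \<Rightarrow> bool" where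
  "t_structure D G L \<longleftrightarrow>
     G = {E \<in> Ob D. \<forall>F \<in> L. orth D E F} \<and> L = {F \<in> Ob D. \<forall>E \<in> G. orth D E F} \<and>
     (\<forall>E \<in> G. Shift D E \<in> G) \<and> (\<forall>E \<in> Ob D. \<exists>T \<in> G. \<exists>F \<in> L. exact_triangle D T E F)"

context triangulated_category
begin

text \<open>
  An object orthogonal to \<open>L\<close> has truncation \<open>T \<rightarrow> E \<rightarrow> F\<close> with \<open>Hom(F, F) = 0\<close>, because both \<open>E\<close> and
  \<open>T[1]\<close> are orthogonal to \<open>F\<close>; hence \<open>E \<cong> T\<close>.
\<close>

lemma t_structureI:
  assumes G: "G \<subseteq> Ob D" "iso_closed D G" "\<And>E. E \<in> G \<Longrightarrow> Shift D E \<in> G"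
    and L: "L \<subseteq> Ob D" "iso_closed D L"
    and o: "\<And>E F. E \<in> G \<Longrightarrow> F \<in> L \<Longrightarrow> orth D E F"
    and tr: "\<And>E. E \<in> Ob D \<Longrightarrow> \<exists>T \<in> G. \<exists>F \<in> L. exact_triangle D T E F"
  shows "t_structure D G L"
proof -
  have 1: "E \<in> G" if E: "E \<in> Ob D" "\<forall>F \<in> L. orth D E F" for E
  proof -
    obtain T F where T: "T \<in> G" "F \<in> L" "exact_triangle D T E F" using tr E by blast
    have "orth D F F"
      using orth_ext_left[OF exact_rot[OF T(3)]] E(2) T(2) o[OF G(3)[OF T(1)] T(2)] by blast
    then have "isomorphic D T E" using exact_cone_zero[OF T(3)] zero_object_orth by blast
    then show ?thesis using T(1) G(2) iso_closedD by blast
  qed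
  have 2: "F \<in> L" if F: "F \<in> Ob D" "\<forall>E \<in> G. orth D E F" for F
  proof -
    obtain T F' where T: "T \<in> G" "F' \<in> L" "exact_triangle D T F F'" using tr F by blast
    have ob: "T \<in> Ob D" "F' \<in> Ob D" using exact_obs[OF T(3)] by auto
    have "orth D T (Unshift D F')"
      using o[OF G(3)[OF T(1)] T(2)] orth_shift[OF ob(1) Unshift_ob[OF ob(2)]] ob by simp
    then have "orth D T T" using orth_ext_right[OF exact_rot_back[OF T(3)]] F(2) T(1) by blast
    then have "isomorphic D F F'" using exact_fibre_zero[OF T(3)] zero_object_orth by blast
    then show ?thesis using T(2) L(2) iso_closedD isomorphic_sym by blast
  qed
  have "G = {E \<in> Ob D. \<forall>F \<in> L. orth D E F}" using 1 G(1) o by (intro equalityI subsetI) auto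
  moreover have "L = {F \<in> Ob D. \<forall>E \<in> G. orth D E F}" using 2 L(1) o by (intro equalityI subsetI) auto
  ultimately show ?thesis unfolding t_structure_def using G(3) tr by simp
qed

context
  fixes G L assumes ts: "t_structure D G L"
begin

lemma ts_G_iff: "E \<in> G \<longleftrightarrow> E \<in> Ob D \<and> (\<forall>F \<in> L. orth D E F)"
  using ts unfolding t_structure_def by blast

lemma ts_L_iff: "F \<in> L \<longleftrightarrow> F \<in> Ob D \<and> (\<forall>E \<in> G. orth D E F)"
  using ts unfolding t_structure_def by blast

lemma ts_orth: "E \<in> G \<Longrightarrow> F \<in> L \<Longrightarrow> orth D E F"
  using ts_G_iff by blast

lemma ts_ob: "E \<in> G \<Longrightarrow> E \<in> Ob D" "F \<in> L \<Longrightarrow> F \<in> Ob D"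
  using ts_G_iff ts_L_iff by blast+

lemma ts_trunc: assumes "E \<in> Ob D" obtains T F where "T \<in> G" "F \<in> L" "exact_triangle D T E F"
  using ts assms unfolding t_structure_def by blast

lemma ts_G_shift: "E \<in> G \<Longrightarrow> Shift D E \<in> G"
  using ts unfolding t_structure_def by blast

lemma ts_L_unshift: assumes F: "F \<in> L" shows "Unshift D F \<in> L"
proof -
  have ob: "F \<in> Ob D" using ts_ob(2)[OF F] .
  have "orth D E (Unshift D F)" if "E \<in> G" for E
    using ts_orth[OF ts_G_shift[OF that] F] orth_shift[OF ts_ob(1)[OF that] Unshift_ob[OF ob]] ob by simp
  then show ?thesis using ts_L_iff Unshift_ob[OF ob] by blast
qed

lemma ts_zero: "zero_object D Z0 \<Longrightarrow> Z0 \<in> G" "zero_object D Z0 \<Longrightarrow> Z0 \<in> L"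
  using ts_G_iff ts_L_iff zero_orth zero_ob by blast+

lemma ts_G_ext: "exact_triangle D A B C \<Longrightarrow> A \<in> G \<Longrightarrow> C \<in> G \<Longrightarrow> B \<in> G"
  using ts_G_iff[of B] ts_orth orth_ext_left exact_obs by meson

lemma ts_L_ext: "exact_triangle D A B C \<Longrightarrow> A \<in> L \<Longrightarrow> C \<in> L \<Longrightarrow> B \<in> L"
  using ts_L_iff[of B] ts_orth orth_ext_right exact_obs by meson

lemma ts_G_cone: "exact_triangle D A B C \<Longrightarrow> A \<in> G \<Longrightarrow> B \<in> G \<Longrightarrow> C \<in> G"
  using ts_G_ext[OF exact_rot] ts_G_shift by blast

lemma ts_L_fibre: "exact_triangle D A B C \<Longrightarrow> B \<in> L \<Longrightarrow> C \<in> L \<Longrightarrow> A \<in> L"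
  using ts_L_ext[OF exact_rot_back] ts_L_unshift by blast

lemma ts_G_iso: "isomorphic D A B \<Longrightarrow> A \<in> G \<Longrightarrow> B \<in> G"
  using ts_G_iff orth_iso_left isomorphic_obs by meson

lemma ts_L_iso: "isomorphic D A B \<Longrightarrow> A \<in> L \<Longrightarrow> B \<in> L"
  using ts_L_iff orth_iso_right isomorphic_obs by meson

lemma ts_zero_if: "E \<in> G \<Longrightarrow> E \<in> L \<Longrightarrow> zero_object D E"
  using ts_orth zero_object_orth by blast

end

lemma t_structure_eq:
  assumes "t_structure D G L" "t_structure D G' L'" "G \<subseteq> G'" "L \<subseteq> L'" shows "G = G'" "L = L'"
  using ts_G_iff[OF assms(1)] ts_G_iff[OF assms(2)] ts_L_iff[OF assms(1)] ts_L_iff[OF assms(2)] assms(3,4)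
  by blast+

end

section \<open>Slicings\<close>

text \<open>
  \<open>hn D P E t b\<close>: the object \<open>E\<close> has a Harder-Narasimhan filtration whose largest phase is \<open>t\<close> and whose
  smallest phase is \<open>b\<close>. The recursion appends a quotient of smaller phase; nonzero objects only.
\<close>

inductive hn :: "('o, 'm) tcat \<Rightarrow> (real \<Rightarrow> 'o set) \<Rightarrow> 'o \<Rightarrow> real \<Rightarrow> real \<Rightarrow> bool"
  for D :: "('o, 'm) tcat" and P :: "real \<Rightarrow> 'o set" where
  single: "E \<in> P \<phi> \<Longrightarrow> \<not> zero_object D E \<Longrightarrow> hn D P E \<phi> \<phi>"
| step: "hn D P F t b \<Longrightarrow> exact_triangle D F E A \<Longrightarrow> A \<in> P \<phi> \<Longrightarrow> \<not> zero_object D A \<Longrightarrow> \<phi> < b \<Longrightarrow>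
    hn D P E t \<phi>"

lemma phase_range_base: "\<phi> \<in> I \<Longrightarrow> A \<in> P \<phi> \<Longrightarrow> A \<in> phase_range D P I"
  unfolding phase_range_def by (auto intro: ext_closure.intros)

lemma phase_range_ext: "exact_triangle D A B C \<Longrightarrow> A \<in> phase_range D P I \<Longrightarrow> C \<in> phase_range D P I \<Longrightarrow>
    B \<in> phase_range D P I"
  unfolding phase_range_def by (auto intro: ext_closure.intros)

lemma phase_range_induct [consumes 1, case_names base ext]:
  assumes "E \<in> phase_range D P I"
    and "\<And>\<phi> A. \<phi> \<in> I \<Longrightarrow> A \<in> P \<phi> \<Longrightarrow> Q A"
    and "\<And>A B C. exact_triangle D A B C \<Longrightarrow> A \<in> phase_range D P I \<Longrightarrow> C \<in> phase_range D P I \<Longrightarrow>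
      Q A \<Longrightarrow> Q C \<Longrightarrow> Q B"
  shows "Q E"
  using assms(1) unfolding phase_range_def
  by (induction rule: ext_closure.induct) (use assms(2,3) in \<open>auto simp: phase_range_def\<close>)

lemma phase_range_nonempty: "E \<in> phase_range D P I \<Longrightarrow> \<exists>\<phi>. \<phi> \<in> I"
  by (induction rule: phase_range_induct) auto

lemma phase_range_mono: "I \<subseteq> J \<Longrightarrow> phase_range D P I \<subseteq> phase_range D P J"
  unfolding phase_range_def
proof
  assume IJ: "I \<subseteq> J"
  fix E assume "E \<in> ext_closure D (\<Union> (P ` I))"
  then show "E \<in> ext_closure D (\<Union> (P ` J))"
  proof (induction rule: ext_closure.induct)
    case (base E) then show ?case using IJ by (intro ext_closure.base) auto
  next
    case (ext A C B) show ?case by (rule ext_closure.ext[OF ext.IH ext.hyps(3)])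
  qed
qed

lemma phase_range_subset_trans:
  assumes "\<And>\<phi>. \<phi> \<in> I \<Longrightarrow> P \<phi> \<subseteq> phase_range D Q J" shows "phase_range D P I \<subseteq> phase_range D Q J"
proof
  fix E assume "E \<in> phase_range D P I"
  then show "E \<in> phase_range D Q J"
  proof (induction rule: phase_range_induct)
    case (base \<phi> A) then show ?case using assms by blast
  next
    case (ext A B C) then show ?case by (metis phase_range_ext)
  qed
qed

lemma phase_range_least:
  assumes "E \<in> phase_range D P I" "\<And>\<phi>. \<phi> \<in> I \<Longrightarrow> P \<phi> \<subseteq> X"
    "\<And>A B C. exact_triangle D A B C \<Longrightarrow> A \<in> X \<Longrightarrow> C \<in> X \<Longrightarrow> B \<in> X"
  shows "E \<in> X"
  using assms(1) by (induction rule: phase_range_induct) (use assms(2,3) in blast)+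

definition up_closed :: "real set \<Rightarrow> bool" where
  "up_closed J \<longleftrightarrow> (\<forall>x \<in> J. \<forall>y \<ge> x. y \<in> J)"

lemma up_closed_rays [simp]: "up_closed {t<..}" "up_closed {t..}"
  unfolding up_closed_def by auto

locale slicing_on = triangulated_category +
  fixes P :: "real \<Rightarrow> 'a set"
  assumes slicing: "slicing D P"
begin

lemma P_ob: "A \<in> P \<phi> \<Longrightarrow> A \<in> Ob D"
  using slicing unfolding slicing_def full_additive_subcategory_def by blast
lemma P_iso: "isomorphic D A B \<Longrightarrow> A \<in> P \<phi> \<Longrightarrow> B \<in> P \<phi>"
  using slicing iso_closedD unfolding slicing_def full_additive_subcategory_def by blast
lemma P_zero: "zero_object D Z0 \<Longrightarrow> Z0 \<in> P \<phi>"
  using slicing unfolding slicing_def full_additive_subcategory_def by blast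
lemma P_shift_eq: "Shift D ` P \<phi> = P (\<phi> + 1)"
  using slicing unfolding slicing_def by blast
lemma P_shift: "A \<in> P \<phi> \<Longrightarrow> Shift D A \<in> P (\<phi> + 1)"
  using P_shift_eq by blast
lemma P_unshift: assumes "A \<in> P \<phi>" shows "Unshift D A \<in> P (\<phi> - 1)"
proof -
  have "A \<in> Shift D ` P (\<phi> - 1)" using assms P_shift_eq[of "\<phi> - 1"] by simp
  then obtain B where B: "B \<in> P (\<phi> - 1)" "A = Shift D B" by blast
  then show ?thesis using P_ob by simp
qed
lemma P_orth: "\<phi>1 > \<phi>2 \<Longrightarrow> A \<in> P \<phi>1 \<Longrightarrow> B \<in> P \<phi>2 \<Longrightarrow> orth D A B"
  using slicing unfolding slicing_def orth_def by blast

abbreviation "PR \<equiv> phase_range D P"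

lemma PR_base: "\<phi> \<in> I \<Longrightarrow> A \<in> P \<phi> \<Longrightarrow> A \<in> PR I"
  by (rule phase_range_base)

lemma PR_ext: "exact_triangle D A B C \<Longrightarrow> A \<in> PR I \<Longrightarrow> C \<in> PR I \<Longrightarrow> B \<in> PR I"
  by (rule phase_range_ext)

lemma PR_ob: "E \<in> PR I \<Longrightarrow> E \<in> Ob D"
  by (induction rule: phase_range_induct) (use P_ob exact_obs in blast)+

lemma PR_zero: "zero_object D Z0 \<Longrightarrow> \<phi> \<in> I \<Longrightarrow> Z0 \<in> PR I"
  using P_zero PR_base by blast

lemma PR_iso: assumes "E \<in> PR I" "isomorphic D E E'" shows "E' \<in> PR I"
proof -
  obtain Z0 where z: "zero_object D Z0" by (rule obtain_zero)
  obtain \<phi> where "\<phi> \<in> I" using phase_range_nonempty[OF assms(1)] by blast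
  then show ?thesis using PR_ext[OF isomorphic_exact[OF assms(2) z] assms(1)] PR_zero[OF z] by blast
qed

lemma PR_shift: "E \<in> PR I \<Longrightarrow> (\<And>\<phi>. \<phi> \<in> I \<Longrightarrow> \<phi> + 1 \<in> J) \<Longrightarrow> Shift D E \<in> PR J"
proof (induction rule: phase_range_induct)
  case (base \<phi> A) then show ?case using P_shift PR_base by blast
next
  case (ext A B C) then show ?case using PR_ext[OF exact_shift] by blast
qed

lemma PR_unshift: "E \<in> PR I \<Longrightarrow> (\<And>\<phi>. \<phi> \<in> I \<Longrightarrow> \<phi> - 1 \<in> J) \<Longrightarrow> Unshift D E \<in> PR J"
proof (induction rule: phase_range_induct)
  case (base \<phi> A) then show ?case using P_unshift PR_base by blast
next
  case (ext A B C) then show ?case using PR_ext[OF exact_Unshift] by blast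
qed

lemma PR_orth: assumes "E \<in> PR I" "F \<in> PR J" "\<And>x y. x \<in> I \<Longrightarrow> y \<in> J \<Longrightarrow> x > y" shows "orth D E F"
  using assms(1)
proof (induction rule: phase_range_induct)
  case (base \<phi> A)
  show ?case using assms(2)
    by (induction rule: phase_range_induct) (use P_orth base assms(3) orth_ext_right in blast)+
next
  case (ext A B C) then show ?case using orth_ext_left by blast
qed

lemma hn_bot_le_top: "hn D P E t b \<Longrightarrow> b \<le> t"
  by (induction rule: hn.induct) auto

lemma hn_in: "hn D P E t b \<Longrightarrow> {b..t} \<subseteq> I \<Longrightarrow> E \<in> PR I"
proof (induction rule: hn.induct)
  case (single E \<phi>) then show ?case using PR_base by auto
next
  case (step F t b E A \<phi>)
  have "b \<le> t" using hn_bot_le_top step by blast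
  then have "{b..t} \<subseteq> I" "\<phi> \<in> I" using step by auto
  then show ?case using step PR_ext PR_base by metis
qed

text \<open>
  If \<open>E \<rightarrow> A\<close> vanished, then \<open>Hom(A, A) = 0\<close>, because \<open>F[1]\<close> has phases larger than that of \<open>A\<close>.
\<close>

lemma hn_quotient: "hn D P E t b \<Longrightarrow> \<exists>A \<in> P b. \<not> zero_object D A \<and> \<not> orth D E A"
proof (induction rule: hn.induct)
  case (single E \<phi>) then show ?case using zero_object_orth by blast
next
  case (step F t b E A \<phi>)
  have "\<not> orth D E A"
  proof
    assume o: "orth D E A"
    have "Shift D F \<in> PR {b + 1..}" by (rule PR_shift[OF hn_in[OF step(1) subset_refl]]) auto
    moreover have "A \<in> PR {\<phi>}" using PR_base[OF singletonI step(3)] .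
    ultimately have "orth D (Shift D F) A" by (rule PR_orth) (use step in auto)
    then have "orth D A A" using orth_ext_left[OF exact_rot[OF step(2)] o] by blast
    then show False using step zero_object_orth by blast
  qed
  then show ?case using step by blast
qed

lemma hn_sub: "hn D P E t b \<Longrightarrow> \<exists>A \<in> P t. \<not> zero_object D A \<and> \<not> orth D A E"
proof (induction rule: hn.induct)
  case (single E \<phi>) then show ?case using zero_object_orth by blast
next
  case (step F t b E A \<phi>)
  then obtain A' where A': "A' \<in> P t" "\<not> zero_object D A'" "\<not> orth D A' F" by blast
  have "b \<le> t" using hn_bot_le_top step by blast
  then have "orth D A' (Unshift D A)" using P_orth[OF _ A'(1) P_unshift[OF step(3)]] step by auto
  then have "\<not> orth D A' E" using orth_ext_right[OF exact_rot_back[OF step(2)]] A' by blast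
  then show ?case using A' by blast
qed

text \<open>
  Extreme phases are detected by the nonzero arrows to the last factor and from the first one, so they
  are bounded by the phases of any way to build \<open>E\<close> by extensions.
\<close>

lemma hn_bounds: assumes h: "hn D P E t b" and E: "E \<in> PR I"
  shows "\<exists>x \<in> I. x \<le> b" "\<exists>y \<in> I. t \<le> y"
proof -
  obtain A where A: "A \<in> P b" "\<not> orth D E A" using hn_quotient[OF h] by blast
  show "\<exists>x \<in> I. x \<le> b"
    using PR_orth[OF E PR_base[OF singletonI A(1)]] A(2) by force
  obtain B where B: "B \<in> P t" "\<not> orth D B E" using hn_sub[OF h] by blast
  show "\<exists>y \<in> I. t \<le> y"
    using PR_orth[OF PR_base[OF singletonI B(1)] E] B(2) by force
qed

lemma hn_of_filtration:
  assumes "has_HN_filtration D P E" "\<not> zero_object D E" shows "\<exists>t b. hn D P E t b"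
proof -
  obtain n F A \<phi> where z: "zero_object D (F 0)" and E: "F n = E"
    and ex: "\<And>i. i < n \<Longrightarrow> A i \<in> P (\<phi> i) \<and> \<not> zero_object D (A i) \<and> exact_triangle D (F i) (F (Suc i)) (A i)"
    and dec: "\<And>i j. i < j \<Longrightarrow> j < n \<Longrightarrow> \<phi> i > \<phi> j"
    using assms(1) unfolding has_HN_filtration_def by blast
  have *: "hn D P (F (Suc k)) (\<phi> 0) (\<phi> k)" if "k < n" for k using that
  proof (induction k)
    case 0
    have "isomorphic D (A 0) (F (Suc 0))" using exact_fibre_zero[of "F 0"] ex[OF 0] z isomorphic_sym by blast
    then show ?case using ex[OF 0] P_iso zero_iso isomorphic_sym hn.single by meson
  next
    case (Suc k)
    note e = ex[OF Suc.prems]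
    show ?case
      by (rule hn.step[OF Suc.IH conjunct2[OF conjunct2[OF e]]]) (use e dec[of k "Suc k"] Suc.prems in auto)
  qed
  have "n \<noteq> 0" using z E assms(2) by metis
  then show ?thesis using *[of "n - 1"] E by auto
qed

lemma hn_exists: "E \<in> Ob D \<Longrightarrow> \<not> zero_object D E \<Longrightarrow> \<exists>t b. hn D P E t b"
  using hn_of_filtration slicing unfolding slicing_def by blast

lemma hn_truncate:
  assumes J: "up_closed J" "x \<in> J" "y \<notin> J"
  shows "hn D P E t b \<Longrightarrow> \<exists>T \<in> PR J. \<exists>F \<in> PR (- J). exact_triangle D T E F"
proof (induction rule: hn.induct)
  case (single E \<phi>)
  obtain Z0 where z: "zero_object D Z0" by (rule obtain_zero)
  have E: "E \<in> Ob D" using single P_ob by blast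
  have Z: "Z0 \<in> PR J" "Z0 \<in> PR (- J)" using PR_zero[OF z] J by auto
  show ?case
  proof (cases "\<phi> \<in> J")
    case True then show ?thesis using PR_base[OF True single(1)] Z exact_zero_right[OF E z] by blast
  next
    case False then show ?thesis using PR_base[of \<phi> "- J", OF _ single(1)] Z exact_zero_left[OF E z] by blast
  qed
next
  case (step F t b E A \<phi>)
  obtain Z0 where z: "zero_object D Z0" by (rule obtain_zero)
  have E: "E \<in> Ob D" using step exact_obs by blast
  show ?case
  proof (cases "\<phi> \<in> J")
    case True
    have "hn D P E t \<phi>" using step hn.step by metis
    then have "E \<in> PR J" using hn_in[of E t \<phi> J] True J(1) unfolding up_closed_def by force
    then show ?thesis using PR_zero[OF z, of y "- J"] J exact_zero_right[OF E z] by blast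
  next
    case False
    then have A: "A \<in> PR (- J)" using PR_base[of \<phi> "- J"] step by blast
    obtain T F'' where T: "T \<in> PR J" "F'' \<in> PR (- J)" "exact_triangle D T F F''" using step by blast
    obtain Y where Y: "exact_triangle D T E Y" "exact_triangle D F'' Y A" using octahedron[OF T(3) step(2)] .
    show ?thesis using PR_ext[OF Y(2) T(2) A] T(1) Y(1) by blast
  qed
qed

text \<open>
  Up-closed sets treat \<open>P(>t)\<close> and \<open>P(\<ge>t)\<close> at the same time.
\<close>

lemma t_structure_PR: assumes J: "up_closed J" "x \<in> J" "y \<notin> J" shows "t_structure D (PR J) (PR (- J))"
proof (rule t_structureI)
  show "PR J \<subseteq> Ob D" "PR (- J) \<subseteq> Ob D" using PR_ob by auto
  show "iso_closed D (PR J)" "iso_closed D (PR (- J))" using PR_iso unfolding iso_closed_def by auto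
  show "Shift D E \<in> PR J" if "E \<in> PR J" for E
    by (rule PR_shift[OF that]) (use J in \<open>auto simp: up_closed_def\<close>)
  show "orth D E F" if "E \<in> PR J" "F \<in> PR (- J)" for E F
  proof (rule PR_orth[OF that])
    fix x y assume "x \<in> J" "y \<in> - J"
    then show "y < x" using J(1) unfolding up_closed_def by (metis ComplD not_le)
  qed
  show "\<exists>T \<in> PR J. \<exists>F \<in> PR (- J). exact_triangle D T E F" if E: "E \<in> Ob D" for E
  proof (cases "zero_object D E")
    case True
    then show ?thesis using PR_zero[OF True, of x J] PR_zero[OF True, of y "- J"] J exact_zero_right[OF E True] by blast
  next
    case False
    then show ?thesis using hn_exists[OF E False] hn_truncate[OF J] by blast
  qed
qed

lemma ts_gt: "t_structure D (PR {t<..}) (PR {..t})"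
  using t_structure_PR[of "{t<..}" "t + 1" t] by (simp add: Compl_greaterThan)

lemma ts_ge: "t_structure D (PR {t..}) (PR {..<t})"
  using t_structure_PR[of "{t..}" t "t - 1"] by (simp add: Compl_atLeast)

text \<open>
  By \<open>hn_bounds\<close> all Harder-Narasimhan phases of an object of both classes lie in the intersection.
\<close>

lemma PR_Int:
  assumes "up_closed J" "up_closed (- K)" "x \<in> J \<inter> K" shows "PR (J \<inter> K) = PR J \<inter> PR K"
proof
  show "PR (J \<inter> K) \<subseteq> PR J \<inter> PR K"
    using phase_range_mono[of "J \<inter> K" J D P] phase_range_mono[of "J \<inter> K" K D P] by simp
  show "PR J \<inter> PR K \<subseteq> PR (J \<inter> K)"
  proof
    fix E assume E: "E \<in> PR J \<inter> PR K"
    show "E \<in> PR (J \<inter> K)"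
    proof (cases "zero_object D E")
      case True then show ?thesis using PR_zero assms(3) by blast
    next
      case False
      then obtain t b where h: "hn D P E t b" using hn_exists E PR_ob by blast
      obtain x y where "x \<in> J" "x \<le> b" "y \<in> K" "t \<le> y" using hn_bounds(1)[OF h] hn_bounds(2)[OF h] E by blast
      then have "u \<in> J \<inter> K" if "u \<in> {b..t}" for u
        using assms(1,2) that unfolding up_closed_def by (meson ComplD ComplI IntI atLeastAtMost_iff order_trans)
      then have "{b..t} \<subseteq> J \<inter> K" by blast
      then show ?thesis using hn_in[OF h] by blast
    qed
  qed
qed

lemma PR_singleton: "PR {\<phi>} = P \<phi>"
proof
  show "P \<phi> \<subseteq> PR {\<phi>}" using PR_base by blast
  show "PR {\<phi>} \<subseteq> P \<phi>"
  proof
    fix E assume E: "E \<in> PR {\<phi>}"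
    show "E \<in> P \<phi>"
    proof (cases "zero_object D E")
      case True then show ?thesis using P_zero by blast
    next
      case False
      then obtain t b where h: "hn D P E t b" using hn_exists E PR_ob by blast
      have "\<phi> \<le> b" "t \<le> \<phi>" using hn_bounds[OF h E] by auto
      moreover have "b \<le> t" using hn_bot_le_top[OF h] .
      ultimately have "t = \<phi>" "b = \<phi>" by auto
      then have "hn D P E \<phi> \<phi>" using h by simp
      then show ?thesis
      proof cases
        case (step F b A) then show ?thesis using hn_bot_le_top by force
      qed auto
    qed
  qed
qed

lemma PR_gt_le: "a < b \<Longrightarrow> PR {a<..b} = PR {a<..} \<inter> PR {..b}"
  using PR_Int[of "{a<..}" "{..b}" b] by (simp add: Compl_atMost greaterThanAtMost_def)
lemma PR_ge_le: "a \<le> b \<Longrightarrow> PR {a..b} = PR {a..} \<inter> PR {..b}"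
  using PR_Int[of "{a..}" "{..b}" b] by (simp add: Compl_atMost atLeastAtMost_def)
lemma PR_gt_lt: "a < b \<Longrightarrow> PR {a<..<b} = PR {a<..} \<inter> PR {..<b}"
  using PR_Int[of "{a<..}" "{..<b}" "(a + b) / 2"] by (simp add: Compl_lessThan greaterThanLessThan_def)
end

lemma filtration_of_hn:
  assumes "additive_category D" and Z: "\<And>A. A \<in> Ob D \<Longrightarrow> exact_triangle D Z0 A A" "zero_object D Z0"
    and ob: "\<And>\<phi> A. A \<in> P \<phi> \<Longrightarrow> A \<in> Ob D"
  shows "hn D P E t b \<Longrightarrow> has_HN_filtration D P E"
proof -
  have *: "hn D P E t b \<Longrightarrow> \<exists>n F A \<phi>. zero_object D (F 0) \<and> F (Suc n) = E \<and> \<phi> n = b \<and>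
     (\<forall>i<Suc n. A i \<in> P (\<phi> i) \<and> \<not> zero_object D (A i) \<and> exact_triangle D (F i) (F (Suc i)) (A i)) \<and>
     (\<forall>i j. i < j \<and> j < Suc n \<longrightarrow> \<phi> i > \<phi> j)" for E
  proof (induction rule: hn.induct)
    case (single E \<phi>)
    show ?case
      by (rule exI[of _ 0], rule exI[of _ "\<lambda>i. if i = 0 then Z0 else E"], rule exI[of _ "\<lambda>_. E"], rule exI[of _ "\<lambda>_. \<phi>"])
        (use single Z ob in auto)
  next
    case (step F t b E A \<phi>)
    then obtain n F' A' \<phi>' where *: "zero_object D (F' 0)" "F' (Suc n) = F" "\<phi>' n = b"
      "\<forall>i<Suc n. A' i \<in> P (\<phi>' i) \<and> \<not> zero_object D (A' i) \<and> exact_triangle D (F' i) (F' (Suc i)) (A' i)"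
      "\<forall>i j. i < j \<and> j < Suc n \<longrightarrow> \<phi>' i > \<phi>' j" by blast
    have le: "\<phi> < \<phi>' i" if "i < Suc n" for i
      using *(3,5) step(5) that by (cases "i = n") (auto simp: less_Suc_eq intro: less_trans)
    show ?case
      by (rule exI[of _ "Suc n"], rule exI[of _ "F'(Suc (Suc n) := E)"], rule exI[of _ "A'(Suc n := A)"],
          rule exI[of _ "\<phi>'(Suc n := \<phi>)"])
        (use * step le in \<open>auto simp: less_Suc_eq\<close>)
  qed
  show "has_HN_filtration D P E" if h: "hn D P E t b"
  proof -
    obtain n F A \<phi> where "zero_object D (F 0)" "F (Suc n) = E"
      "\<forall>i<Suc n. A i \<in> P (\<phi> i) \<and> \<not> zero_object D (A i) \<and> exact_triangle D (F i) (F (Suc i)) (A i)"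
      "\<forall>i j. i < j \<and> j < Suc n \<longrightarrow> \<phi> i > \<phi> j"
      using * h by metis
    then show ?thesis unfolding has_HN_filtration_def by metis
  qed
qed

section \<open>Additive functions and K0\<close>

definition additive_on :: "('o, 'm) tcat \<Rightarrow> ('o \<Rightarrow> complex) \<Rightarrow> bool" where
  "additive_on D \<zeta> \<longleftrightarrow> (\<forall>A B C. exact_triangle D A B C \<longrightarrow> \<zeta> B = \<zeta> A + \<zeta> C)"

lemma additive_onD: "additive_on D \<zeta> \<Longrightarrow> exact_triangle D A B C \<Longrightarrow> \<zeta> B = \<zeta> A + \<zeta> C"
  unfolding additive_on_def by blast

context triangulated_category
begin

lemma additive_zero: assumes "additive_on D \<zeta>" "zero_object D Z0" shows "\<zeta> Z0 = 0"
  using additive_onD[OF assms(1) exact_zero_right[OF zero_ob[OF assms(2)] assms(2)]] by simp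

lemma additive_iso: assumes "additive_on D \<zeta>" "isomorphic D A B" shows "\<zeta> A = \<zeta> B"
proof -
  obtain Z0 where z: "zero_object D Z0" by (rule obtain_zero)
  show ?thesis using additive_onD[OF assms(1) isomorphic_exact[OF assms(2) z]] additive_zero[OF assms(1) z] by simp
qed

lemma additive_shift: assumes "additive_on D \<zeta>" "A \<in> Ob D" shows "\<zeta> (Shift D A) = - \<zeta> A"
proof -
  obtain Z0 where z: "zero_object D Z0" by (rule obtain_zero)
  show ?thesis using additive_onD[OF assms(1) exact_rot[OF exact_zero_right[OF assms(2) z]]]
     additive_zero[OF assms(1) z] by (simp add: eq_neg_iff_add_eq_0 add.commute)
qed

lemma complex_group: "comm_group complex_add_group"
  by (rule comm_groupI) (auto simp: complex_add_group_def intro: exI[of _ "- x" for x])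

lemma K0_normal: "K0_relations D \<lhd> free_Abelian_group (Ob D)"
proof -
  interpret F: comm_group "free_Abelian_group (Ob D)" by (rule abelian_free_Abelian_group)
  show ?thesis unfolding K0_relations_def
  proof (rule F.subgroup_imp_normal, rule F.generate_is_subgroup)
    show "{frag_of B - frag_of A - frag_of C |A B C. exact_triangle D A B C} \<subseteq> carrier (free_Abelian_group (Ob D))"
    proof clarify
      fix A B C assume "exact_triangle D A B C"
      then have "A \<in> Ob D" "B \<in> Ob D" "C \<in> Ob D" using exact_obs by blast+
      then have "Poly_Mapping.keys (frag_of B - frag_of A - frag_of C) \<subseteq> Ob D"
        using keys_diff[of "frag_of B - frag_of A" "frag_of C"] keys_diff[of "frag_of B" "frag_of A"] by fastforce
      then show "frag_of B - frag_of A - frag_of C \<in> carrier (free_Abelian_group (Ob D))" by simp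
    qed
  qed
qed

lemma K0_proj_hom: "(\<lambda>x. K0_relations D #>\<^bsub>free_Abelian_group (Ob D)\<^esub> x) \<in> hom (free_Abelian_group (Ob D)) (K0 D)"
  unfolding K0_def using normal.r_coset_hom_Mod[OF K0_normal] .

lemma K0_class_carrier: "E \<in> Ob D \<Longrightarrow> K0_class D E \<in> carrier (K0 D)"
  using hom_carrier[OF K0_proj_hom] unfolding K0_class_def by auto

lemma hom_K0_frag: assumes "Z \<in> hom (K0 D) complex_add_group"
  shows "(\<lambda>x. Z (K0_relations D #>\<^bsub>free_Abelian_group (Ob D)\<^esub> x)) \<in> hom (free_Abelian_group (Ob D)) complex_add_group"
  using hom_compose[OF K0_proj_hom assms] by (simp add: o_def)

lemma hom_frag_sub: assumes "h \<in> hom (free_Abelian_group X) complex_add_group"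
  "Poly_Mapping.keys x \<subseteq> X" "Poly_Mapping.keys y \<subseteq> X" shows "h (x - y) = h x - h y"
proof -
  have k: "Poly_Mapping.keys (x - y) \<subseteq> X" using keys_diff[of x y] assms by blast
  have "h (x - y + y) = h (x - y) + h y"
    using hom_mult[OF assms(1), of "x - y" y] assms(3) k by (simp add: complex_add_group_def)
  then show ?thesis by simp
qed

lemma charge_additive: assumes "fst \<sigma> \<in> hom (K0 D) complex_add_group" shows "additive_on D (charge D \<sigma>)"
  unfolding additive_on_def
proof (intro allI impI)
  fix A B C assume e: "exact_triangle D A B C"
  interpret F: comm_group "free_Abelian_group (Ob D)" by (rule abelian_free_Abelian_group)
  let ?h = "\<lambda>x. fst \<sigma> (K0_relations D #>\<^bsub>free_Abelian_group (Ob D)\<^esub> x)"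
  have ob: "A \<in> Ob D" "B \<in> Ob D" "C \<in> Ob D" using exact_obs[OF e] by auto
  note h = hom_K0_frag[OF assms]
  let ?r = "frag_of B - frag_of A - frag_of C"
  have r: "?r \<in> K0_relations D" unfolding K0_relations_def using e by (auto intro: generate.incl)
  have kd: "Poly_Mapping.keys (frag_of B - frag_of A) \<subseteq> Ob D"
    using keys_diff[of "frag_of B" "frag_of A"] ob by auto
  have kr: "Poly_Mapping.keys ?r \<subseteq> Ob D" using keys_diff[of "frag_of B - frag_of A" "frag_of C"] kd ob by auto
  have sub: "subgroup (K0_relations D) (free_Abelian_group (Ob D))" using K0_normal by (rule normal_imp_subgroup)
  have "K0_relations D #>\<^bsub>free_Abelian_group (Ob D)\<^esub> ?r = K0_relations D #>\<^bsub>free_Abelian_group (Ob D)\<^esub> 0"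
    using F.coset_join2[OF _ sub r] F.coset_join2[OF _ sub subgroup.one_closed[OF sub]] kr by simp
  then have "?h ?r = ?h 0" by simp
  also have "?h 0 = 0" using hom_frag_sub[OF h, of 0 0] by simp
  finally have "?h ?r = 0" .
  moreover have "?h ?r = ?h (frag_of B) - ?h (frag_of A) - ?h (frag_of C)"
    using hom_frag_sub[OF h kd] hom_frag_sub[OF h] ob by simp
  ultimately show "charge D \<sigma> B = charge D \<sigma> A + charge D \<sigma> C"
    unfolding charge_def K0_class_def by (simp add: algebra_simps)
qed

text \<open>
  The universal property of the Grothendieck group; restricting to its carrier gives the normal form that a
  stability condition requires.
\<close>

lemma K0_hom_of_additive: assumes a: "additive_on D \<zeta>"
  obtains Z where "Z \<in> hom (K0 D) complex_add_group \<inter> extensional (carrier (K0 D))"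
    "\<And>E. E \<in> Ob D \<Longrightarrow> Z (K0_class D E) = \<zeta> E"
proof -
  interpret CG: comm_group complex_add_group by (rule complex_group)
  interpret F: comm_group "free_Abelian_group (Ob D)" by (rule abelian_free_Abelian_group)
  obtain h where h: "h \<in> hom (free_Abelian_group (Ob D)) complex_add_group"
      "\<And>x. x \<in> Ob D \<Longrightarrow> h (frag_of x) = \<zeta> x"
    using CG.free_Abelian_group_universal[of \<zeta> "Ob D"] by (auto simp: complex_add_group_def)
  interpret gh: group_hom "free_Abelian_group (Ob D)" complex_add_group h
    using h(1) by unfold_locales
  have "K0_relations D \<subseteq> kernel (free_Abelian_group (Ob D)) complex_add_group h"
    unfolding K0_relations_def
  proof (rule F.generate_subgroup_incl[OF _ gh.subgroup_kernel], clarify)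
    fix A B C assume e: "exact_triangle D A B C"
    have ob: "A \<in> Ob D" "B \<in> Ob D" "C \<in> Ob D" using exact_obs[OF e] by auto
    have kd: "Poly_Mapping.keys (frag_of B - frag_of A) \<subseteq> Ob D"
      using keys_diff[of "frag_of B" "frag_of A"] ob by auto
    have kr: "Poly_Mapping.keys (frag_of B - frag_of A - frag_of C) \<subseteq> Ob D"
      using keys_diff[of "frag_of B - frag_of A" "frag_of C"] kd ob by auto
    have "h (frag_of B - frag_of A - frag_of C) = 0"
      using hom_frag_sub[OF h(1) kd] hom_frag_sub[OF h(1)] ob h(2) additive_onD[OF a e] by simp
    then show "frag_of B - frag_of A - frag_of C \<in> kernel (free_Abelian_group (Ob D)) complex_add_group h"
      using kr by (simp add: kernel_def complex_add_group_def)
  qed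
  then obtain g where g: "g \<in> hom (K0 D) complex_add_group"
      "\<And>x. x \<in> carrier (free_Abelian_group (Ob D)) \<Longrightarrow> g (K0_relations D #>\<^bsub>free_Abelian_group (Ob D)\<^esub> x) = h x"
    unfolding K0_def using gh.FactGroup_universal_kernel[OF K0_normal] by blast
  let ?Z = "restrict g (carrier (K0 D))"
  have grp: "group (K0 D)" unfolding K0_def using K0_normal by (rule normal.factorgroup_is_group)
  have "?Z \<in> hom (K0 D) complex_add_group"
    using g(1) group.is_monoid[OF grp] by (auto simp: hom_def monoid.m_closed Pi_def)
  moreover have "?Z (K0_class D E) = \<zeta> E" if E: "E \<in> Ob D" for E
    using K0_class_carrier[OF E] g(2)[of "frag_of E"] h(2)[OF E] E by (simp add: K0_class_def)
  ultimately show ?thesis using that[of ?Z] by blast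
qed

lemma K0_hom_unique:
  assumes Z: "Z \<in> hom (K0 D) complex_add_group \<inter> extensional (carrier (K0 D))"
    and Z': "Z' \<in> hom (K0 D) complex_add_group \<inter> extensional (carrier (K0 D))"
    and eq: "\<And>E. E \<in> Ob D \<Longrightarrow> Z (K0_class D E) = Z' (K0_class D E)"
  shows "Z = Z'"
proof (rule extensionalityI)
  show "Z \<in> extensional (carrier (K0 D))" "Z' \<in> extensional (carrier (K0 D))" using Z Z' by auto
  fix x assume "x \<in> carrier (K0 D)"
  then obtain y where y: "Poly_Mapping.keys y \<subseteq> Ob D" "x = K0_relations D #>\<^bsub>free_Abelian_group (Ob D)\<^esub> y"
    unfolding K0_def by (auto simp: FactGroup_def RCOSETS_def)
  let ?p = "\<lambda>x. K0_relations D #>\<^bsub>free_Abelian_group (Ob D)\<^esub> x"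
  note h = hom_K0_frag[of Z] and h' = hom_K0_frag[of Z']
  have "Z (?p y) = Z' (?p y)"
  proof (rule free_Abelian_group_induct[OF y(1)])
    show "Z (?p 0) = Z' (?p 0)"
      using hom_frag_sub[OF h, of 0 0] hom_frag_sub[OF h', of 0 0] Z Z' by simp
    show "Z (?p (u - v)) = Z' (?p (u - v))"
      if "Poly_Mapping.keys u \<subseteq> Ob D" "Poly_Mapping.keys v \<subseteq> Ob D" "Z (?p u) = Z' (?p u)" "Z (?p v) = Z' (?p v)" for u v
      using hom_frag_sub[OF h that(1,2)] hom_frag_sub[OF h' that(1,2)] Z Z' that by simp
    show "Z (?p (frag_of a)) = Z' (?p (frag_of a))" if "a \<in> Ob D" for a
      using eq[OF that] unfolding K0_class_def .
  qed
  then show "Z x = Z' x" using y by simp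
qed

end

section \<open>Half planes and phases\<close>

text \<open>
  The imaginary part of \<open>z\<close> after rotating the ray of phase \<open>\<phi>\<close> to the positive real axis: it is positive for phases in
  \<open>(\<phi>, \<phi>+1)\<close>. Being additive in \<open>z\<close>, its sign can be controlled along extensions, which is not true
  of the phase itself.
\<close>

definition hgt :: "real \<Rightarrow> complex \<Rightarrow> real" where "hgt \<phi> z = Im (cis (- (pi * \<phi>)) * z)"
text \<open>
  The corresponding real part: positive for phases within \<open>1/2\<close> of \<open>\<phi>\<close>. It serves as a length function.
\<close>

definition wid :: "real \<Rightarrow> complex \<Rightarrow> real" where "wid \<phi> z = Re (cis (- (pi * \<phi>)) * z)"

lemma hgt_simps [simp]: "hgt \<phi> (z + w) = hgt \<phi> z + hgt \<phi> w" "hgt \<phi> (- z) = - hgt \<phi> z" "hgt \<phi> 0 = 0"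
  "hgt \<phi> (z - w) = hgt \<phi> z - hgt \<phi> w"
  by (simp_all add: hgt_def algebra_simps)

lemma wid_simps [simp]: "wid \<phi> (z + w) = wid \<phi> z + wid \<phi> w" "wid \<phi> (- z) = - wid \<phi> z" "wid \<phi> 0 = 0"
  "wid \<phi> (z - w) = wid \<phi> z - wid \<phi> w"
  by (simp_all add: wid_def algebra_simps)

lemma exp_phase: "exp (\<i> * complex_of_real (pi * \<phi>)) = cis (pi * \<phi>)"
  by (simp add: cis_conv_exp)

lemma rotate_phase: "cis (- (pi * \<phi>)) * (complex_of_real r * cis (pi * \<psi>)) = of_real r * cis (pi * (\<psi> - \<phi>))"
proof -
  have "cis (- (pi * \<phi>)) * cis (pi * \<psi>) = cis (pi * (\<psi> - \<phi>))" by (simp add: cis_mult algebra_simps)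
  then show ?thesis by (metis mult.left_commute)
qed

lemma hgt_polar: "hgt \<phi> (of_real r * cis (pi * \<psi>)) = r * sin (pi * (\<psi> - \<phi>))"
  unfolding hgt_def rotate_phase by simp

lemma wid_polar: "wid \<phi> (of_real r * cis (pi * \<psi>)) = r * cos (pi * (\<psi> - \<phi>))"
  unfolding wid_def rotate_phase by simp

lemma abs_hgt_le: "\<bar>hgt \<phi> z\<bar> \<le> cmod z"
  using abs_Im_le_cmod[of "cis (- (pi * \<phi>)) * z"] by (simp add: hgt_def norm_mult)

lemma wid_le: "wid \<phi> z \<le> cmod z"
  using complex_Re_le_cmod[of "cis (- (pi * \<phi>)) * z"] by (simp add: wid_def norm_mult)

lemma sin_pi_pos: "0 < x \<Longrightarrow> x < 1 \<Longrightarrow> 0 < sin (pi * x)"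
  by (intro sin_gt_zero) auto

lemma sin_pi_nonneg: "0 \<le> x \<Longrightarrow> x \<le> 1 \<Longrightarrow> 0 \<le> sin (pi * x)"
  by (intro sin_ge_zero) auto

lemma sin_pi_neg: "-1 < x \<Longrightarrow> x < 0 \<Longrightarrow> sin (pi * x) < 0"
  using sin_pi_pos[of "- x"] by simp

lemma hgt_sign:
  assumes "0 < r" "\<bar>\<psi> - \<phi>\<bar> < 1"
  shows "hgt \<phi> (of_real r * cis (pi * \<psi>)) > 0 \<longleftrightarrow> \<psi> > \<phi>"
    "hgt \<phi> (of_real r * cis (pi * \<psi>)) < 0 \<longleftrightarrow> \<psi> < \<phi>"
    "hgt \<phi> (of_real r * cis (pi * \<psi>)) = 0 \<longleftrightarrow> \<psi> = \<phi>"
proof -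
  have *: "sin (pi * x) > 0 \<longleftrightarrow> x > 0" "sin (pi * x) < 0 \<longleftrightarrow> x < 0" if "\<bar>x\<bar> < 1" for x
    using sin_pi_pos[of x] sin_pi_neg[of x] that by (cases "x > 0"; cases "x = 0"; force)+
  show 1: "hgt \<phi> (of_real r * cis (pi * \<psi>)) > 0 \<longleftrightarrow> \<psi> > \<phi>"
    and 2: "hgt \<phi> (of_real r * cis (pi * \<psi>)) < 0 \<longleftrightarrow> \<psi> < \<phi>"
    unfolding hgt_polar using *[OF assms(2)] assms(1) by (simp_all add: zero_less_mult_iff mult_less_0_iff)
  show "hgt \<phi> (of_real r * cis (pi * \<psi>)) = 0 \<longleftrightarrow> \<psi> = \<phi>" using 1 2 by linarith
qed

lemma hgt_minus_one: "hgt (\<phi> - 1) z = - hgt \<phi> z"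
proof -
  have "cis (- (pi * (\<phi> - 1))) = - cis (- (pi * \<phi>))"
    by (rule complex_eqI) (simp_all add: algebra_simps cos_add sin_add cos_diff sin_diff)
  then show ?thesis by (simp add: hgt_def)
qed

lemma cos_pi_ge: assumes "\<bar>x\<bar> \<le> w" "w < 1/2" shows "cos (pi * w) \<le> cos (pi * x)"
proof -
  have "cos (pi * w) \<le> cos (pi * \<bar>x\<bar>)"
  proof (rule cos_monotone_0_pi_le)
    show "0 \<le> pi * \<bar>x\<bar>" by simp
    show "pi * \<bar>x\<bar> \<le> pi * w" using assms by simp
    have "pi * w \<le> pi * 1" using assms by (intro mult_left_mono) auto
    then show "pi * w \<le> pi" by simp
  qed
  also have "cos (pi * \<bar>x\<bar>) = cos (pi * x)" by (cases "0 \<le> x") auto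
  finally show ?thesis .
qed

lemma cos_pi_pos: assumes "0 \<le> w" "w < 1/2" shows "0 < cos (pi * w)"
proof (rule cos_gt_zero_pi)
  have "0 \<le> pi * w" using assms by simp
  then show "- (pi / 2) < pi * w" using pi_gt_zero by linarith
  have "pi * w < pi * (1/2)" using assms by (intro mult_strict_left_mono) auto
  then show "pi * w < pi / 2" by simp
qed

text \<open>
  A point above the ray of phase \<open>b\<close> and not above the ray of phase \<open>c\<close> has a phase in \<open>(b, c]\<close>.
\<close>

lemma sector_phase:
  assumes "b < c" "c < b + 1" "hgt b z > 0" "hgt c z \<le> 0"
  obtains r \<psi> where "0 < r" "b < \<psi>" "\<psi> \<le> c" "z = of_real r * cis (pi * \<psi>)"
proof -
  let ?w = "cis (- (pi * b)) * z"
  have w: "Im ?w > 0" using assms(3) by (simp add: hgt_def)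
  then have a: "0 < Arg ?w" "Arg ?w < pi" using Arg_lt_pi by blast+
  define \<psi> where "\<psi> = b + Arg ?w / pi"
  have \<psi>: "b < \<psi>" "\<psi> < b + 1" using a by (auto simp: \<psi>_def)
  have z0: "z \<noteq> 0" using assms(3) by auto
  have "?w = of_real (cmod ?w) * cis (Arg ?w)" using rcis_cmod_Arg[of ?w] by (simp add: rcis_def)
  then have "?w = of_real (cmod z) * cis (Arg ?w)" by (simp add: norm_mult)
  then have "cis (pi * b) * ?w = cis (pi * b) * (of_real (cmod z) * cis (Arg ?w))" by simp
  moreover have "cis (pi * b) * ?w = z" by (simp add: cis_mult mult.assoc[symmetric])
  moreover have "cis (pi * b) * (of_real (cmod z) * cis (Arg ?w)) = of_real (cmod z) * cis (pi * \<psi>)"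
  proof -
    have "cis (pi * b) * cis (Arg ?w) = cis (pi * \<psi>)" by (simp add: cis_mult \<psi>_def algebra_simps)
    then show ?thesis by (metis mult.left_commute)
  qed
  ultimately have z: "z = of_real (cmod z) * cis (pi * \<psi>)" by simp
  have "\<psi> \<le> c"
  proof (rule ccontr)
    assume "\<not> \<psi> \<le> c"
    then have "hgt c (of_real (cmod z) * cis (pi * \<psi>)) > 0"
      using hgt_sign(1)[of "cmod z" \<psi> c] z0 \<psi> assms(1,2) by auto
    then show False using z assms(4) by simp
  qed
  then show ?thesis using that z \<psi> z0 by (metis zero_less_norm_iff)
qed

section \<open>Harder-Narasimhan filtrations in a quasi-abelian piece\<close>

text \<open>
  Two t-structures at phases \<open>b < c \<le> b+1\<close>: \<open>G = D(>b)\<close>, \<open>L = D(\<le>b)\<close>, \<open>G' = D(>c)\<close>,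
  \<open>L' = D(\<le>c)\<close>. Then \<open>Q = G \<inter> L'\<close> is the quasi-abelian category \<open>D(b, c]\<close>; other kinds of
  end points are treated in the same way. Its strict exact
  sequences are the triangles with all three vertices in \<open>Q\<close>.
\<close>

locale strip = triangulated_category +
  fixes G L G' L' :: "'a set"
  assumes ts: "t_structure D G L" and ts': "t_structure D G' L'"
    and G'_G: "G' \<subseteq> G" and G_shift: "E \<in> G \<Longrightarrow> Shift D E \<in> G'"
begin

definition "Q = G \<inter> L'"

lemma QD: "E \<in> Q \<Longrightarrow> E \<in> G \<and> E \<in> L' \<and> E \<in> Ob D"
  unfolding Q_def using ts_ob[OF ts] by blast
lemma QI: "E \<in> G \<Longrightarrow> E \<in> L' \<Longrightarrow> E \<in> Q" unfolding Q_def by blast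
lemma L_L': "F \<in> L \<Longrightarrow> F \<in> L'"
  using ts_L_iff[OF ts] ts_L_iff[OF ts'] G'_G by blast
lemma Q_ext: "exact_triangle D A E B \<Longrightarrow> A \<in> Q \<Longrightarrow> B \<in> Q \<Longrightarrow> E \<in> Q"
  unfolding Q_def using ts_G_ext[OF ts, of A E B] ts_L_ext[OF ts', of A E B] by simp
lemma Q_iso: "isomorphic D A B \<Longrightarrow> A \<in> Q \<Longrightarrow> B \<in> Q"
  using QD QI ts_G_iso[OF ts] ts_L_iso[OF ts'] by blast
lemma Q_zero: "zero_object D A \<Longrightarrow> A \<in> Q"
  using QI ts_zero[OF ts] ts_zero[OF ts'] by blast
lemma Q_orth: assumes "X \<in> Q" "Y \<in> Q" shows "orth D (Shift D X) Y" "orth D X (Unshift D Y)"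
proof -
  have X: "X \<in> G" and Y: "Y \<in> L'" using QD assms by auto
  show 1: "orth D (Shift D X) Y" by (rule ts_orth[OF ts' G_shift[OF X] Y])
  show "orth D X (Unshift D Y)" using 1 orth_shift[of X "Unshift D Y"] QD[OF assms(1)] QD[OF assms(2)]
    by (simp add: Unshift_ob)
qed

lemma not_orth_quotient: assumes "exact_triangle D X E Y" "X \<in> Q" "Y \<in> Q" "\<not> zero_object D Y"
  shows "\<not> orth D E Y"
  using orth_ext_left[OF exact_rot[OF assms(1)] _ Q_orth(1)[OF assms(2,3)]] assms(4) zero_object_orth by blast

lemma not_orth_sub: assumes "exact_triangle D X E Y" "X \<in> Q" "Y \<in> Q" "\<not> zero_object D X"
  shows "\<not> orth D X E"
  using orth_ext_right[OF exact_rot_back[OF assms(1)] Q_orth(2)[OF assms(2,3)]] assms(4) zero_object_orth by blast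

text \<open>
  For \<open>f : S \<rightarrow> S'\<close> with cone \<open>C\<close>, the truncation \<open>C \<rightarrow> R\<close> of the cone is the cokernel of \<open>f\<close> in \<open>Q\<close>
  and the fibre \<open>I\<close> of \<open>S' \<rightarrow> R\<close> is the image.
\<close>

lemma image_factorization:
  assumes T: "tri S S' C f g h" and S: "S \<in> Q" "S' \<in> Q"
  obtains C' R I a q d j k where "C' \<in> G'" "C' \<in> Ob D" "R \<in> Q" "I \<in> Q" "tri C' C R a q d"
    "tri I S' R j (q \<odot> g) k" "exact_triangle D S I C'"
proof -
  have e: "exact_triangle D S S' C" using T unfolding exact_triangle_def by blast
  note SQ = QD[OF S(1)] and SQ' = QD[OF S(2)]
  have C: "C \<in> G" using ts_G_cone[OF ts e] SQ SQ' by blast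
  obtain C' R where R: "C' \<in> G'" "R \<in> L'" "exact_triangle D C' C R" using ts_trunc[OF ts' ts_ob(1)[OF ts C]] .
  obtain a q d where T2: "tri C' C R a q d" using R(3) unfolding exact_triangle_def by blast
  obtain I j k where I: "tri I S' R j (q \<odot> g) k" "exact_triangle D S I C'" using octahedron_fibre_map[OF T T2] .
  have eI: "exact_triangle D I S' R" using I(1) unfolding exact_triangle_def by blast
  have RQ: "R \<in> Q" using QI ts_G_cone[OF ts R(3)] R G'_G C by blast
  have IQ: "I \<in> Q" using QI ts_L_fibre[OF ts' eI] ts_G_ext[OF ts I(2)] R G'_G SQ SQ' by blast
  have C'o: "C' \<in> Ob D" using ts_ob[OF ts'] R by blast
  show ?thesis by (rule that[OF R(1) C'o RQ IQ T2 I])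
qed

end

text \<open>
  The additive function \<open>len\<close> has the lower bound \<open>c0\<close> on nonzero objects of \<open>Q\<close>, so a strict chain
  in \<open>E\<close> has at most \<open>len E / c0\<close> steps.
\<close>

locale bounded_strip = strip +
  fixes Z :: "'a \<Rightarrow> complex" and c0 \<theta> :: real
  assumes Z_add: "additive_on D Z" and c0: "0 < c0"
    and mass: "E \<in> G \<Longrightarrow> E \<in> L' \<Longrightarrow> \<not> zero_object D E \<Longrightarrow> c0 \<le> wid \<theta> (Z E)"
begin

abbreviation "len E \<equiv> wid \<theta> (Z E)"

lemma len_pos: "E \<in> Q \<Longrightarrow> \<not> zero_object D E \<Longrightarrow> c0 \<le> len E" using mass QD by blast
lemma Z_zero: "zero_object D E \<Longrightarrow> Z E = 0" using additive_zero[OF Z_add] .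
lemma Z_ext: "exact_triangle D A E B \<Longrightarrow> Z E = Z A + Z B" using additive_onD[OF Z_add] .
lemma len_nonneg: "E \<in> Q \<Longrightarrow> 0 \<le> len E"
  using len_pos[of E] Z_zero[of E] c0 by (cases "zero_object D E") auto

end

text \<open>
  Here \<open>Z\<close> has phases in \<open>(b, c]\<close> on \<open>D(b, c]\<close>, by \<open>sector\<close>. The condition \<open>gap\<close> concerns \<open>D(c, b+1]\<close>, the complementary part of
  the heart \<open>D(b, b+1]\<close>, whose objects have larger phases; it controls the difference between image and coimage
  in \<open>D(b, c]\<close>.
\<close>

locale piece = bounded_strip +
  fixes b c :: real
  assumes bc: "b < c" "c < b + 1"
    and sector: "E \<in> G \<Longrightarrow> E \<in> L' \<Longrightarrow> \<not> zero_object D E \<Longrightarrow> hgt b (Z E) > 0 \<and> hgt c (Z E) \<le> 0"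
    and gap: "X \<in> G' \<Longrightarrow> Unshift D X \<in> L \<Longrightarrow> b < \<phi> \<Longrightarrow> \<phi> \<le> c \<Longrightarrow> 0 \<le> hgt \<phi> (Z X)"
begin

definition "ph E = (SOME \<psi>. b < \<psi> \<and> \<psi> \<le> c \<and> (\<exists>r>0. Z E = of_real r * cis (pi * \<psi>)))"

lemma ph: assumes "E \<in> Q" "\<not> zero_object D E"
  shows "b < ph E" "ph E \<le> c"
    "b \<le> \<phi> \<Longrightarrow> \<phi> \<le> c \<Longrightarrow> hgt \<phi> (Z E) > 0 \<longleftrightarrow> \<phi> < ph E"
    "b \<le> \<phi> \<Longrightarrow> \<phi> \<le> c \<Longrightarrow> hgt \<phi> (Z E) < 0 \<longleftrightarrow> ph E < \<phi>"
    "b \<le> \<phi> \<Longrightarrow> \<phi> \<le> c \<Longrightarrow> hgt \<phi> (Z E) = 0 \<longleftrightarrow> ph E = \<phi>"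
proof -
  have "hgt b (Z E) > 0" "hgt c (Z E) \<le> 0" using sector QD assms by blast+
  then have "\<exists>\<psi>. b < \<psi> \<and> \<psi> \<le> c \<and> (\<exists>r>0. Z E = of_real r * cis (pi * \<psi>))"
    using sector_phase[OF bc] by metis
  then have "b < ph E \<and> ph E \<le> c \<and> (\<exists>r>0. Z E = of_real r * cis (pi * ph E))"
    unfolding ph_def by (rule someI_ex)
  then obtain r where r: "b < ph E" "ph E \<le> c" "0 < r" "Z E = of_real r * cis (pi * ph E)" by blast
  show "b < ph E" "ph E \<le> c" using r by auto
  show "b \<le> \<phi> \<Longrightarrow> \<phi> \<le> c \<Longrightarrow> hgt \<phi> (Z E) > 0 \<longleftrightarrow> \<phi> < ph E"
    "b \<le> \<phi> \<Longrightarrow> \<phi> \<le> c \<Longrightarrow> hgt \<phi> (Z E) < 0 \<longleftrightarrow> ph E < \<phi>"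
    "b \<le> \<phi> \<Longrightarrow> \<phi> \<le> c \<Longrightarrow> hgt \<phi> (Z E) = 0 \<longleftrightarrow> ph E = \<phi>"
    unfolding r(4) using hgt_sign[OF r(3), of "ph E" \<phi>] r(1,2) bc by auto
qed

lemma nonzero: "hgt \<phi> (Z E) \<noteq> 0 \<Longrightarrow> \<not> zero_object D E" using Z_zero by auto

text \<open>
  Semistability of phase \<open>\<phi>\<close> in \<open>D(b, c]\<close> with respect to strict subobjects, expressed by heights, so that
  zero objects are included.
\<close>

definition "sst \<phi> E \<longleftrightarrow> E \<in> Q \<and> hgt \<phi> (Z E) = 0 \<and>
  (\<forall>X Y. exact_triangle D X E Y \<and> X \<in> Q \<and> Y \<in> Q \<longrightarrow> hgt \<phi> (Z X) \<le> 0)"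

lemma sst_Q: "sst \<phi> E \<Longrightarrow> E \<in> Q" unfolding sst_def by blast
lemma sst_hgt: "sst \<phi> E \<Longrightarrow> hgt \<phi> (Z E) = 0" unfolding sst_def by blast
lemma sst_sub: "sst \<phi> E \<Longrightarrow> exact_triangle D X E Y \<Longrightarrow> X \<in> Q \<Longrightarrow> Y \<in> Q \<Longrightarrow> hgt \<phi> (Z X) \<le> 0"
  unfolding sst_def by blast

lemma sst_iso: assumes "isomorphic D A B" "sst \<phi> A" shows "sst \<phi> B"
  unfolding sst_def
proof (intro conjI allI impI)
  show "B \<in> Q" using Q_iso assms sst_Q by blast
  show "hgt \<phi> (Z B) = 0" using sst_hgt[OF assms(2)] additive_iso[OF Z_add assms(1)] by simp
  fix X Y assume "exact_triangle D X B Y \<and> X \<in> Q \<and> Y \<in> Q"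
  then show "hgt \<phi> (Z X) \<le> 0"
    using sst_sub[OF assms(2) exact_iso[OF _ isomorphic_refl isomorphic_sym[OF assms(1)] isomorphic_refl]] QD by blast
qed

lemma sst_zero: assumes "zero_object D E" "b < \<phi>" "\<phi> \<le> c" shows "sst \<phi> E"
  unfolding sst_def
proof (intro conjI allI impI)
  show "E \<in> Q" "hgt \<phi> (Z E) = 0" using Q_zero Z_zero assms by auto
  fix X Y assume a: "exact_triangle D X E Y \<and> X \<in> Q \<and> Y \<in> Q"
  then have "orth D X E" using zero_orth(2)[OF assms(1)] QD by blast
  then have "zero_object D X" using a not_orth_sub by blast
  then show "hgt \<phi> (Z X) \<le> 0" using Z_zero by simp
qed

text \<open>
  For a nonzero arrow \<open>f : S \<rightarrow> S'\<close> let \<open>J\<close> be its coimage and \<open>I\<close> its image in \<open>Q\<close>. Semistability gives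
  \<open>\<phi> \<le>\<close> phase of \<open>J\<close> and phase of \<open>I \<le> \<phi>'\<close>. The arrow \<open>J \<rightarrow> I\<close> need not be an isomorphism, but its cone lies in
  \<open>D(c, b+1]\<close>, so passing from \<open>J\<close> to \<open>I\<close> can only increase the phase. Hence \<open>I = 0\<close>.
\<close>

lemma sst_orth: assumes S: "sst \<phi> S" and S': "sst \<phi>' S'" and lt: "b < \<phi>'" "\<phi>' < \<phi>" "\<phi> \<le> c"
  shows "orth D S S'"
proof (rule orthI)
  show "S \<in> Ob D" "S' \<in> Ob D" using S S' sst_Q QD by blast+
  fix f assume f: "f \<in> Hom D S S'"
  note SQ = QD[OF sst_Q[OF S]] and SQ' = QD[OF sst_Q[OF S']]
  obtain C g h where T: "tri S S' C f g h" using TR1_cone[OF f] by metis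
  obtain C' R I a q d j k where R: "C' \<in> G'" and C'o: "C' \<in> Ob D" and RQ: "R \<in> Q" and IQ: "I \<in> Q"
    and T2: "tri C' C R a q d" and I: "tri I S' R j (q \<odot> g) k" "exact_triangle D S I C'"
    using image_factorization[OF T sst_Q[OF S] sst_Q[OF S']] .
  have eI: "exact_triangle D I S' R" using I(1) unfolding exact_triangle_def by blast
  \<comment> \<open>\<open>?K\<close> is the kernel of \<open>f\<close> in the heart \<open>D(c-1, c]\<close>; its truncation \<open>K'\<close> at \<open>b\<close> is the kernel in \<open>Q\<close>.\<close>
  let ?K = "Unshift D C'"
  have eK: "exact_triangle D ?K S I" using exact_rot_back[OF I(2)] .
  have K: "?K \<in> L'" using ts_L_fibre[OF ts' eK] SQ QD[OF IQ] by blast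
  obtain K' K'' where K': "K' \<in> G" "K'' \<in> L" "exact_triangle D K' ?K K''"
    using ts_trunc[OF ts Unshift_ob[OF C'o]] .
  obtain J where J: "exact_triangle D K' S J" "exact_triangle D K'' J I" using octahedron[OF K'(3) eK] .
  have K'Q: "K' \<in> Q" using QI ts_L_fibre[OF ts' K'(3)] K K' L_L' by blast
  have JQ: "J \<in> Q" using QI ts_G_cone[OF ts J(1)] ts_L_ext[OF ts' J(2)] K' SQ QD[OF IQ] L_L' by blast
  have "Shift D K'' \<in> G'"
    using ts_G_cone[OF ts' exact_shift[OF K'(3)]] G_shift[OF K'(1)] C'o R by simp
  then have "0 \<le> hgt \<phi> (Z (Shift D K''))"
    using gap[of "Shift D K''" \<phi>] ts_ob(2)[OF ts K'(2)] K'(2) lt by auto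
  moreover have "Z (Shift D K'') = - Z K''" using additive_shift[OF Z_add ts_ob(2)[OF ts K'(2)]] .
  moreover have "hgt \<phi> (Z K') \<le> 0" using sst_sub[OF S J(1) K'Q JQ] .
  ultimately have hI: "0 \<le> hgt \<phi> (Z I)" using Z_ext[OF J(1)] Z_ext[OF J(2)] sst_hgt[OF S] by simp
  have hI': "hgt \<phi>' (Z I) \<le> 0" using sst_sub[OF S' eI IQ RQ] .
  have "zero_object D I"
  proof (rule ccontr)
    assume nz: "\<not> zero_object D I"
    show False using ph(3)[OF IQ nz, of \<phi>'] ph(4)[OF IQ nz, of \<phi>] hI hI' lt bc by auto
  qed
  have "g \<odot> f = Zer D S C" using tri_comp_zer[OF T] .
  then have "(q \<odot> g) \<odot> f = Zer D S R"
    using comp_assoc[OF f triE(2)[OF T] triE(2)[OF T2]] comp_zer[OF triE(2)[OF T2]] SQ by simp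
  then obtain s where s: "s \<in> Hom D S I" "j \<odot> s = f" using lift_covariant[OF I(1) f] by metis
  have "s = Zer D S I" using orthD[OF zero_orth(2)[OF \<open>zero_object D I\<close>] s(1)] SQ by blast
  then show "f = Zer D S S'" using s(2) comp_zer[OF triE(1)[OF I(1)]] SQ by simp
qed

lemma len_induct [consumes 2, case_names step]:
  assumes "E \<in> Q" "\<not> zero_object D E"
    and step: "\<And>E. E \<in> Q \<Longrightarrow> \<not> zero_object D E \<Longrightarrow>
      (\<And>F. F \<in> Q \<Longrightarrow> \<not> zero_object D F \<Longrightarrow> len F \<le> len E - c0 \<Longrightarrow> Pr F) \<Longrightarrow> Pr E"
  shows "Pr E"
proof -
  have "Pr E" if "E \<in> Q" "\<not> zero_object D E" "len E < real n * c0" for n E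
    using that
  proof (induction n arbitrary: E)
    case 0 then show ?case using len_pos[of E] c0 by simp
  next
    case (Suc n)
    show ?case
    proof (rule step[OF Suc.prems(1,2)])
      fix F assume F: "F \<in> Q" "\<not> zero_object D F" "len F \<le> len E - c0"
      show "Pr F" using Suc.IH[OF F(1,2)] F(3) Suc.prems(3) by (simp add: algebra_simps)
    qed
  qed
  moreover obtain n where "len E / c0 < real n" using reals_Archimedean2 by blast
  then have "len E < real n * c0" using c0 by (simp add: field_simps)
  ultimately show ?thesis using assms by blast
qed

lemma not_sstE: assumes "E \<in> Q" "\<not> zero_object D E" "\<not> sst (ph E) E"
  obtains X Y where "exact_triangle D X E Y" "X \<in> Q" "Y \<in> Q" "\<not> zero_object D X" "\<not> zero_object D Y"
    "ph E < ph X" "ph Y < ph E"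
proof -
  note p = ph[OF assms(1,2)]
  have h: "hgt (ph E) (Z E) = 0" using p(5)[of "ph E"] p(1,2) by simp
  then obtain X Y where X: "exact_triangle D X E Y" "X \<in> Q" "Y \<in> Q" "hgt (ph E) (Z X) > 0"
    using assms unfolding sst_def by fastforce
  have hY: "hgt (ph E) (Z Y) < 0" using X(4) h Z_ext[OF X(1)] by simp
  have nz: "\<not> zero_object D X" "\<not> zero_object D Y" using nonzero[of "ph E"] X hY by auto
  have "ph E < ph X" "ph Y < ph E"
    using ph(3)[OF X(2) nz(1), of "ph E"] ph(4)[OF X(3) nz(2), of "ph E"] X(4) hY p by auto
  then show ?thesis using that X nz by blast
qed

text \<open>
  Pass from \<open>E\<close> to a destabilizing subobject as long as possible; every step shortens \<open>len\<close> by at least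
  \<open>c0\<close>.
\<close>

lemma sst_subobject:
  assumes "E \<in> Q" "\<not> zero_object D E"
  shows "\<exists>S Y. exact_triangle D S E Y \<and> S \<in> Q \<and> Y \<in> Q \<and> \<not> zero_object D S \<and> sst (ph S) S \<and>
    ph E \<le> ph S \<and> (\<not> sst (ph E) E \<longrightarrow> ph E < ph S)"
  using assms
proof (induction rule: len_induct)
  case (step E)
  show ?case
  proof (cases "sst (ph E) E")
    case True
    obtain Z0 where z: "zero_object D Z0" by (rule obtain_zero)
    have "exact_triangle D E E Z0" using exact_zero_right[OF _ z] step QD by blast
    then show ?thesis using True step Q_zero[OF z] by blast
  next
    case False
    then obtain X Y where X: "exact_triangle D X E Y" "X \<in> Q" "Y \<in> Q" "\<not> zero_object D X" "\<not> zero_object D Y"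
      "ph E < ph X" using not_sstE step by metis
    have "len X \<le> len E - c0" using Z_ext[OF X(1)] len_pos[OF X(3,5)] by simp
    then obtain S Y' where S: "exact_triangle D S X Y'" "S \<in> Q" "Y' \<in> Q" "\<not> zero_object D S" "sst (ph S) S" "ph X \<le> ph S"
      using step(3)[OF X(2,4)] by blast
    obtain Y'' where Y'': "exact_triangle D S E Y''" "exact_triangle D Y' Y'' Y" using octahedron[OF S(1) X(1)] .
    have "Y'' \<in> Q" using Q_ext[OF Y''(2)] S X by blast
    then show ?thesis using Y'' S X(6) by (intro exI[of _ S] exI[of _ Y'']) auto
  qed
qed

lemma sst_quotient:
  assumes "E \<in> Q" "\<not> zero_object D E"
  shows "\<exists>X S. exact_triangle D X E S \<and> X \<in> Q \<and> S \<in> Q \<and> \<not> zero_object D S \<and> sst (ph S) S \<and> ph S \<le> ph E"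
  using assms
proof (induction rule: len_induct)
  case (step E)
  show ?case
  proof (cases "sst (ph E) E")
    case True
    obtain Z0 where z: "zero_object D Z0" by (rule obtain_zero)
    have "exact_triangle D Z0 E E" using exact_zero_left[OF _ z] step QD by blast
    then show ?thesis using True step Q_zero[OF z] by blast
  next
    case False
    then obtain X Y where X: "exact_triangle D X E Y" "X \<in> Q" "Y \<in> Q" "\<not> zero_object D X" "\<not> zero_object D Y"
      "ph Y < ph E" using not_sstE step by metis
    have "len Y \<le> len E - c0" using Z_ext[OF X(1)] len_pos[OF X(2,4)] by simp
    then obtain X' S where S: "exact_triangle D X' Y S" "X' \<in> Q" "S \<in> Q" "\<not> zero_object D S" "sst (ph S) S" "ph S \<le> ph Y"
      using step(3)[OF X(3,5)] by blast
    obtain K where K: "exact_triangle D K E S" "exact_triangle D X K X'" using octahedron_fibre[OF X(1) S(1)] .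
    have "K \<in> Q" using Q_ext[OF K(2)] S X by blast
    then show ?thesis using K S X(6) by (intro exI[of _ K] exI[of _ S]) auto
  qed
qed

text \<open>
  Take a semistable subobject \<open>S\<close> of larger phase and the quotient \<open>R\<close> obtained by induction for \<open>E/S\<close>, with kernel
  \<open>K'\<close>. The kernel of \<open>E \<rightarrow> R\<close> is an extension of \<open>K'\<close> by \<open>S\<close>. The condition on the kernel, formulated by
  vanishing of Hom, passes to this extension because \<open>S\<close> has larger phase than \<open>R\<close>. It implies
  that every phase in a Harder-Narasimhan filtration of the kernel exceeds that of the quotient.
\<close>

lemma minimal_destabilizing_quotient:
  assumes "E \<in> Q" "\<not> zero_object D E"
  shows "\<exists>K S. exact_triangle D K E S \<and> K \<in> Q \<and> S \<in> Q \<and> \<not> zero_object D S \<and> sst (ph S) S \<and>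
    (\<forall>\<psi> S'. b < \<psi> \<and> \<psi> \<le> ph S \<and> sst \<psi> S' \<longrightarrow> orth D K S')"
  using assms
proof (induction rule: len_induct)
  case (step E)
  show ?case
  proof (cases "sst (ph E) E")
    case True
    obtain Z0 where z: "zero_object D Z0" by (rule obtain_zero)
    have "exact_triangle D Z0 E E" using exact_zero_left[OF _ z] step QD by blast
    then show ?thesis using True step Q_zero[OF z] zero_orth(1)[OF z] sst_Q QD by blast
  next
    case False
    obtain S E' where S: "exact_triangle D S E E'" "S \<in> Q" "E' \<in> Q" "\<not> zero_object D S" "sst (ph S) S" "ph E < ph S"
      using sst_subobject[OF step(1,2)] False by blast
    note pE = ph[OF step(1,2)]
    have "hgt (ph E) (Z S) > 0" using ph(3)[OF S(2,4), of "ph E"] S(6) pE by auto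
    then have hE': "hgt (ph E) (Z E') < 0" using Z_ext[OF S(1)] pE(5)[of "ph E"] pE(1,2) by simp
    then have nz: "\<not> zero_object D E'" using nonzero[of "ph E" E'] by linarith
    have pE': "ph E' < ph E" using ph(4)[OF S(3) nz, of "ph E"] hE' pE by auto
    have "len E' \<le> len E - c0" using Z_ext[OF S(1)] len_pos[OF S(2,4)] by simp
    then obtain K' R where R: "exact_triangle D K' E' R" "K' \<in> Q" "R \<in> Q" "\<not> zero_object D R" "sst (ph R) R"
      "\<And>\<psi> S'. b < \<psi> \<Longrightarrow> \<psi> \<le> ph R \<Longrightarrow> sst \<psi> S' \<Longrightarrow> orth D K' S'"
      using step(3)[OF S(3) nz] by blast
    note pR = ph[OF R(3,4)]
    \<comment> \<open>a semistable quotient of \<open>K'\<close> receives a nonzero arrow from \<open>K'\<close>, so its phase exceeds that of \<open>R\<close>\<close>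
    have "0 \<le> hgt (ph R) (Z K')"
    proof (cases "zero_object D K'")
      case True then show ?thesis using Z_zero by simp
    next
      case False
      obtain X S1 where S1: "exact_triangle D X K' S1" "X \<in> Q" "S1 \<in> Q" "\<not> zero_object D S1" "sst (ph S1) S1" "ph S1 \<le> ph K'"
        using sst_quotient[OF R(2) False] by blast
      have "\<not> orth D K' S1" using not_orth_quotient[OF S1(1-4)] .
      then have "ph R < ph S1" using R(6)[OF _ _ S1(5)] ph(1)[OF S1(3,4)] by force
      then show ?thesis using ph(3)[OF R(2) False, of "ph R"] S1(6) pR by auto
    qed
    then have "0 \<le> hgt (ph R) (Z E')" using Z_ext[OF R(1)] sst_hgt[OF R(5)] by simp
    then have "ph R \<le> ph E'" using ph(4)[OF S(3) nz, of "ph R"] pR by auto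
    obtain K where K: "exact_triangle D K E R" "exact_triangle D S K K'" using octahedron_fibre[OF S(1) R(1)] .
    have KQ: "K \<in> Q" using Q_ext[OF K(2)] S R by blast
    have "orth D K S'" if S': "b < \<psi>" "\<psi> \<le> ph R" "sst \<psi> S'" for \<psi> S'
    proof (rule orth_ext_left[OF K(2)])
      show "orth D S S'"
        by (rule sst_orth[OF S(5) S'(3,1)]) (use S'(2) \<open>ph R \<le> ph E'\<close> pE' S(6) ph(2)[OF S(2,4)] in auto)
      show "orth D K' S'" using R(6) S' by blast
    qed
    then show ?thesis using K KQ R(3-5) by blast
  qed
qed

text \<open>
  A destabilizing subobject of \<open>E\<close> would contain a semistable one of phase greater than \<open>\<phi>\<close>, which has no nonzero arrow to
  \<open>A\<close> or \<open>B\<close>.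
\<close>

lemma sst_ext: assumes e: "exact_triangle D A E B" and A: "sst \<phi> A" and B: "sst \<phi> B" and \<phi>: "b < \<phi>" "\<phi> \<le> c"
  shows "sst \<phi> E"
  unfolding sst_def
proof (intro conjI allI impI)
  show "E \<in> Q" using Q_ext[OF e] A B sst_Q by blast
  show "hgt \<phi> (Z E) = 0" using Z_ext[OF e] A B sst_hgt by simp
  fix X Y assume X: "exact_triangle D X E Y \<and> X \<in> Q \<and> Y \<in> Q"
  show "hgt \<phi> (Z X) \<le> 0"
  proof (rule ccontr)
    assume h: "\<not> hgt \<phi> (Z X) \<le> 0"
    then have nz: "\<not> zero_object D X" using nonzero[of \<phi> X] by auto
    have "\<phi> < ph X" using ph(3)[of X \<phi>] X nz h \<phi> by auto
    obtain S Y' where S: "exact_triangle D S X Y'" "S \<in> Q" "Y' \<in> Q" "\<not> zero_object D S" "sst (ph S) S" "ph X \<le> ph S"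
      using sst_subobject[of X] X nz by blast
    obtain Y'' where Y'': "exact_triangle D S E Y''" "exact_triangle D Y' Y'' Y" using octahedron[OF S(1)] X by blast
    have Y''Q: "Y'' \<in> Q" using Q_ext[OF Y''(2)] S X by blast
    have "orth D S A" "orth D S B"
      using sst_orth[OF S(5) A \<phi>(1)] sst_orth[OF S(5) B \<phi>(1)] \<open>\<phi> < ph X\<close> S(6) ph(2)[OF S(2,4)] by auto
    then have "orth D S E" using orth_ext_right[OF e] by blast
    then show False using not_orth_sub[OF Y''(1) S(2) Y''Q S(4)] by blast
  qed
qed

text \<open>
  Split off minimal destabilizing quotients. The induction carries along a semistable object of the last phase that
  receives a nonzero arrow; this is what forces the phases to decrease.
\<close>

lemma hn_in_piece:
  assumes P: "\<And>\<phi> E. b < \<phi> \<Longrightarrow> \<phi> \<le> c \<Longrightarrow> E \<in> P \<phi> \<longleftrightarrow> sst \<phi> E" and E: "E \<in> Q" "\<not> zero_object D E"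
  shows "\<exists>t u. hn D P E t u \<and> b < u \<and> t \<le> c"
proof -
  have "\<exists>t u S. hn D P E t u \<and> b < u \<and> t \<le> c \<and> sst u S \<and> \<not> orth D E S"
    using E
  proof (induction rule: len_induct)
    case (step E)
    obtain K S where K: "exact_triangle D K E S" "K \<in> Q" "S \<in> Q" "\<not> zero_object D S" "sst (ph S) S"
      "\<And>\<psi> S'. b < \<psi> \<Longrightarrow> \<psi> \<le> ph S \<Longrightarrow> sst \<psi> S' \<Longrightarrow> orth D K S'"
      using minimal_destabilizing_quotient[OF step(1,2)] by blast
    note pS = ph[OF K(3,4)]
    have no: "\<not> orth D E S" using not_orth_quotient[OF K(1-4)] .
    have SP: "S \<in> P (ph S)" using P K(5) pS by blast
    show ?case
    proof (cases "zero_object D K")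
      case True
      have i: "isomorphic D S E" using exact_fibre_zero[OF K(1) True] isomorphic_sym by blast
      have "E \<in> P (ph S)" using P sst_iso[OF i K(5)] pS by blast
      then have "hn D P E (ph S) (ph S)" using step(2) hn.single by metis
      then show ?thesis using pS K(5) no by blast
    next
      case False
      have "len K \<le> len E - c0" using Z_ext[OF K(1)] len_pos[OF K(3,4)] by simp
      then obtain t u S' where h: "hn D P K t u" "b < u" "t \<le> c" "sst u S'" "\<not> orth D K S'"
        using step(3)[OF K(2) False] by blast
      then have "ph S < u" using K(6)[of u S'] by force
      then have "hn D P E t (ph S)" using hn.step[where P=P, OF h(1) K(1) SP K(4)] by blast
      then show ?thesis using pS K(5) no h(3) by blast
    qed
  qed
  then show ?thesis by blast
qed

end

section \<open>Finite length\<close>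

lemma bounded_increments:
  fixes a :: "nat \<Rightarrow> real"
  assumes "0 < c" "\<And>n. 0 \<le> a n" "\<And>n. a n \<le> M" "\<And>n. a n \<le> a (Suc n)" "\<And>n. bad n \<Longrightarrow> a n + c \<le> a (Suc n)"
  shows "\<exists>N. \<forall>n\<ge>N. \<not> bad n"
proof -
  have le: "c * card {k. k < n \<and> bad k} \<le> a n" for n
  proof (induction n)
    case 0 then show ?case using assms(2) by simp
  next
    case (Suc n)
    have fin: "finite {k. k < n \<and> bad k}" by simp
    show ?case
    proof (cases "bad n")
      case True
      then have "{k. k < Suc n \<and> bad k} = insert n {k. k < n \<and> bad k}" by (auto simp: less_Suc_eq)
      then have "card {k. k < Suc n \<and> bad k} = Suc (card {k. k < n \<and> bad k})" using fin by simp
      then show ?thesis using Suc assms(5)[OF True] by (simp add: algebra_simps)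
    next
      case False
      then have "{k. k < Suc n \<and> bad k} = {k. k < n \<and> bad k}" by (auto simp: less_Suc_eq)
      then show ?thesis using Suc assms(4)[of n] by simp
    qed
  qed
  have "finite {k. bad k}"
  proof (rule ccontr)
    assume "infinite {k. bad k}"
    moreover obtain m :: nat where m: "M / c < real m" using reals_Archimedean2 by blast
    ultimately obtain T where T: "T \<subseteq> {k. bad k}" "finite T" "card T = m" using infinite_arbitrarily_large by blast
    define n where "n = Suc (Max (insert 0 T))"
    have "T \<subseteq> {k. k < n \<and> bad k}"
      using T Max_ge[of "insert 0 T"] by (fastforce simp: n_def less_Suc_eq_le)
    then have "m \<le> card {k. k < n \<and> bad k}" using card_mono[of "{k. k < n \<and> bad k}" T] T by simp
    then have "c * m \<le> c * card {k. k < n \<and> bad k}" using assms(1) by simp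
    then have "c * m \<le> M" using le[of n] assms(3)[of n] by simp
    then show False using m assms(1) by (simp add: field_simps)
  qed
  then obtain N where "\<And>k. bad k \<Longrightarrow> k < N" using finite_nat_set_iff_bounded by auto
  then show ?thesis by (metis leD)
qed

context strip
begin

abbreviation "QC \<equiv> full_subcategory D Q"

text \<open>
  A strict monomorphism is the kernel of its cokernel \<open>c\<close>. Since \<open>c\<close> vanishes on the image \<open>I \<rightarrow> E\<close> computed from a cone, \<open>I \<rightarrow> E\<close>
  factors through \<open>i\<close>; the resulting arrow is inverse to the canonical arrow from the source of \<open>i\<close> to \<open>I\<close>. So \<open>i\<close> is a fibre of
  \<open>E \<rightarrow> R\<close>, and its cone \<open>R\<close> lies in \<open>Q\<close>.
\<close>

lemma strict_subobject_cone:
  assumes s: "strict_subobject QC E i" and E: "E \<in> Q"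
  obtains R g h where "tri (Src D i) E R i g h" "R \<in> Q" "Src D i \<in> Q"
proof -
  note sel = full_subcategory_sel
  let ?A = "Src D i"
  have mono: "is_mono QC i" and "is_strict QC i" and tgt: "Tgt D i = E"
    using s by (auto simp: strict_subobject_def sel)
  then obtain k p c m u where st: "is_kernel QC k i" "is_cokernel QC p k" "is_cokernel QC c i" "is_kernel QC m c"
      "u \<in> Hom QC (Tgt D p) (Src D m)" "is_iso QC u" "i = m \<odot> (u \<odot> p)"
    unfolding is_strict_def sel by blast
  have i: "i \<in> Hom D ?A E" "?A \<in> Q" using mono tgt by (auto simp: is_mono_def Arr_full Hom_def)
  have monoD: "s = t" if "s \<in> Hom D X ?A" "t \<in> Hom D X ?A" "X \<in> Q" "i \<odot> s = i \<odot> t" for s t X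
  proof -
    have "s \<in> Arr QC" "t \<in> Arr QC" "Tgt D s = ?A" "Tgt D t = ?A" "Src D s = Src D t"
      using that i(2) by (auto simp: Hom_def Arr_full)
    then show ?thesis using mono that(4) unfolding is_mono_def sel by blast
  qed
  have AO: "?A \<in> Ob D" and EO: "E \<in> Ob D" using i(2) E QD by blast+
  \<comment> \<open>the arrow \<open>p\<close> from the source of a monomorphism to its coimage is an isomorphism\<close>
  let ?K = "Src D k"
  have k: "k \<in> Hom D ?K ?A" "?K \<in> Q" "i \<odot> k = Zer D ?K E" using st(1) tgt by (auto simp: is_kernel_def sel Arr_full Hom_def)
  have KO: "?K \<in> Ob D" using k QD by blast
  have k0: "k = Zer D ?K ?A"
    using monoD[OF k(1) zer_hom[OF KO AO] k(2)] k(3) comp_zer[OF i(1) KO] by simp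
  let ?P = "Tgt D p"
  have p: "p \<in> Hom D ?A ?P" "?P \<in> Q" using st(2) k(1) by (auto simp: is_cokernel_def sel Arr_full Hom_def)
  have PO: "?P \<in> Ob D" using p QD by blast
  have cokp: "\<exists>!u. u \<in> Hom D ?P X \<and> u \<odot> p = t" if "t \<in> Hom D ?A X" "X \<in> Q" for t X
  proof -
    have "t \<in> Arr QC" "Src D t = Tgt D k" "Tgt D t = X" using that i(2) k(1) by (auto simp: Hom_def Arr_full)
    moreover have "t \<odot> k = Zer D (Src D k) X" using k0 comp_zer[OF that(1) KO] by simp
    ultimately have "\<exists>!u. u \<in> Hom QC ?P X \<and> u \<odot> p = t" using st(2) unfolding is_cokernel_def sel by blast
    then show ?thesis using that(2) p(2) by (simp add: Hom_full)
  qed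
  obtain v where v: "v \<in> Hom D ?P ?A" "v \<odot> p = Idn D ?A" using cokp[OF id_hom[OF AO] i(2)] by blast
  have "p \<odot> v = Idn D ?P"
  proof -
    have "(p \<odot> v) \<odot> p = p" using comp_assoc[OF p(1) v(1) p(1)] v(2) id_right[OF p(1)] by simp
    then show ?thesis using cokp[OF p] comp_hom[OF v(1) p(1)] id_hom[OF PO] id_left[OF p(1)] by metis
  qed
  let ?M = "Src D m"
  have c: "c \<in> Hom D E (Tgt D c)" "Tgt D c \<in> Q" "c \<odot> i = Zer D ?A (Tgt D c)"
    using st(3) tgt by (auto simp: is_cokernel_def sel Arr_full Hom_def)
  have m: "m \<in> Hom D ?M E" "?M \<in> Q" using st(4) c(1) by (auto simp: is_kernel_def sel Arr_full Hom_def)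
  have u: "u \<in> Hom D ?P ?M" using st(5) p(2) m(2) by (simp add: Hom_full)
  have "is_iso D u" using st(6) is_iso_full[OF u p(2) m(2)] by simp
  then obtain u' where u': "u' \<in> Hom D ?M ?P" "u \<odot> u' = Idn D ?M" using isoE[OF _ u] by metis
  have vu: "v \<odot> u' \<in> Hom D ?M ?A" using comp_hom[OF u'(1) v(1)] .
  have m_i: "i \<odot> (v \<odot> u') = m"
  proof -
    have "(u \<odot> p) \<odot> (v \<odot> u') = u \<odot> ((p \<odot> v) \<odot> u')"
      using comp_assoc[OF vu p(1) u] comp_assoc[OF u'(1) v(1) p(1)] by simp
    also have "\<dots> = Idn D ?M" using \<open>p \<odot> v = Idn D ?P\<close> id_left[OF u'(1)] u'(2) by simp
    finally show ?thesis using st(7) comp_assoc[OF vu comp_hom[OF p(1) u] m(1)] id_right[OF m(1)] by simp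
  qed
  \<comment> \<open>compare with the image computed from a cone\<close>
  obtain X g h where T: "tri ?A E X i g h" using TR1_cone[OF i(1)] by metis
  obtain X' R I a q d j k' where R: "X' \<in> G'" "X' \<in> Ob D" "R \<in> Q" "I \<in> Q" "tri X' X R a q d"
    "tri I E R j (q \<odot> g) k'" "exact_triangle D ?A I X'"
    using image_factorization[OF T i(2) E] .
  note g = triE(2)[OF T] and a = triE(1)[OF R(5)] and q = triE(2)[OF R(5)] and j = triE(1)[OF R(6)]
    and qg = triE(2)[OF R(6)] and k' = triE(3)[OF R(6)]
  have IO: "I \<in> Ob D" using R QD by blast
  have CO: "Tgt D c \<in> Ob D" using c QD by blast
  obtain c1 where c1: "c1 \<in> Hom D X (Tgt D c)" "c1 \<odot> g = c" using lift_contravariant[OF T c(1,3)] .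
  have "c1 \<odot> a = Zer D X' (Tgt D c)"
    using orthD[OF ts_orth[OF ts' R(1)] comp_hom[OF a c1(1)]] QD[OF c(2)] by blast
  then obtain c2 where c2: "c2 \<in> Hom D R (Tgt D c)" "c2 \<odot> q = c1" using lift_contravariant[OF R(5) c1(1)] by metis
  have "c \<odot> j = Zer D I (Tgt D c)"
  proof -
    have "c = c2 \<odot> (q \<odot> g)" using comp_assoc[OF g q c2(1)] c1 c2 by simp
    then show ?thesis using comp_assoc[OF j qg c2(1)] tri_comp_zer[OF R(6)] comp_zer[OF c2(1) IO] by simp
  qed
  moreover have "j \<in> Arr QC" "Tgt D j = Src D c" "Src D j = I" "Tgt D c = Tgt D c"
    using j c(1) R(4) E by (auto simp: Arr_full Hom_def)
  ultimately obtain w0 where w0: "w0 \<in> Hom QC (Src D j) ?M" "m \<odot> w0 = j"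
    using st(4) unfolding is_kernel_def sel by metis
  have w0': "w0 \<in> Hom D I ?M" using w0(1) j by (auto simp: Hom_def full_subcategory_def)
  define w where "w = (v \<odot> u') \<odot> w0"
  have w: "w \<in> Hom D I ?A" using comp_hom[OF w0' vu] by (simp add: w_def)
  have iw: "i \<odot> w = j" using comp_assoc[OF w0' vu i(1)] m_i w0(2) by (simp add: w_def)
  have gi: "g \<odot> i = Zer D ?A X" using tri_comp_zer[OF T] .
  have "(q \<odot> g) \<odot> i = Zer D ?A R" using comp_assoc[OF i(1) g q] gi comp_zer[OF q AO] by simp
  then obtain e where e: "e \<in> Hom D ?A I" "j \<odot> e = i" using lift_covariant[OF R(6) i(1)] by metis
  have we: "w \<odot> e = Idn D ?A"
  proof (rule monoD[OF comp_hom[OF e(1) w] id_hom[OF AO] i(2)])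
    show "i \<odot> (w \<odot> e) = i \<odot> Idn D ?A" using comp_assoc[OF e(1) w i(1)] iw e(2) id_right[OF i(1)] by simp
  qed
  have "j \<odot> (e \<odot> w) = j \<odot> Idn D I" using comp_assoc[OF w e(1) j] e(2) iw id_right[OF j] by simp
  then have ew: "e \<odot> w = Idn D I"
    using comp_left_inj[OF R(6) Q_orth(2)[OF R(4,3)] comp_hom[OF w e(1)] id_hom[OF IO]] by blast
  have h': "ShiftA D w \<odot> k' \<in> Hom D R (Shift D ?A)" using comp_hom[OF k' ShiftA_hom[OF w]] .
  have RO: "R \<in> Ob D" using R QD by blast
  have sh: "tri_shape D ?A E R i (q \<odot> g) (ShiftA D w \<odot> k')" unfolding tri_shape_def using i qg h' by simp
  have "(i, q \<odot> g, ShiftA D w \<odot> k') \<in> Tri D"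
  proof (rule TR1_iso[OF conjunct2[OF R(6)] conjunct1[OF R(6)] sh w id_hom[OF EO] id_hom[OF RO]])
    show "is_iso D w" using isoI[OF w e(1) ew we] .
    show "is_iso D (Idn D E)" "is_iso D (Idn D R)" using id_iso EO RO by auto
    show "Idn D E \<odot> j = i \<odot> w" using id_left[OF j] iw by simp
    show "Idn D R \<odot> (q \<odot> g) = q \<odot> g \<odot> Idn D E" using id_left[OF qg] id_right[OF qg] by simp
    show "ShiftA D w \<odot> k' = (ShiftA D w \<odot> k') \<odot> Idn D R" using id_right[OF h'] by simp
  qed
  then show ?thesis using that sh R(3) i(2) by blast
qed

text \<open>
  The quotient of two comparable strict subobjects lies in \<open>Q\<close>: it is a cone of objects in \<open>G\<close> and, by the octahedron, a
  fibre of objects in \<open>L'\<close>.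
\<close>

lemma strict_subobject_le_cone:
  assumes "strict_subobject QC E i" "strict_subobject QC E i'" "E \<in> Q" "subobject_le QC i i'"
  obtains Y where "Y \<in> Q" "exact_triangle D (Src D i) (Src D i') Y" "zero_object D Y \<longrightarrow> subobject_le QC i' i"
proof -
  obtain R g h where T: "tri (Src D i) E R i g h" "R \<in> Q" "Src D i \<in> Q" using strict_subobject_cone[OF assms(1,3)] .
  obtain R' g' h' where T': "tri (Src D i') E R' i' g' h'" "R' \<in> Q" "Src D i' \<in> Q" using strict_subobject_cone[OF assms(2,3)] .
  obtain k where k: "k \<in> Hom D (Src D i) (Src D i')" "i = i' \<odot> k"
    using assms(4) T(3) T'(3) by (auto simp: subobject_le_def full_subcategory_sel Hom_full)
  obtain Y u v where Y: "tri (Src D i) (Src D i') Y k u v" using TR1_cone[OF k(1)] by metis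
  have e: "exact_triangle D (Src D i) (Src D i') Y" using Y unfolding exact_triangle_def by blast
  have "tri (Src D i) E R (i' \<odot> k) g h" using T k by simp
  then have o: "exact_triangle D Y R R'" using octahedron_tri[OF Y T'(1)] by blast
  have YQ: "Y \<in> Q"
    using QI ts_G_cone[OF ts e] ts_L_fibre[OF ts' o] QD[OF T(3)] QD[OF T'(3)] QD[OF T(2)] QD[OF T'(2)] by blast
  have "subobject_le QC i' i" if z: "zero_object D Y"
  proof -
    obtain r where r: "r \<in> Hom D (Src D i') (Src D i)" "r \<odot> k = Idn D (Src D i)" "k \<odot> r = Idn D (Src D i')"
      using tri_zero_cone_iso[OF Y z] .
    have "i' = i \<odot> r" using comp_assoc[OF r(1) k(1) triE(1)[OF T'(1)]] k(2) r(3) id_right[OF triE(1)[OF T'(1)]] by simp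
    then show ?thesis using r(1) T(3) T'(3) by (auto simp: subobject_le_def full_subcategory_sel Hom_full)
  qed
  then show ?thesis using that YQ e by blast
qed

lemma subobject_le_trans:
  assumes "i \<in> Hom D A E" "i' \<in> Hom D A' E" "i'' \<in> Hom D A'' E" "subobject_le QC i i'" "subobject_le QC i' i''"
    "A \<in> Q" "A' \<in> Q" "A'' \<in> Q"
  shows "subobject_le QC i i''"
proof -
  have src: "Src D i = A" "Src D i' = A'" "Src D i'' = A''" using Hom_arr assms by auto
  obtain k where k: "k \<in> Hom D A A'" "i = i' \<odot> k"
    using assms(4,6,7) src by (auto simp: subobject_le_def full_subcategory_sel Hom_full)
  obtain k' where k': "k' \<in> Hom D A' A''" "i' = i'' \<odot> k'"
    using assms(5,7,8) src by (auto simp: subobject_le_def full_subcategory_sel Hom_full)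
  have "i = i'' \<odot> (k' \<odot> k)" using comp_assoc[OF k(1) k'(1) assms(3)] k k' by simp
  then show ?thesis using comp_hom[OF k(1) k'(1)] assms src
    by (auto simp: subobject_le_def full_subcategory_sel Hom_full)
qed

lemma subobject_le_refl:
  assumes "i \<in> Hom D A E" "A \<in> Q" shows "subobject_le QC i i"
proof -
  have "Idn D A \<in> Hom D A A" "i = i \<odot> Idn D A" using id_hom id_right[OF assms(1)] QD[OF assms(2)] by auto
  then show ?thesis using Hom_arr[OF assms(1)] assms(2)
    by (auto simp: subobject_le_def full_subcategory_sel Hom_full)
qed

end

text \<open>
  Every step of a chain that is not an isomorphism changes \<open>len\<close> by at least \<open>c0\<close>, and \<open>len\<close> of subobjects of \<open>E\<close> is between
  \<open>0\<close> and \<open>len E\<close>.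
\<close>

lemma (in bounded_strip) finite_length_Q: "finite_length QC"
  unfolding finite_length_def
proof (intro ballI allI impI conjI)
  fix E and s :: "nat \<Rightarrow> 'b" assume "E \<in> Ob QC" and s: "\<forall>n. strict_subobject QC E (s n)"
  then have E: "E \<in> Q" by (simp add: full_subcategory_sel)
  let ?a = "\<lambda>n. len (Src D (s n))"
  have sub: "s n \<in> Hom D (Src D (s n)) E \<and> Src D (s n) \<in> Q \<and> 0 \<le> ?a n \<and> ?a n \<le> len E" for n
  proof -
    obtain R g h where T: "tri (Src D (s n)) E R (s n) g h" "R \<in> Q" "Src D (s n) \<in> Q"
      using strict_subobject_cone[OF spec[OF s] E] .
    have "exact_triangle D (Src D (s n)) E R" using T(1) unfolding exact_triangle_def by blast
    from Z_ext[OF this] show ?thesis using T triE(1)[OF T(1)] len_nonneg[OF T(2)] len_nonneg[OF T(3)] by simp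
  qed
  have trans: "subobject_le QC (s l) (s n)" if "subobject_le QC (s l) (s m)" "subobject_le QC (s m) (s n)" for l m n
    using subobject_le_trans[OF _ _ _ that] sub by blast
  have refl: "subobject_le QC (s n) (s n)" for n using subobject_le_refl sub by blast
  have step: "?a n \<le> ?a m \<and> (\<not> subobject_le QC (s m) (s n) \<longrightarrow> ?a n + c0 \<le> ?a m)"
    if le: "subobject_le QC (s n) (s m)" for n m
  proof -
    obtain Y where Y: "Y \<in> Q" "exact_triangle D (Src D (s n)) (Src D (s m)) Y"
       "zero_object D Y \<longrightarrow> subobject_le QC (s m) (s n)"
      using strict_subobject_le_cone[OF spec[OF s] spec[OF s] E le] .
    show ?thesis using Z_ext[OF Y(2)] len_nonneg[OF Y(1)] len_pos[OF Y(1)] Y(3) by auto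
  qed
  {
    assume inc: "\<forall>n. subobject_le QC (s n) (s (Suc n))"
    have "\<exists>N. \<forall>n\<ge>N. \<not> \<not> subobject_le QC (s (Suc n)) (s n)"
      by (rule bounded_increments[of c0 ?a "len E"]) (use c0 sub step inc in auto)
    then obtain N where N: "\<And>n. n \<ge> N \<Longrightarrow> subobject_le QC (s (Suc n)) (s n)" by blast
    have "subobject_le QC (s n) (s N)" if "n \<ge> N" for n using that
      by (induction n rule: dec_induct) (use refl trans N in blast)+
    then show "\<exists>N. \<forall>n\<ge>N. subobject_le QC (s n) (s N)" by blast
  }
  {
    assume dec: "\<forall>n. subobject_le QC (s (Suc n)) (s n)"
    have "\<exists>N. \<forall>n\<ge>N. \<not> \<not> subobject_le QC (s n) (s (Suc n))"
      by (rule bounded_increments[of c0 "\<lambda>n. len E - ?a n" "len E"]) (use c0 sub step dec in fastforce)+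
    then obtain N where N: "\<And>n. n \<ge> N \<Longrightarrow> subobject_le QC (s n) (s (Suc n))" by blast
    have "subobject_le QC (s N) (s n)" if "n \<ge> N" for n using that
      by (induction n rule: dec_induct) (use refl trans N in blast)+
    then show "\<exists>N. \<forall>n\<ge>N. subobject_le QC (s N) (s n)" by blast
  }
qed

section \<open>Estimates for stability conditions\<close>

locale stability = slicing_on +
  fixes Z :: "'a \<Rightarrow> complex"
  assumes Z_additive: "additive_on D Z"
    and phase: "E \<in> P \<phi> \<Longrightarrow> \<not> zero_object D E \<Longrightarrow> \<exists>m>0. Z E = of_real m * cis (pi * \<phi>)"

context slicing_on
begin

lemma PR_mono: "E \<in> PR I \<Longrightarrow> I \<subseteq> J \<Longrightarrow> E \<in> PR J"
  using subsetD[OF phase_range_mono[of I J D P]] by blast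

text \<open>
  The induction principle behind all estimates: a convex condition on charges that holds for the nonzero semistable objects with
  phases in \<open>I\<close> holds for all nonzero objects of \<open>P(I)\<close>.
\<close>

lemma PR_zero_or:
  assumes Z: "additive_on D Z" and add: "\<And>x y. Pr x \<Longrightarrow> Pr y \<Longrightarrow> Pr (x + y)"
    and base: "\<And>\<psi> A. \<psi> \<in> I \<Longrightarrow> A \<in> P \<psi> \<Longrightarrow> \<not> zero_object D A \<Longrightarrow> Pr (Z A)"
  shows "E \<in> PR I \<Longrightarrow> zero_object D E \<or> Pr (Z E)"
proof (induction rule: phase_range_induct)
  case (base \<phi> A) then show ?case using assms(3) by blast
next
  case (ext A B C)
  note e = additive_onD[OF Z ext(1)]
  show ?case
  proof (cases "zero_object D A")
    case True
    then show ?thesis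
      using e ext exact_fibre_zero[OF ext(1) True] zero_iso isomorphic_sym additive_zero[OF Z True] by auto
  next
    case False
    then show ?thesis
      using e ext add additive_zero[OF Z, of C] by (cases "zero_object D C") auto
  qed
qed

lemma PR_additive_bound:
  assumes Z: "additive_on D Z" and W: "additive_on D W" and f: "\<And>x y. f (x + y) = f x + (f y :: real)" "f 0 = 0"
    and base: "\<And>\<psi> A. \<psi> \<in> I \<Longrightarrow> A \<in> P \<psi> \<Longrightarrow> \<not> zero_object D A \<Longrightarrow> cmod (W A) \<le> f (Z A)"
  shows "E \<in> PR I \<Longrightarrow> cmod (W E) \<le> f (Z E)"
proof (induction rule: phase_range_induct)
  case (base \<phi> A) then show ?case
    using assms(5) additive_zero[OF Z] additive_zero[OF W] f by (cases "zero_object D A") auto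
next
  case (ext A B C)
  show ?case unfolding additive_onD[OF Z ext(1)] additive_onD[OF W ext(1)] f(1)
    using norm_triangle_ineq[of "W A" "W C"] ext by linarith
qed

end

context stability
begin

lemma phase_hgt:
  assumes "A \<in> P \<psi>" "\<not> zero_object D A"
  shows "\<phi> < \<psi> \<Longrightarrow> \<psi> < \<phi> + 1 \<Longrightarrow> 0 < hgt \<phi> (Z A)"
    "\<phi> \<le> \<psi> \<Longrightarrow> \<psi> \<le> \<phi> + 1 \<Longrightarrow> 0 \<le> hgt \<phi> (Z A)"
    "\<phi> - 1 < \<psi> \<Longrightarrow> \<psi> < \<phi> \<Longrightarrow> hgt \<phi> (Z A) < 0"
proof -
  obtain m where m: "m > 0" "Z A = of_real m * cis (pi * \<psi>)" using phase[OF assms] by blast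
  show "\<phi> < \<psi> \<Longrightarrow> \<psi> < \<phi> + 1 \<Longrightarrow> 0 < hgt \<phi> (Z A)"
    using m(1) sin_pi_pos[of "\<psi> - \<phi>"] by (simp add: m(2) hgt_polar)
  show "\<phi> \<le> \<psi> \<Longrightarrow> \<psi> \<le> \<phi> + 1 \<Longrightarrow> 0 \<le> hgt \<phi> (Z A)"
    using m(1) sin_pi_nonneg[of "\<psi> - \<phi>"] by (simp add: m(2) hgt_polar)
  show "\<phi> - 1 < \<psi> \<Longrightarrow> \<psi> < \<phi> \<Longrightarrow> hgt \<phi> (Z A) < 0"
    using m(1) sin_pi_neg[of "\<psi> - \<phi>"] by (simp add: m(2) hgt_polar mult_less_0_iff)
qed

lemma PR_hgt_pos: assumes "E \<in> PR I" "\<And>\<psi>. \<psi> \<in> I \<Longrightarrow> \<phi> < \<psi> \<and> \<psi> < \<phi> + 1"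
  shows "zero_object D E \<or> hgt \<phi> (Z E) > 0"
proof (rule PR_zero_or[OF Z_additive _ _ assms(1), of "\<lambda>z. hgt \<phi> z > 0"])
  fix \<psi> A assume "\<psi> \<in> I" "A \<in> P \<psi>" "\<not> zero_object D A"
  then show "hgt \<phi> (Z A) > 0" using phase_hgt(1)[of A \<psi>] assms(2)[of \<psi>] by blast
qed auto

lemma PR_hgt_nonneg: assumes "E \<in> PR I" "\<And>\<psi>. \<psi> \<in> I \<Longrightarrow> \<phi> \<le> \<psi> \<and> \<psi> \<le> \<phi> + 1" shows "hgt \<phi> (Z E) \<ge> 0"
proof -
  have "zero_object D E \<or> hgt \<phi> (Z E) \<ge> 0"
  proof (rule PR_zero_or[OF Z_additive _ _ assms(1), of "\<lambda>z. hgt \<phi> z \<ge> 0"])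
    fix \<psi> A assume "\<psi> \<in> I" "A \<in> P \<psi>" "\<not> zero_object D A"
    then show "hgt \<phi> (Z A) \<ge> 0" using phase_hgt(2)[of A \<psi>] assms(2)[of \<psi>] by blast
  qed auto
  then show ?thesis using additive_zero[OF Z_additive, of E] by auto
qed

lemma PR_hgt_nonpos: assumes "E \<in> PR I" "\<And>\<psi>. \<psi> \<in> I \<Longrightarrow> \<phi> - 1 \<le> \<psi> \<and> \<psi> \<le> \<phi>" shows "hgt \<phi> (Z E) \<le> 0"
  using PR_hgt_nonneg[OF assms(1), of "\<phi> - 1"] assms(2) by (simp add: hgt_minus_one)

lemma PR_wid: assumes "E \<in> PR I" "\<And>\<psi>. \<psi> \<in> I \<Longrightarrow> \<bar>\<psi> - \<theta>\<bar> \<le> w" "w < 1/2" "0 \<le> w" "0 < c"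
    and c: "\<And>\<psi> A. A \<in> P \<psi> \<Longrightarrow> \<not> zero_object D A \<Longrightarrow> c \<le> cmod (Z A)"
  shows "zero_object D E \<or> c * cos (pi * w) \<le> wid \<theta> (Z E)"
proof (rule PR_zero_or[OF Z_additive _ _ assms(1)])
  note cp = cos_pi_pos[OF assms(4,3)]
  fix x y assume "c * cos (pi * w) \<le> wid \<theta> x" "c * cos (pi * w) \<le> wid \<theta> y"
  moreover have "0 < c * cos (pi * w)" using cp assms(5) by simp
  ultimately show "c * cos (pi * w) \<le> wid \<theta> (x + y)" by simp
next
  note cp = cos_pi_pos[OF assms(4,3)]
  fix \<psi> A assume A: "\<psi> \<in> I" "A \<in> P \<psi>" "\<not> zero_object D A"
  then obtain m where m: "m > 0" "Z A = of_real m * cis (pi * \<psi>)" using phase by blast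
  then have "c \<le> m" using c[OF A(2,3)] by (simp add: norm_mult)
  then have "c * cos (pi * w) \<le> m * cos (pi * (\<psi> - \<theta>))"
    using cos_pi_ge[OF assms(2)[OF A(1)] assms(3)] cp m(1) assms(5) by (intro mult_mono) auto
  then show "c * cos (pi * w) \<le> wid \<theta> (Z A)" by (simp add: m(2) wid_polar)
qed

text \<open>
  On an interval of width \<open>2w < 1\<close> the charges of the factors do not cancel, so that a relative bound on semistable objects
  extends to all objects, with the loss of a factor \<open>1 / cos(\<pi>w)\<close>.
\<close>

lemma PR_compare: assumes "E \<in> PR I" "\<And>\<psi>. \<psi> \<in> I \<Longrightarrow> \<bar>\<psi> - \<theta>\<bar> \<le> w" "w < 1/2" "0 \<le> w" "0 \<le> K"
    and W: "additive_on D W"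
    and K: "\<And>\<psi> A. A \<in> P \<psi> \<Longrightarrow> \<not> zero_object D A \<Longrightarrow> cmod (W A) \<le> K * cmod (Z A)"
  shows "cmod (W E) \<le> K / cos (pi * w) * wid \<theta> (Z E)"
proof (rule PR_additive_bound[OF Z_additive W _ _ _ assms(1), of "\<lambda>z. K / cos (pi * w) * wid \<theta> z"])
  note cp = cos_pi_pos[OF assms(4,3)]
  fix \<psi> A assume A: "\<psi> \<in> I" "A \<in> P \<psi>" "\<not> zero_object D A"
  then obtain m where m: "m > 0" "Z A = of_real m * cis (pi * \<psi>)" using phase by blast
  have "K / cos (pi * w) * (m * cos (pi * w)) \<le> K / cos (pi * w) * (m * cos (pi * (\<psi> - \<theta>)))"
    using cos_pi_ge[OF assms(2)[OF A(1)] assms(3)] cp m(1) assms(5) by (intro mult_left_mono) auto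
  moreover have "cmod (W A) \<le> K * m" using K[OF A(2,3)] m by (simp add: norm_mult)
  ultimately show "cmod (W A) \<le> K / cos (pi * w) * wid \<theta> (Z A)" using cp by (simp add: m(2) wid_polar)
qed (auto simp: algebra_simps)

end

lemma real_shift_induct:
  assumes "\<And>x::real. 0 < x \<Longrightarrow> x \<le> 1 \<Longrightarrow> R x" "\<And>x. R (x + 1) \<longleftrightarrow> R x" shows "R y"
proof -
  have 1: "R (x + real n) \<longleftrightarrow> R x" for x n
  proof (induction n)
    case (Suc n) then show ?case using assms(2)[of "x + real n"] by (simp add: algebra_simps)
  qed simp
  define k where "k = \<lceil>y\<rceil> - 1"
  have "R (y - of_int k)" by (rule assms(1)) (unfold k_def, linarith+)
  moreover have "R (y - of_int k) \<longleftrightarrow> R y"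
  proof (cases "k \<ge> 0")
    case True then show ?thesis using 1[of "y - of_int k" "nat k"] by simp
  next
    case False then show ?thesis using 1[of y "nat (- k)"] by simp
  qed
  ultimately show ?thesis by simp
qed

lemma (in triangulated_category) slicing_subset_from_heart:
  assumes "slicing D P" "slicing D P'" "\<And>\<phi>. 0 < \<phi> \<Longrightarrow> \<phi> \<le> 1 \<Longrightarrow> P \<phi> \<subseteq> phase_range D P' {\<phi> - e..\<phi> + e}"
  shows "P \<phi> \<subseteq> phase_range D P' {\<phi> - e..\<phi> + e}"
proof (rule real_shift_induct[where R = "\<lambda>\<phi>. P \<phi> \<subseteq> phase_range D P' {\<phi> - e..\<phi> + e}"])
  interpret P: slicing_on D P using assms(1) by unfold_locales
  interpret P': slicing_on D P' using assms(2) by unfold_locales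
  show "(P (x + 1) \<subseteq> phase_range D P' {x + 1 - e..x + 1 + e}) \<longleftrightarrow> (P x \<subseteq> phase_range D P' {x - e..x + e})" for x
  proof
    assume a: "P (x + 1) \<subseteq> phase_range D P' {x + 1 - e..x + 1 + e}"
    show "P x \<subseteq> phase_range D P' {x - e..x + e}"
    proof
      fix A assume A: "A \<in> P x"
      have "Shift D A \<in> phase_range D P' {x + 1 - e..x + 1 + e}" using P.P_shift[OF A] a by blast
      then have "Unshift D (Shift D A) \<in> phase_range D P' {x - e..x + e}" by (rule P'.PR_unshift) auto
      then show "A \<in> phase_range D P' {x - e..x + e}" using P.P_ob[OF A] by simp
    qed
  next
    assume a: "P x \<subseteq> phase_range D P' {x - e..x + e}"
    show "P (x + 1) \<subseteq> phase_range D P' {x + 1 - e..x + 1 + e}"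
    proof
      fix A assume A: "A \<in> P (x + 1)"
      have "Unshift D A \<in> phase_range D P' {x - e..x + e}" using P.P_unshift[OF A] a by auto
      then have "Shift D (Unshift D A) \<in> phase_range D P' {x + 1 - e..x + 1 + e}" by (rule P'.PR_shift) auto
      then show "A \<in> phase_range D P' {x + 1 - e..x + 1 + e}" using P.P_ob[OF A] by simp
    qed
  qed
qed (use assms(3) in auto)

context stability
begin

context
  fixes P' :: "real \<Rightarrow> 'a set" and l u b \<phi> t :: real and E
  assumes P': "slicing D P'" and E': "E \<in> phase_range D P' {l<..u}"
    and sub: "phase_range D P' {l<..u} \<subseteq> PR {b<..b + 1}" and \<phi>: "b < \<phi>" "\<phi> \<le> b + 1"
begin

text \<open>
  The fibre sequence \<open>F[-1] \<rightarrow> T \<rightarrow> E\<close> shows that \<open>T\<close> has phases at most \<open>\<phi>\<close> for \<open>P\<close>, because those of \<open>F[-1]\<close> are at most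
  \<open>b < \<phi>\<close>. So \<open>Z T\<close> is not above the ray of phase \<open>\<phi>\<close>, while \<open>H\<close> puts it above this ray unless \<open>T = 0\<close>.
\<close>

lemma truncation_upper:
  assumes E: "E \<in> PR {..\<phi>}" and t: "l < t" "t \<le> u"
    and H: "\<And>\<psi> A. t < \<psi> \<Longrightarrow> \<psi> \<le> u \<Longrightarrow> A \<in> P' \<psi> \<Longrightarrow> \<not> zero_object D A \<Longrightarrow> 0 < hgt \<phi> (Z A)"
  shows "E \<in> phase_range D P' {..t}"
proof -
  interpret P': slicing_on D P' using P' by unfold_locales
  have EO: "E \<in> Ob D" using P'.PR_ob E' .
  obtain T F where T: "T \<in> P'.PR {t<..}" "F \<in> P'.PR {..t}" "exact_triangle D T E F" using ts_trunc[OF P'.ts_gt EO] .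
  have lu: "l < u" using t by simp
  have El: "E \<in> P'.PR {l<..}" "E \<in> P'.PR {..u}" using E' P'.PR_gt_le[OF lu] by auto
  have Fu: "F \<in> P'.PR {..u}" by (rule P'.PR_mono[OF T(2)]) (use t in auto)
  have Tl: "T \<in> P'.PR {l<..}" by (rule P'.PR_mono[OF T(1)]) (use t in auto)
  have Tu: "T \<in> P'.PR {..u}" using ts_L_fibre[OF P'.ts_gt T(3) El(2) Fu] .
  have Fl: "F \<in> P'.PR {l<..}" using ts_G_cone[OF P'.ts_gt T(3) Tl El(1)] .
  have "T \<in> PR {b<..b + 1}" "F \<in> PR {b<..b + 1}" using sub Tl Tu Fl Fu P'.PR_gt_le[OF lu] by auto
  then have Tb: "T \<in> PR {b<..}" and Fb: "F \<in> PR {..b + 1}" using PR_gt_le[of b "b + 1"] by auto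
  have "Unshift D F \<in> PR {..\<phi>}" by (rule PR_unshift[OF Fb]) (use \<phi> in auto)
  then have "T \<in> PR {..\<phi>}" using ts_L_ext[OF ts_gt exact_rot_back[OF T(3)] _ E] by blast
  then have "T \<in> PR {b<..\<phi>}" using Tb PR_gt_le[OF \<phi>(1)] by blast
  then have neg: "hgt \<phi> (Z T) \<le> 0" by (rule PR_hgt_nonpos) (use \<phi> in auto)
  have "zero_object D T"
  proof (cases "t = u")
    case True then show ?thesis using ts_zero_if[OF P'.ts_gt T(1)] Tu by blast
  next
    case False
    then have tu: "t < u" using t by simp
    have "T \<in> P'.PR {t<..u}" using T(1) Tu P'.PR_gt_le[OF tu] by blast
    then have "zero_object D T \<or> 0 < hgt \<phi> (Z T)"
      by (rule P'.PR_zero_or[OF Z_additive, rotated 2, where Pr = "\<lambda>z. 0 < hgt \<phi> z"]) (use H in auto)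
    then show ?thesis using neg by auto
  qed
  then have "isomorphic D E F" using exact_fibre_zero T(3) by blast
  then show ?thesis using T(2) P'.PR_iso isomorphic_sym by blast
qed

lemma truncation_lower:
  assumes E: "E \<in> PR {\<phi>..}" and t: "l < t" "t \<le> u"
    and H: "\<And>\<psi> A. l < \<psi> \<Longrightarrow> \<psi> < t \<Longrightarrow> A \<in> P' \<psi> \<Longrightarrow> \<not> zero_object D A \<Longrightarrow> hgt \<phi> (Z A) < 0"
  shows "E \<in> phase_range D P' {t..}"
proof -
  interpret P': slicing_on D P' using P' by unfold_locales
  have EO: "E \<in> Ob D" using P'.PR_ob E' .
  obtain T F where T: "T \<in> P'.PR {t..}" "F \<in> P'.PR {..<t}" "exact_triangle D T E F" using ts_trunc[OF P'.ts_ge EO] .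
  have lu: "l < u" using t by simp
  have El: "E \<in> P'.PR {l<..}" "E \<in> P'.PR {..u}" using E' P'.PR_gt_le[OF lu] by auto
  have Fu: "F \<in> P'.PR {..u}" by (rule P'.PR_mono[OF T(2)]) (use t in auto)
  have Tl: "T \<in> P'.PR {l<..}" by (rule P'.PR_mono[OF T(1)]) (use t in auto)
  have Tu: "T \<in> P'.PR {..u}" using ts_L_fibre[OF P'.ts_gt T(3) El(2) Fu] .
  have Fl: "F \<in> P'.PR {l<..}" using ts_G_cone[OF P'.ts_gt T(3) Tl El(1)] .
  have "T \<in> PR {b<..b + 1}" "F \<in> PR {b<..b + 1}" using sub Tl Tu Fl Fu P'.PR_gt_le[OF lu] by auto
  then have Tb: "T \<in> PR {b<..}" and Fb: "F \<in> PR {..b + 1}" using PR_gt_le[of b "b + 1"] by auto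
  have "Shift D T \<in> PR {\<phi>..}" by (rule PR_shift[OF Tb]) (use \<phi> in auto)
  then have "F \<in> PR {\<phi>..}" using ts_G_ext[OF ts_ge exact_rot[OF T(3)] E] by blast
  then have "F \<in> PR {\<phi>..b + 1}" using Fb PR_ge_le[OF \<phi>(2)] by blast
  then have pos: "0 \<le> hgt \<phi> (Z F)" by (rule PR_hgt_nonneg) (use \<phi> in auto)
  have "F \<in> P'.PR {l<..<t}" using T(2) Fl P'.PR_gt_lt[OF t(1)] by blast
  then have "zero_object D F \<or> hgt \<phi> (Z F) < 0"
    by (rule P'.PR_zero_or[OF Z_additive, rotated 2, where Pr = "\<lambda>z. hgt \<phi> z < 0"]) (use H in auto)
  then have "zero_object D F" using pos by auto
  then have "isomorphic D T E" using exact_cone_zero T(3) by blast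
  then show ?thesis using T(1) P'.PR_iso by blast
qed

end

end

lemma (in triangulated_category) slicing_subset_of_same_heart:
  assumes S: "stability D P Z" and S': "stability D P' Z"
    and heart: "phase_range D P {0<..1} = phase_range D P' {0<..1}"
  shows "P \<phi> \<subseteq> P' \<phi>"
proof -
  interpret P: stability D P Z by (rule S)
  interpret P': stability D P' Z by (rule S')
  have *: "P \<phi> \<subseteq> P' \<phi>" if \<phi>: "0 < \<phi>" "\<phi> \<le> 1" for \<phi>
  proof
    fix E assume E: "E \<in> P \<phi>"
    have E1: "E \<in> P'.PR {0<..1}" using P.PR_base[OF _ E, of "{0<..1}"] heart \<phi> by auto
    have "P'.PR {0<..1} \<subseteq> P.PR {0<..0+1}" using heart by simp
    note tr = P'.slicing E1 this \<phi>(1)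
    have "E \<in> P'.PR {..\<phi>}"
    proof (rule P.truncation_upper[OF tr])
      fix \<psi> A assume "\<phi> < \<psi>" "\<psi> \<le> 1" "A \<in> P' \<psi>" "\<not> zero_object D A"
      then show "0 < hgt \<phi> (Z A)" using P'.phase_hgt(1)[of A \<psi>] \<phi> by simp
    qed (use \<phi> P.PR_base[OF _ E] in auto)
    moreover have "E \<in> P'.PR {\<phi>..}"
    proof (rule P.truncation_lower[OF tr])
      fix \<psi> A assume "0 < \<psi>" "\<psi> < \<phi>" "A \<in> P' \<psi>" "\<not> zero_object D A"
      then show "hgt \<phi> (Z A) < 0" using P'.phase_hgt(3)[of A \<psi>] \<phi> by simp
    qed (use \<phi> P.PR_base[OF _ E] in auto)
    ultimately have "E \<in> P'.PR {\<phi>..\<phi>}" using P'.PR_ge_le[of \<phi> \<phi>] by auto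
    then show "E \<in> P' \<phi>" using P'.PR_singleton by simp
  qed
  show ?thesis
    using slicing_subset_from_heart[OF P.slicing P'.slicing, of 0 \<phi>] * P'.PR_singleton by simp
qed

lemma (in triangulated_category) stability_of_condition:
  assumes "stability_condition D \<sigma>" shows "stability D (slices \<sigma>) (charge D \<sigma>)"
proof unfold_locales
  show "slicing D (slices \<sigma>)" "additive_on D (charge D \<sigma>)"
    using assms charge_additive unfolding stability_condition_def by auto
  show "\<exists>m>0. charge D \<sigma> E = of_real m * cis (pi * \<phi>)" if "E \<in> slices \<sigma> \<phi>" "\<not> zero_object D E" for E \<phi>
    using assms that unfolding stability_condition_def exp_phase by blast
qed

text \<open>
  A stability condition is determined by its heart and its charge on objects.
\<close>

lemma (in triangulated_category) stability_condition_eqI: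
  assumes S: "stability_condition D \<sigma>" and S': "stability_condition D \<tau>"
    and heart: "heart D \<sigma> = heart D \<tau>" and Z: "\<And>E. E \<in> Ob D \<Longrightarrow> charge D \<sigma> E = charge D \<tau> E"
  shows "\<sigma> = \<tau>"
proof -
  interpret P: stability D "slices \<sigma>" "charge D \<sigma>" by (rule stability_of_condition[OF S])
  interpret P': stability D "slices \<tau>" "charge D \<tau>" by (rule stability_of_condition[OF S'])
  have "fst \<sigma> = fst \<tau>"
    using K0_hom_unique[of "fst \<sigma>" "fst \<tau>"] S S' Z unfolding stability_condition_def charge_def by blast
  then have ch: "charge D \<sigma> = charge D \<tau>" by (auto simp: charge_def)
  have "slices \<sigma> \<phi> = slices \<tau> \<phi>" for \<phi>
    using slicing_subset_of_same_heart[of "slices \<sigma>" "charge D \<tau>" "slices \<tau>" \<phi>]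
      slicing_subset_of_same_heart[of "slices \<tau>" "charge D \<tau>" "slices \<sigma>" \<phi>]
      P.stability_axioms P'.stability_axioms heart unfolding ch heart_def by blast
  then show ?thesis using \<open>fst \<sigma> = fst \<tau>\<close> by (intro prod_eqI) auto
qed

lemma reasonableE: assumes "reasonable D \<sigma>"
  obtains c where "0 < c" "\<And>E. E \<in> nonzero_semistable D \<sigma> \<Longrightarrow> c \<le> cmod (charge D \<sigma> E)"
proof -
  let ?I = "INF E \<in> nonzero_semistable D \<sigma>. ennreal (cmod (charge D \<sigma> E))"
  have "0 < ?I" using assms by (simp add: reasonable_def)
  then obtain e where e: "0 < e" "e < ?I" using dense by blast
  then obtain c where c: "0 \<le> c" "e = ennreal c" by (cases e) auto
  have c0: "0 < c" using e c by simp
  have "c \<le> cmod (charge D \<sigma> E)" if "E \<in> nonzero_semistable D \<sigma>" for E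
  proof -
    have "ennreal c \<le> ?I" using c e by simp
    also have "?I \<le> ennreal (cmod (charge D \<sigma> E))" by (rule INF_lower[OF that])
    finally show ?thesis by (simp add: ennreal_le_iff)
  qed
  then show ?thesis using that c0 by blast
qed

lemma reasonableI:
  assumes "0 < c" "\<And>E. E \<in> nonzero_semistable D \<sigma> \<Longrightarrow> c \<le> cmod (charge D \<sigma> E)"
  shows "reasonable D \<sigma>"
proof -
  have "ennreal c \<le> (INF E \<in> nonzero_semistable D \<sigma>. ennreal (cmod (charge D \<sigma> E)))"
    by (rule INF_greatest) (use assms in \<open>auto intro: ennreal_leI\<close>)
  moreover have "0 < ennreal c" using assms by simp
  ultimately show ?thesis unfolding reasonable_def by (rule less_le_trans[rotated])
qed

text \<open>
  Any \<open>\<eta> < 1/2\<close> works, with the rotated real part of the charge as length function; \<open>1/4\<close> is a choice.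
\<close>

lemma (in triangulated_category) reasonable_locally_finite:
  assumes S: "stability_condition D \<sigma>" and r: "reasonable D \<sigma>" shows "locally_finite_stab D \<sigma>"
  unfolding locally_finite_stab_def
proof (intro exI[of _ "1/4"] conjI allI)
  interpret P: stability D "slices \<sigma>" "charge D \<sigma>" by (rule stability_of_condition[OF S])
  obtain c where c: "0 < c" "\<And>E. E \<in> nonzero_semistable D \<sigma> \<Longrightarrow> c \<le> cmod (charge D \<sigma> E)" using reasonableE[OF r] by metis
  fix \<phi> :: real
  let ?s = "\<phi> - 1/4" and ?t = "\<phi> + 1/4"
  have eq: "P.PR {?s<..<?t} = P.PR {?s<..} \<inter> P.PR {..<?t}" by (rule P.PR_gt_lt) simp
  interpret B: bounded_strip D "P.PR {?s<..}" "P.PR {..?s}" "P.PR {?t..}" "P.PR {..<?t}" "charge D \<sigma>" "c * cos (pi * (1/4))" \<phi>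
  proof unfold_locales
    show "t_structure D (P.PR {?s<..}) (P.PR {..?s})" "t_structure D (P.PR {?t..}) (P.PR {..<?t})"
      by (rule P.ts_gt, rule P.ts_ge)
    show "P.PR {?t..} \<subseteq> P.PR {?s<..}" by (rule phase_range_mono) auto
    show "Shift D E \<in> P.PR {?t..}" if "E \<in> P.PR {?s<..}" for E by (rule P.PR_shift[OF that]) auto
    show "additive_on D (charge D \<sigma>)" by (rule P.Z_additive)
    show "0 < c * cos (pi * (1/4))" using c(1) cos_pi_pos[of "1/4"] by simp
    show "c * cos (pi * (1/4)) \<le> wid \<phi> (charge D \<sigma> E)"
      if "E \<in> P.PR {?s<..}" "E \<in> P.PR {..<?t}" "\<not> zero_object D E" for E
    proof -
      have "E \<in> P.PR {?s<..<?t}" using that eq by blast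
      then have "zero_object D E \<or> c * cos (pi * (1/4)) \<le> wid \<phi> (charge D \<sigma> E)"
      proof (rule P.PR_wid)
        show "\<bar>\<psi> - \<phi>\<bar> \<le> 1/4" if "\<psi> \<in> {?s<..<?t}" for \<psi>
          unfolding abs_le_iff using that by auto
      qed (use c in \<open>auto simp: nonzero_semistable_def\<close>)
      then show ?thesis using that by blast
    qed
  qed
  show "finite_length (full_subcategory D (P.PR {?s<..<?t}))"
    using B.finite_length_Q unfolding eq B.Q_def .
qed auto

lemma int_shift_invariant:
  assumes "\<And>x::real. R (x + 1) \<longleftrightarrow> R x" shows "R (x + of_int k) \<longleftrightarrow> R x"
proof -
  have 1: "R (x + real n) \<longleftrightarrow> R x" for x n
  proof (induction n)
    case (Suc n) then show ?case using assms[of "x + real n"] by (simp add: algebra_simps)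
  qed simp
  show ?thesis
  proof (cases "k \<ge> 0")
    case True then show ?thesis using 1[of x "nat k"] by simp
  next
    case False then show ?thesis using 1[of "x + of_int k" "nat (- k)"] by simp
  qed
qed

lemma (in triangulated_category) hn_append:
  assumes T: "hn D P T t b" shows "hn D P F t' b' \<Longrightarrow> exact_triangle D T E F \<Longrightarrow> t' < b \<Longrightarrow> hn D P E t b'"
proof (induction arbitrary: E rule: hn.induct)
  case (single F \<phi>) then show ?case using hn.step[where P=P, OF T] by metis
next
  case (step F' t' b' F A \<phi>)
  obtain K where K: "exact_triangle D K E A" "exact_triangle D T K F'" using octahedron_fibre[OF step.prems(1) step.hyps(2)] .
  show ?case by (rule hn.step[where P=P, OF step.IH[OF K(2) step.prems(2)] K(1) step.hyps(3-5)])
qed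

section \<open>Semiorthogonal decompositions\<close>

locale semiorthogonal = triangulated_category +
  fixes D1 D2 :: "'a set"
  assumes sod: "semiorthogonal_decomposition D D1 D2"
begin

abbreviation "C1 \<equiv> full_subcategory D D1"
abbreviation "C2 \<equiv> full_subcategory D D2"
abbreviation "lam \<equiv> lambda1 D D1 D2"
abbreviation "rho \<equiv> rho2 D D1 D2"

lemma sub1: "triangulated_subcategory_of D D1"
  using sod by unfold_locales (simp add: semiorthogonal_decomposition_def)
lemma sub2: "triangulated_subcategory_of D D2"
  using sod by unfold_locales (simp add: semiorthogonal_decomposition_def)

end

sublocale semiorthogonal \<subseteq> S1: triangulated_subcategory_of D D1 by (rule sub1)
sublocale semiorthogonal \<subseteq> S2: triangulated_subcategory_of D D2 by (rule sub2)

context semiorthogonal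
begin

lemma sod_orth: "A \<in> D2 \<Longrightarrow> B \<in> D1 \<Longrightarrow> orth D A B"
  using sod unfolding semiorthogonal_decomposition_def orth_def by blast

text \<open>
  The values of \<open>\<lambda>\<^sub>1\<close> and \<open>\<rho>\<^sub>2\<close> are chosen independently of each other; this lemma shows that they nevertheless fit into one triangle,
  which is \<open>decomp\<close>.
\<close>

lemma decomposition_unique':
  assumes "exact_triangle D E2 E E1" "E1 \<in> D1" "E2 \<in> D2" "exact_triangle D F2 E F1" "F1 \<in> D1" "F2 \<in> D2"
  shows "isomorphic D E2 F2 \<and> isomorphic D E1 F1"
proof (rule decomposition_unique[OF assms(1,4)])
  fix X Y assume "X \<in> {E2, F2}" "Y \<in> {E1, F1}"
  then have "X \<in> D2" "Y \<in> D1" using assms by auto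
  then show "orth D X Y \<and> orth D (Shift D X) Y" using sod_orth S2.sub_shift by blast
qed

lemma decomp: assumes "E \<in> Ob D" shows "exact_triangle D (rho E) E (lam E)" "lam E \<in> D1" "rho E \<in> D2"
proof -
  have ex: "\<exists>E1 E2. decomposition_triangle D D1 D2 E E1 E2"
    using sod assms unfolding semiorthogonal_decomposition_def by blast
  then have "\<exists>E2. decomposition_triangle D D1 D2 E (lam E) E2" unfolding lambda1_def by (rule someI_ex)
  then obtain E2 where E2: "exact_triangle D E2 E (lam E)" "lam E \<in> D1" "E2 \<in> D2"
    unfolding decomposition_triangle_def by blast
  have "\<exists>E2 E1. decomposition_triangle D D1 D2 E E1 E2" using ex by blast
  then have "\<exists>E1. decomposition_triangle D D1 D2 E E1 (rho E)" unfolding rho2_def by (rule someI_ex)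
  then obtain E1 where E1: "exact_triangle D (rho E) E E1" "E1 \<in> D1" "rho E \<in> D2"
    unfolding decomposition_triangle_def by blast
  have i: "isomorphic D E2 (rho E)" using decomposition_unique'[OF E2 E1] by blast
  show "exact_triangle D (rho E) E (lam E)"
    using exact_iso[OF E2(1) i isomorphic_refl isomorphic_refl] assms E2(2) S1.sub_ob by blast
  show "lam E \<in> D1" "rho E \<in> D2" using E1 E2 by auto
qed

lemma decomp_iso:
  assumes "exact_triangle D E2 E E1" "E1 \<in> D1" "E2 \<in> D2"
  shows "isomorphic D E1 (lam E)" "isomorphic D E2 (rho E)"
  using decomposition_unique'[OF assms decomp] exact_obs[OF assms(1)] by blast+

lemma decomp_exact: assumes e: "exact_triangle D A B C"
  shows "exact_triangle D (lam A) (lam B) (lam C)" "exact_triangle D (rho A) (rho B) (rho C)"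
proof -
  have ob: "A \<in> Ob D" "B \<in> Ob D" "C \<in> Ob D" using exact_obs[OF e] by auto
  obtain C1' C2' where C: "exact_triangle D (rho A) (rho B) C2'" "exact_triangle D (lam A) (lam B) C1'"
      "exact_triangle D C2' C C1'"
    using decomposition_of_triangle[OF e decomp(1)[OF ob(1)] decomp(1)[OF ob(2)]
      sod_orth[OF decomp(3)[OF ob(1)] decomp(2)[OF ob(2)]]] .
  have "C1' \<in> D1" by (rule S1.sub_cone[OF C(2)]) (use decomp(2) ob in auto)
  moreover have "C2' \<in> D2" by (rule S2.sub_cone[OF C(1)]) (use decomp(3) ob in auto)
  ultimately have i: "isomorphic D C1' (lam C)" "isomorphic D C2' (rho C)" using decomp_iso[OF C(3)] by auto
  have o: "lam A \<in> Ob D" "lam B \<in> Ob D" "rho A \<in> Ob D" "rho B \<in> Ob D" using exact_obs C by blast+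
  show "exact_triangle D (lam A) (lam B) (lam C)"
    using exact_iso[OF C(2) isomorphic_refl isomorphic_refl i(1)] o by blast
  show "exact_triangle D (rho A) (rho B) (rho C)"
    using exact_iso[OF C(1) isomorphic_refl isomorphic_refl i(2)] o by blast
qed

lemma decomp_respects_iso: assumes "isomorphic D E F" shows "isomorphic D (lam E) (lam F)" "isomorphic D (rho E) (rho F)"
proof -
  have E: "E \<in> Ob D" using isomorphic_obs[OF assms] by blast
  have o: "lam E \<in> Ob D" "rho E \<in> Ob D" using exact_obs[OF decomp(1)[OF E]] by auto
  have "exact_triangle D (rho E) F (lam E)"
    using exact_iso[OF decomp(1)[OF E] isomorphic_refl assms isomorphic_refl] o by blast
  then show "isomorphic D (lam E) (lam F)" "isomorphic D (rho E) (rho F)" using decomp_iso decomp[OF E] by blast+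
qed

lemma decomp_shift: assumes "E \<in> Ob D"
  shows "isomorphic D (Shift D (lam E)) (lam (Shift D E))" "isomorphic D (Shift D (rho E)) (rho (Shift D E))"
  using decomp_iso[OF exact_shift[OF decomp(1)[OF assms]]] decomp[OF assms] S1.sub_shift S2.sub_shift by blast+

lemma zero_decomp: assumes "E \<in> Ob D" "zero_object D (lam E)" "zero_object D (rho E)" shows "zero_object D E"
  using exact_fibre_zero[OF decomp(1)[OF assms(1)] assms(3)] zero_iso assms(2) isomorphic_sym by blast

lemma Unshift_C: "A \<in> D1 \<Longrightarrow> Unshift C1 A = Unshift D A" "A \<in> D2 \<Longrightarrow> Unshift C2 A = Unshift D A"
proof -
  have *: "Unshift (full_subcategory D S) A = Unshift D A" if "triangulated_subcategory_of D S" "A \<in> S" for S A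
  proof -
    interpret S: triangulated_subcategory_of D S by (rule that)
    interpret C: triangulated_category "full_subcategory D S" by (rule S.sub_triangulated)
    have A: "A \<in> Ob (full_subcategory D S)" using that(2) by (simp add: full_subcategory_sel)
    let ?U = "Unshift (full_subcategory D S) A"
    have "Shift D ?U = A" "?U \<in> S" using C.Shift_Unshift[OF A] C.Unshift_ob[OF A] by (simp_all add: full_subcategory_sel)
    then show ?thesis using S.sub_ob Unshift_Shift by (metis subsetD)
  qed
  show "A \<in> D1 \<Longrightarrow> Unshift C1 A = Unshift D A" "A \<in> D2 \<Longrightarrow> Unshift C2 A = Unshift D A"
    using *[OF sub1] *[OF sub2] by auto
qed

end

section \<open>Gluing\<close>

text \<open>
  The data on \<open>D1\<close> and \<open>D2\<close> that enter the construction. The condition \<open>compat\<close> is the vanishing condition that defines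
  the domain of the gluing map, in a form without shifts, and \<open>c0\<close> witnesses that both stability conditions are reasonable.
\<close>

locale glue_data = semiorthogonal +
  fixes P1 :: "real \<Rightarrow> 'a set" and Z1 :: "'a \<Rightarrow> complex" and P2 :: "real \<Rightarrow> 'a set" and Z2 :: "'a \<Rightarrow> complex"
    and \<epsilon> c0 :: real
  assumes stab1: "stability (full_subcategory D D1) P1 Z1" and stab2: "stability (full_subcategory D D2) P2 Z2"
    and eps: "0 < \<epsilon>" and c0: "0 < c0"
    and compat: "A \<in> phase_range (full_subcategory D D1) P1 {- \<epsilon><..} \<Longrightarrow>
      B \<in> phase_range (full_subcategory D D2) P2 {..<1 + \<epsilon>} \<Longrightarrow> orth D A B"
    and mass1: "A \<in> P1 \<psi> \<Longrightarrow> \<not> zero_object D A \<Longrightarrow> c0 \<le> cmod (Z1 A)"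
    and mass2: "B \<in> P2 \<psi> \<Longrightarrow> \<not> zero_object D B \<Longrightarrow> c0 \<le> cmod (Z2 B)"

sublocale glue_data \<subseteq> A1: stability "full_subcategory D D1" P1 Z1 by (rule stab1)
sublocale glue_data \<subseteq> A2: stability "full_subcategory D D2" P2 Z2 by (rule stab2)

context glue_data
begin

abbreviation "R1 \<equiv> phase_range (full_subcategory D D1) P1"
abbreviation "R2 \<equiv> phase_range (full_subcategory D D2) P2"

lemma R_mem: "E \<in> R1 I \<Longrightarrow> E \<in> D1" "E \<in> R2 I \<Longrightarrow> E \<in> D2"
  using A1.PR_ob[of E I] A2.PR_ob[of E I] by (simp_all add: full_subcategory_sel)

lemma R_iso: "isomorphic D A B \<Longrightarrow> A \<in> R1 I \<Longrightarrow> B \<in> R1 I" "isomorphic D A B \<Longrightarrow> A \<in> R2 I \<Longrightarrow> B \<in> R2 I"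
proof -
  show "B \<in> R1 I" if "isomorphic D A B" "A \<in> R1 I"
  proof (rule A1.PR_iso[OF that(2)])
    have "A \<in> D1" "B \<in> D1" using R_mem(1)[OF that(2)] S1.sub_iso that(1) iso_closedD by blast+
    then show "isomorphic C1 A B" using that(1) by (simp add: isomorphic_full)
  qed
  show "B \<in> R2 I" if "isomorphic D A B" "A \<in> R2 I"
  proof (rule A2.PR_iso[OF that(2)])
    have "A \<in> D2" "B \<in> D2" using R_mem(2)[OF that(2)] S2.sub_iso that(1) iso_closedD by blast+
    then show "isomorphic C2 A B" using that(1) by (simp add: isomorphic_full)
  qed
qed

lemma R_shift:
  assumes "\<And>\<phi>. \<phi> \<in> I \<Longrightarrow> \<phi> + 1 \<in> J"
  shows "E \<in> R1 I \<Longrightarrow> Shift D E \<in> R1 J" "E \<in> R2 I \<Longrightarrow> Shift D E \<in> R2 J"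
  using A1.PR_shift[of E I J] A2.PR_shift[of E I J] assms by (simp_all add: full_subcategory_sel)

lemma R_unshift:
  assumes "\<And>\<phi>. \<phi> \<in> I \<Longrightarrow> \<phi> - 1 \<in> J"
  shows "E \<in> R1 I \<Longrightarrow> Unshift D E \<in> R1 J" "E \<in> R2 I \<Longrightarrow> Unshift D E \<in> R2 J"
  using A1.PR_unshift[of E I J] A2.PR_unshift[of E I J] assms Unshift_C R_mem
  by metis+

lemma R_mono: "I \<subseteq> J \<Longrightarrow> E \<in> R1 I \<Longrightarrow> E \<in> R1 J" "I \<subseteq> J \<Longrightarrow> E \<in> R2 I \<Longrightarrow> E \<in> R2 J"
  using A1.PR_mono A2.PR_mono by blast+

text \<open>
  The phases at which the two slicings can be glued.
\<close>

definition "good t \<longleftrightarrow> (\<exists>n::int. \<bar>t - of_int n\<bar> < \<epsilon>)"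

text \<open>
  Shifting both arguments reduces to \<open>\<bar>t\<bar> < \<epsilon>\<close>, where the claim is contained in \<open>compat\<close>.
\<close>

lemma good_orth: assumes "good t" "A \<in> R1 {t<..}" "B \<in> R2 {..t + 1}" shows "orth D A B"
proof -
  let ?R = "\<lambda>t. \<forall>A \<in> R1 {t<..}. \<forall>B \<in> R2 {..t + 1}. orth D A B"
  have ob: "A \<in> Ob D" "B \<in> Ob D" if "A \<in> R1 I" "B \<in> R2 J" for A B I J
    using R_mem(1)[OF that(1)] R_mem(2)[OF that(2)] S1.sub_ob S2.sub_ob by blast+
  have sh: "?R (t + 1) \<longleftrightarrow> ?R t" for t
  proof (intro iffI ballI)
    fix A B assume h: "?R (t + 1)" and AB: "A \<in> R1 {t<..}" "B \<in> R2 {..t + 1}"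
    have "Shift D A \<in> R1 {t + 1<..}" "Shift D B \<in> R2 {..t + 1 + 1}"
      by (rule R_shift(1)[OF _ AB(1)], simp) (rule R_shift(2)[OF _ AB(2)], simp)
    then have "orth D (Shift D A) (Shift D B)" using h by blast
    then show "orth D A B" using orth_shift[OF ob[OF AB]] by simp
  next
    fix A B assume h: "?R t" and AB: "A \<in> R1 {t + 1<..}" "B \<in> R2 {..t + 1 + 1}"
    have "Unshift D A \<in> R1 {t<..}" "Unshift D B \<in> R2 {..t + 1}"
      by (rule R_unshift(1)[OF _ AB(1)], simp) (rule R_unshift(2)[OF _ AB(2)], simp)
    then have "orth D (Unshift D A) (Unshift D B)" using h by blast
    then show "orth D A B"
      using orth_shift[of "Unshift D A" "Unshift D B"] ob[OF AB] by (simp add: Unshift_ob)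
  qed
  obtain n :: int where n: "\<bar>t - of_int n\<bar> < \<epsilon>" using assms(1) good_def by blast
  have "?R (t - of_int n)"
  proof (intro ballI)
    fix A B assume AB: "A \<in> R1 {t - of_int n<..}" "B \<in> R2 {..t - of_int n + 1}"
    show "orth D A B"
    proof (rule compat)
      show "A \<in> R1 {- \<epsilon><..}" by (rule R_mono(1)[OF _ AB(1)]) (use n in auto)
      show "B \<in> R2 {..<1 + \<epsilon>}" by (rule R_mono(2)[OF _ AB(2)]) (use n in auto)
    qed
  qed
  then have "?R t" using int_shift_invariant[where R = ?R, OF sh, of "t - of_int n" n] by simp
  then show ?thesis using assms by blast
qed

definition "GG I = {E \<in> Ob D. lam E \<in> R1 I \<and> rho E \<in> R2 I}"

lemma GG_mono: "I \<subseteq> J \<Longrightarrow> E \<in> GG I \<Longrightarrow> E \<in> GG J"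
  unfolding GG_def using R_mono by blast

lemma GG_ob: "E \<in> GG I \<Longrightarrow> E \<in> Ob D" unfolding GG_def by blast

lemma GG_iso: "isomorphic D E F \<Longrightarrow> E \<in> GG I \<Longrightarrow> F \<in> GG I"
  unfolding GG_def using decomp_respects_iso R_iso isomorphic_obs by (metis (no_types, lifting) mem_Collect_eq)

lemma GG_I: "exact_triangle D E2 E E1 \<Longrightarrow> E1 \<in> R1 I \<Longrightarrow> E2 \<in> R2 I \<Longrightarrow> E \<in> GG I"
  unfolding GG_def using decomp_iso R_mem R_iso exact_obs by (metis (no_types, lifting) mem_Collect_eq)

lemma GG_shift: assumes "E \<in> GG I" "\<And>\<phi>. \<phi> \<in> I \<Longrightarrow> \<phi> + 1 \<in> J" shows "Shift D E \<in> GG J"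
proof -
  have E: "E \<in> Ob D" "lam E \<in> R1 I" "rho E \<in> R2 I" using assms(1) unfolding GG_def by auto
  have "Shift D (lam E) \<in> R1 J" "Shift D (rho E) \<in> R2 J"
    using R_shift(1)[OF assms(2) E(2)] R_shift(2)[OF assms(2) E(3)] by auto
  then show ?thesis unfolding GG_def using R_iso decomp_shift[OF E(1)] E(1) by blast
qed

lemma GG_unshift: assumes "E \<in> GG I" "\<And>\<phi>. \<phi> \<in> I \<Longrightarrow> \<phi> - 1 \<in> J" shows "Unshift D E \<in> GG J"
proof -
  have E: "E \<in> Ob D" "lam E \<in> R1 I" "rho E \<in> R2 I" using assms(1) unfolding GG_def by auto
  have U: "Unshift D (lam E) \<in> R1 J" "Unshift D (rho E) \<in> R2 J"
    using R_unshift(1)[OF assms(2) E(2)] R_unshift(2)[OF assms(2) E(3)] by auto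
  have "exact_triangle D (Unshift D (rho E)) (Unshift D E) (Unshift D (lam E))"
    using exact_Unshift[OF decomp(1)[OF E(1)]] .
  then show ?thesis using GG_I U by blast
qed

lemma GG_Int: "b < c \<Longrightarrow> GG {b<..c} = GG {b<..} \<inter> GG {..c}"
  unfolding GG_def using A1.PR_gt_le[of b c] A2.PR_gt_le[of b c] by auto

lemma GG_orth: assumes "good t" "E \<in> GG {t<..}" "F \<in> GG {..t}" shows "orth D E F"
proof -
  have E: "E \<in> Ob D" "lam E \<in> R1 {t<..}" "rho E \<in> R2 {t<..}" using assms(2) unfolding GG_def by auto
  have F: "F \<in> Ob D" "lam F \<in> R1 {..t}" "rho F \<in> R2 {..t}" using assms(3) unfolding GG_def by auto
  have 1: "orth D (lam E) (lam F)" using A1.PR_orth[OF E(2) F(2)] by (auto simp: orth_full)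
  have 2: "orth D (rho E) (rho F)" using A2.PR_orth[OF E(3) F(3)] by (auto simp: orth_full)
  have 3: "orth D (rho E) (lam F)" using sod_orth decomp E(1) F(1) by blast
  have "rho F \<in> R2 {..t + 1}" by (rule R_mono(2)[OF _ F(3)]) auto
  then have 4: "orth D (lam E) (rho F)" using good_orth[OF assms(1) E(2)] by blast
  have "orth D (lam E) F" "orth D (rho E) F"
    using orth_ext_right[OF decomp(1)[OF F(1)]] 1 2 3 4 by blast+
  then show ?thesis using orth_ext_left[OF decomp(1)[OF E(1)]] by blast
qed

text \<open>
  Truncate \<open>lam E\<close> and \<open>rho E\<close> and rearrange the four pieces \<open>T2, F2, T1, F1\<close>, in which \<open>E\<close> is filtered in this order, to
  \<open>T2, T1, F2, F1\<close>. The exchange in the middle is possible because \<open>Hom(T1, F2[1]) = 0\<close>, and this is where the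
  compatibility of the two slicings enters.
\<close>

lemma GG_trunc: assumes g: "good t" and E: "E \<in> Ob D"
  shows "\<exists>T \<in> GG {t<..}. \<exists>F \<in> GG {..t}. exact_triangle D T E F"
proof -
  have o: "lam E \<in> Ob C1" "rho E \<in> Ob C2" using decomp[OF E] by (auto simp: full_subcategory_sel)
  obtain T1 F1 where 1: "T1 \<in> R1 {t<..}" "F1 \<in> R1 {..t}" "exact_triangle C1 T1 (lam E) F1"
    using A1.ts_trunc[OF A1.ts_gt o(1)] .
  obtain T2 F2 where 2: "T2 \<in> R2 {t<..}" "F2 \<in> R2 {..t}" "exact_triangle C2 T2 (rho E) F2"
    using A2.ts_trunc[OF A2.ts_gt o(2)] .
  have e1: "exact_triangle D T1 (lam E) F1" and e2: "exact_triangle D T2 (rho E) F2"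
    using 1(3) 2(3) S1.exact_sub S2.exact_sub by blast+
  obtain X where X: "exact_triangle D X E F1" "exact_triangle D (rho E) X T1" using octahedron_fibre[OF decomp(1)[OF E] e1] .
  obtain Y where Y: "exact_triangle D T2 X Y" "exact_triangle D F2 Y T1" using octahedron[OF e2 X(2)] .
  have "Shift D F2 \<in> R2 {..t + 1}" by (rule R_shift(2)[OF _ 2(2)]) auto
  then have "orth D T1 (Shift D F2)" using good_orth[OF g 1(1)] by blast
  then have Y': "exact_triangle D T1 Y F2" using split_triangle[OF Y(2)] by blast
  obtain T where T: "exact_triangle D T X F2" "exact_triangle D T2 T T1" using octahedron_fibre[OF Y(1) Y'] .
  obtain F where F: "exact_triangle D T E F" "exact_triangle D F2 F F1" using octahedron[OF T(1) X(1)] .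
  show ?thesis using GG_I[OF T(2) 1(1) 2(1)] GG_I[OF F(2) 1(2) 2(2)] F(1) by blast
qed

lemma GG_ts: assumes g: "good t" shows "t_structure D (GG {t<..}) (GG {..t})"
proof (rule t_structureI)
  show "GG {t<..} \<subseteq> Ob D" "GG {..t} \<subseteq> Ob D" using GG_ob by blast+
  show "iso_closed D (GG {t<..})" "iso_closed D (GG {..t})" using GG_iso unfolding iso_closed_def by blast+
  show "Shift D E \<in> GG {t<..}" if "E \<in> GG {t<..}" for E by (rule GG_shift[OF that]) auto
qed (use GG_orth[OF g] GG_trunc[OF g] in auto)

definition "Z E = Z1 (lam E) + Z2 (rho E)"

lemma Z_additive: "additive_on D Z"
  unfolding additive_on_def
proof (intro allI impI)
  fix A B C assume e: "exact_triangle D A B C"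
  have ob: "A \<in> Ob D" "B \<in> Ob D" "C \<in> Ob D" using exact_obs[OF e] by auto
  have "exact_triangle C1 (lam A) (lam B) (lam C)" "exact_triangle C2 (rho A) (rho B) (rho C)"
    unfolding S1.exact_sub S2.exact_sub using decomp_exact[OF e] decomp(2,3) ob by auto
  then show "Z B = Z A + Z C"
    unfolding Z_def using additive_onD[OF A1.Z_additive] additive_onD[OF A2.Z_additive] by simp
qed

lemma GG_zero_or:
  assumes E: "E \<in> GG I" and add: "\<And>x y. Pr x \<Longrightarrow> Pr y \<Longrightarrow> Pr (x + y)"
    and 1: "\<And>A. A \<in> R1 I \<Longrightarrow> zero_object D A \<or> Pr (Z1 A)"
    and 2: "\<And>A. A \<in> R2 I \<Longrightarrow> zero_object D A \<or> Pr (Z2 A)"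
  shows "zero_object D E \<or> Pr (Z E)"
proof -
  have e: "E \<in> Ob D" "lam E \<in> R1 I" "rho E \<in> R2 I" using E unfolding GG_def by auto
  have z1: "Z1 (lam E) = 0" if "zero_object D (lam E)"
    using A1.additive_zero[OF A1.Z_additive] that S1.zero_sub by blast
  have z2: "Z2 (rho E) = 0" if "zero_object D (rho E)"
    using A2.additive_zero[OF A2.Z_additive] that S2.zero_sub by blast
  show ?thesis using 1[OF e(2)] 2[OF e(3)] z1 z2 add zero_decomp[OF e(1)] unfolding Z_def by auto
qed

lemma GG_hgt_pos: assumes "E \<in> GG I" "\<And>\<psi>. \<psi> \<in> I \<Longrightarrow> \<phi> < \<psi> \<and> \<psi> < \<phi> + 1"
  shows "zero_object D E \<or> 0 < hgt \<phi> (Z E)"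
proof (rule GG_zero_or[OF assms(1), of "\<lambda>z. 0 < hgt \<phi> z"])
  show "zero_object D A \<or> 0 < hgt \<phi> (Z1 A)" if "A \<in> R1 I" for A
    using A1.PR_hgt_pos[OF that assms(2)] S1.zero_sub by blast
  show "zero_object D A \<or> 0 < hgt \<phi> (Z2 A)" if "A \<in> R2 I" for A
    using A2.PR_hgt_pos[OF that assms(2)] S2.zero_sub by blast
qed auto

lemma GG_hgt_nonpos: assumes "E \<in> GG I" "\<And>\<psi>. \<psi> \<in> I \<Longrightarrow> \<phi> - 1 \<le> \<psi> \<and> \<psi> \<le> \<phi>"
  shows "hgt \<phi> (Z E) \<le> 0"
proof -
  have "lam E \<in> R1 I" "rho E \<in> R2 I" using assms(1) unfolding GG_def by auto
  then have "hgt \<phi> (Z1 (lam E)) \<le> 0" "hgt \<phi> (Z2 (rho E)) \<le> 0"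
    using A1.PR_hgt_nonpos assms(2) A2.PR_hgt_nonpos by blast+
  then show ?thesis by (simp add: Z_def)
qed

lemma GG_hgt_nonneg: assumes "E \<in> GG I" "\<And>\<psi>. \<psi> \<in> I \<Longrightarrow> \<phi> \<le> \<psi> \<and> \<psi> \<le> \<phi> + 1"
  shows "0 \<le> hgt \<phi> (Z E)"
proof -
  have "lam E \<in> R1 I" "rho E \<in> R2 I" using assms(1) unfolding GG_def by auto
  then have "0 \<le> hgt \<phi> (Z1 (lam E))" "0 \<le> hgt \<phi> (Z2 (rho E))"
    using A1.PR_hgt_nonneg assms(2) A2.PR_hgt_nonneg by blast+
  then show ?thesis by (simp add: Z_def)
qed

lemma GG_wid: assumes "E \<in> GG I" "\<And>\<psi>. \<psi> \<in> I \<Longrightarrow> \<bar>\<psi> - \<theta>\<bar> \<le> w" "w < 1/2" "0 \<le> w"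
  shows "zero_object D E \<or> c0 * cos (pi * w) \<le> wid \<theta> (Z E)"
proof (rule GG_zero_or[OF assms(1), of "\<lambda>z. c0 * cos (pi * w) \<le> wid \<theta> z"])
  show "zero_object D A \<or> c0 * cos (pi * w) \<le> wid \<theta> (Z1 A)" if "A \<in> R1 I" for A
    using A1.PR_wid[OF that assms(2-4) c0] mass1 S1.zero_sub by blast
  show "zero_object D A \<or> c0 * cos (pi * w) \<le> wid \<theta> (Z2 A)" if "A \<in> R2 I" for A
    using A2.PR_wid[OF that assms(2-4) c0] mass2 S2.zero_sub by blast
  fix x y assume "c0 * cos (pi * w) \<le> wid \<theta> x" "c0 * cos (pi * w) \<le> wid \<theta> y"
  moreover have "0 < c0 * cos (pi * w)" using cos_pi_pos[OF assms(4,3)] c0 by simp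
  ultimately show "c0 * cos (pi * w) \<le> wid \<theta> (x + y)" by simp
qed

text \<open>
  The charge on \<open>D(b, c]\<close> is estimated through the two components, each of which is an extension of semistable objects.
  The constants \<open>(b+c)/2\<close> and \<open>(c-b)/2\<close> are the centre and the radius of the interval of phases.
\<close>

lemma GG_piece: assumes g: "good b" "good c" and bc: "b < c" "c < b + 1"
  shows "piece D (GG {b<..}) (GG {..b}) (GG {c<..}) (GG {..c}) Z (c0 * cos (pi * ((c - b) / 2))) ((b + c) / 2) b c"
proof unfold_locales
  show "t_structure D (GG {b<..}) (GG {..b})" "t_structure D (GG {c<..}) (GG {..c})" using GG_ts g by auto
  show "GG {c<..} \<subseteq> GG {b<..}" using GG_mono[of "{c<..}" "{b<..}"] bc by auto
  show "Shift D E \<in> GG {c<..}" if "E \<in> GG {b<..}" for E by (rule GG_shift[OF that]) (use bc in auto)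
  show "additive_on D Z" by (rule Z_additive)
  show "0 < c0 * cos (pi * ((c - b) / 2))" using c0 cos_pi_pos[of "(c - b) / 2"] bc by simp
  show "c0 * cos (pi * ((c - b) / 2)) \<le> wid ((b + c) / 2) (Z E)"
    if "E \<in> GG {b<..}" "E \<in> GG {..c}" "\<not> zero_object D E" for E
  proof -
    have "E \<in> GG {b<..c}" using that GG_Int[OF bc(1)] by blast
    then have "zero_object D E \<or> c0 * cos (pi * ((c - b) / 2)) \<le> wid ((b + c) / 2) (Z E)"
    proof (rule GG_wid)
      show "\<bar>\<psi> - (b + c) / 2\<bar> \<le> (c - b) / 2" if "\<psi> \<in> {b<..c}" for \<psi>
        using that unfolding abs_le_iff by (auto simp: field_simps)
    qed (use bc in auto)
    then show ?thesis using that by blast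
  qed
  show "b < c" "c < b + 1" by fact+
  show "0 < hgt b (Z E) \<and> hgt c (Z E) \<le> 0" if "E \<in> GG {b<..}" "E \<in> GG {..c}" "\<not> zero_object D E" for E
  proof -
    have E: "E \<in> GG {b<..c}" using that GG_Int[OF bc(1)] by blast
    have "zero_object D E \<or> 0 < hgt b (Z E)" by (rule GG_hgt_pos[OF E]) (use bc in auto)
    moreover have "hgt c (Z E) \<le> 0" by (rule GG_hgt_nonpos[OF E]) (use bc in auto)
    ultimately show ?thesis using that by blast
  qed
  show "0 \<le> hgt \<phi> (Z X)" if X: "X \<in> GG {c<..}" "Unshift D X \<in> GG {..b}" "b < \<phi>" "\<phi> \<le> c" for X \<phi>
  proof -
    have "Shift D (Unshift D X) \<in> GG {..b + 1}" by (rule GG_shift[OF X(2)]) auto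
    then have "X \<in> GG {c<..b + 1}" using X(1) GG_Int[of c "b + 1"] bc GG_ob[OF X(1)] by simp
    then show ?thesis by (rule GG_hgt_nonneg) (use X bc in auto)
  qed
qed

text \<open>
  \<open>piece.sst\<close> for the glued t-structures at \<open>b\<close> and \<open>c\<close>, spelled out so that it can be stated before \<open>b\<close> and \<open>c\<close> are
  known to be good.
\<close>

definition "sstab b c \<phi> E \<longleftrightarrow> E \<in> GG {b<..c} \<and> hgt \<phi> (Z E) = 0 \<and>
  (\<forall>X Y. exact_triangle D X E Y \<and> X \<in> GG {b<..c} \<and> Y \<in> GG {b<..c} \<longrightarrow> hgt \<phi> (Z X) \<le> 0)"

lemma sstab_piece: assumes "good b" "good c" "b < c" "c < b + 1"
  shows "piece.sst D (GG {b<..}) (GG {..c}) Z \<phi> E \<longleftrightarrow> sstab b c \<phi> E"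
    "strip.Q (GG {b<..}) (GG {..c}) = GG {b<..c}"
proof -
  interpret p: piece D "GG {b<..}" "GG {..b}" "GG {c<..}" "GG {..c}" Z "c0 * cos (pi * ((c - b) / 2))" "(b + c) / 2" b c
    by (rule GG_piece[OF assms])
  show 1: "p.Q = GG {b<..c}" unfolding p.Q_def GG_Int[OF assms(3)] by simp
  show "p.sst \<phi> E \<longleftrightarrow> sstab b c \<phi> E" unfolding p.sst_def sstab_def 1 by simp
qed

lemma hgt_shift: "E \<in> Ob D \<Longrightarrow> hgt (\<phi> + 1) (Z (Shift D E)) = hgt \<phi> (Z E)"
  using additive_shift[OF Z_additive, of E] hgt_minus_one[of "\<phi> + 1" "Z E"] by simp

lemma sstab_shift: assumes "sstab b c \<phi> E" shows "sstab (b + 1) (c + 1) (\<phi> + 1) (Shift D E)"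
proof -
  have E: "E \<in> GG {b<..c}" "hgt \<phi> (Z E) = 0" using assms unfolding sstab_def by auto
  note EO = GG_ob[OF E(1)]
  show ?thesis unfolding sstab_def
  proof (intro conjI allI impI)
    show "Shift D E \<in> GG {b + 1<..c + 1}" by (rule GG_shift[OF E(1)]) auto
    show "hgt (\<phi> + 1) (Z (Shift D E)) = 0" using hgt_shift[OF EO] E(2) by simp
    fix X Y assume X: "exact_triangle D X (Shift D E) Y \<and> X \<in> GG {b + 1<..c + 1} \<and> Y \<in> GG {b + 1<..c + 1}"
    have ob: "X \<in> Ob D" "Y \<in> Ob D" using exact_obs X by blast+
    have "Unshift D X \<in> GG {b<..c}" "Unshift D Y \<in> GG {b<..c}"
      using GG_unshift[of X "{b + 1<..c + 1}" "{b<..c}"] GG_unshift[of Y "{b + 1<..c + 1}" "{b<..c}"] X by auto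
    moreover have "exact_triangle D (Unshift D X) E (Unshift D Y)"
      using exact_Unshift[of X "Shift D E" Y] X EO by simp
    ultimately have "hgt \<phi> (Z (Unshift D X)) \<le> 0" using assms unfolding sstab_def by blast
    then show "hgt (\<phi> + 1) (Z X) \<le> 0" using hgt_shift[of "Unshift D X" \<phi>] ob by (simp add: Unshift_ob)
  qed
qed

lemma sstab_unshift: assumes "sstab (b + 1) (c + 1) (\<phi> + 1) E" shows "sstab b c \<phi> (Unshift D E)"
proof -
  have E: "E \<in> GG {b + 1<..c + 1}" "hgt (\<phi> + 1) (Z E) = 0" using assms unfolding sstab_def by auto
  note EO = GG_ob[OF E(1)]
  show ?thesis unfolding sstab_def
  proof (intro conjI allI impI)
    show "Unshift D E \<in> GG {b<..c}" by (rule GG_unshift[OF E(1)]) auto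
    show "hgt \<phi> (Z (Unshift D E)) = 0" using hgt_shift[of "Unshift D E" \<phi>] E(2) EO by (simp add: Unshift_ob)
    fix X Y assume X: "exact_triangle D X (Unshift D E) Y \<and> X \<in> GG {b<..c} \<and> Y \<in> GG {b<..c}"
    have ob: "X \<in> Ob D" using exact_obs X by blast
    have "Shift D X \<in> GG {b + 1<..c + 1}" "Shift D Y \<in> GG {b + 1<..c + 1}"
      using GG_shift[of X "{b<..c}" "{b + 1<..c + 1}"] GG_shift[of Y "{b<..c}" "{b + 1<..c + 1}"] X by auto
    moreover have "exact_triangle D (Shift D X) E (Shift D Y)"
      using exact_shift[of X "Unshift D E" Y] X EO by simp
    ultimately have "hgt (\<phi> + 1) (Z (Shift D X)) \<le> 0" using assms unfolding sstab_def by blast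
    then show "hgt \<phi> (Z X) \<le> 0" using hgt_shift[OF ob] by simp
  qed
qed

lemma GG_bounded: assumes "E \<in> Ob D" shows "\<exists>n::nat. E \<in> GG {- real n<..real n}"
proof -
  have 1: "\<exists>n::nat. \<forall>m\<ge>n. A \<in> R1 {- real m<..real m}" if A: "A \<in> D1" for A
  proof (cases "zero_object C1 A")
    case True
    have "\<forall>m\<ge>1. A \<in> R1 {- real m<..real m}" using A1.PR_zero[OF True, of 0] by auto
    then show ?thesis by blast
  next
    case False
    then obtain t b where h: "hn C1 P1 A t b" using A1.hn_exists[of A] A by (metis full_subcategory_sel(1))
    obtain n :: nat where n: "\<bar>t\<bar> + \<bar>b\<bar> < real n" using reals_Archimedean2 by blast
    have "A \<in> R1 {- real m<..real m}" if "m \<ge> n" for m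
      by (rule A1.hn_in[OF h]) (use n that in auto)
    then show ?thesis by blast
  qed
  have 2: "\<exists>n::nat. \<forall>m\<ge>n. A \<in> R2 {- real m<..real m}" if A: "A \<in> D2" for A
  proof (cases "zero_object C2 A")
    case True
    have "\<forall>m\<ge>1. A \<in> R2 {- real m<..real m}" using A2.PR_zero[OF True, of 0] by auto
    then show ?thesis by blast
  next
    case False
    then obtain t b where h: "hn C2 P2 A t b" using A2.hn_exists[of A] A by (metis full_subcategory_sel(1))
    obtain n :: nat where n: "\<bar>t\<bar> + \<bar>b\<bar> < real n" using reals_Archimedean2 by blast
    have "A \<in> R2 {- real m<..real m}" if "m \<ge> n" for m
      by (rule A2.hn_in[OF h]) (use n that in auto)
    then show ?thesis by blast
  qed
  obtain n1 n2 :: nat where "\<forall>m\<ge>n1. lam E \<in> R1 {- real m<..real m}" "\<forall>m\<ge>n2. rho E \<in> R2 {- real m<..real m}"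
    using 1[OF decomp(2)[OF assms]] 2[OF decomp(3)[OF assms]] by blast
  then have "E \<in> GG {- real (max n1 n2)<..real (max n1 n2)}" unfolding GG_def using assms by auto
  then show ?thesis by blast
qed

end

text \<open>
  The real line is cut at the points \<open>n\<close> and \<open>n + a\<close> for integers \<open>n\<close>. The phase \<open>\<phi>\<close> lies in the piece \<open>(lo \<phi>, hi \<phi>]\<close>.
\<close>

locale glue_cut = glue_data +
  fixes a :: real
  assumes a: "good a" "0 < a" "a < 1"
begin

definition base :: "real \<Rightarrow> real" where "base \<phi> = of_int (\<lceil>\<phi>\<rceil> - 1)"
definition "lo \<phi> = (if \<phi> \<le> base \<phi> + a then base \<phi> else base \<phi> + a)"
definition "hi \<phi> = (if \<phi> \<le> base \<phi> + a then base \<phi> + a else base \<phi> + 1)"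
definition "cutpoint t \<longleftrightarrow> (\<exists>n::int. t = of_int n \<or> t = of_int n + a)"

lemma base: "base \<phi> < \<phi>" "\<phi> \<le> base \<phi> + 1"
  unfolding base_def by linarith+

lemma base_eq: "of_int n < \<phi> \<Longrightarrow> \<phi> \<le> of_int n + 1 \<Longrightarrow> base \<phi> = of_int n"
  unfolding base_def by (simp add: ceiling_unique[of "n + 1"])

lemma lo_hi: "lo \<phi> < \<phi>" "\<phi> \<le> hi \<phi>" "hi \<phi> < lo \<phi> + 1" "lo \<phi> < hi \<phi>"
  using base[of \<phi>] a by (auto simp: lo_def hi_def)

lemma cut_lo_hi: "cutpoint (lo \<phi>)" "cutpoint (hi \<phi>)"
proof -
  have 1: "cutpoint (base \<phi>)" "cutpoint (base \<phi> + a)" unfolding cutpoint_def base_def by blast+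
  have "base \<phi> + 1 = of_int \<lceil>\<phi>\<rceil>" by (simp add: base_def)
  then have "cutpoint (base \<phi> + 1)" unfolding cutpoint_def by blast
  then show "cutpoint (lo \<phi>)" "cutpoint (hi \<phi>)" using 1 by (auto simp: lo_def hi_def)
qed

lemma cut_good: assumes "cutpoint t" shows "good t"
proof -
  obtain n :: int where n: "t = of_int n \<or> t = of_int n + a" using assms cutpoint_def by blast
  obtain m :: int where m: "\<bar>a - of_int m\<bar> < \<epsilon>" using a good_def by blast
  show ?thesis unfolding good_def
  proof (cases "t = of_int n")
    case True then show "\<exists>n::int. \<bar>t - of_int n\<bar> < \<epsilon>" using eps by (intro exI[of _ n]) simp
  next
    case False
    then have "\<bar>t - of_int (n + m)\<bar> < \<epsilon>" using n m by simp
    then show "\<exists>n::int. \<bar>t - of_int n\<bar> < \<epsilon>" by blast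
  qed
qed

lemma cut_separates: assumes "cutpoint t" shows "t < \<phi> \<Longrightarrow> t \<le> lo \<phi>" "\<phi> \<le> t \<Longrightarrow> hi \<phi> \<le> t"
proof -
  obtain n :: int where n: "t = of_int n \<or> t = of_int n + a" using assms cutpoint_def by blast
  show "t \<le> lo \<phi>" if lt: "t < \<phi>"
  proof -
    have "of_int n < \<phi>" using n lt a by auto
    then have "n < \<lceil>\<phi>\<rceil>" by (simp add: less_ceiling_iff)
    then have "n \<le> \<lceil>\<phi>\<rceil> - 1" by simp
    then have le: "(of_int n :: real) \<le> base \<phi>" unfolding base_def by (simp only: of_int_le_iff)
    show ?thesis
    proof (cases "base \<phi> = of_int n")
      case True then show ?thesis using n lt a by (auto simp: lo_def)
    next
      case False
      then have "n \<le> \<lceil>\<phi>\<rceil> - 1 - 1" using le unfolding base_def by linarith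
      then have "(of_int n :: real) \<le> of_int (\<lceil>\<phi>\<rceil> - 1 - 1)" by linarith
      then have "of_int n + 1 \<le> base \<phi>" by (simp add: base_def)
      then show ?thesis using n a by (auto simp: lo_def)
    qed
  qed
  show "hi \<phi> \<le> t" if le: "\<phi> \<le> t"
  proof (cases "t = of_int n")
    case True
    then have "\<lceil>\<phi>\<rceil> \<le> n" using le by linarith
    then have "base \<phi> + 1 \<le> of_int n" by (simp add: base_def)
    then show ?thesis using True a by (auto simp: hi_def)
  next
    case False
    then have t: "t = of_int n + a" using n by blast
    then have "\<phi> \<le> of_int n + 1" using le a by simp
    then have "\<lceil>\<phi>\<rceil> \<le> n + 1" by linarith
    then have bn: "base \<phi> \<le> of_int n" by (simp add: base_def)
    show ?thesis
    proof (cases "base \<phi> = of_int n")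
      case True then show ?thesis using t le by (auto simp: hi_def)
    next
      case False
      then have "\<lceil>\<phi>\<rceil> - 1 \<le> n - 1" using bn unfolding base_def by linarith
      then have "base \<phi> \<le> of_int (n - 1)" unfolding base_def by linarith
      then show ?thesis using t a by (auto simp: hi_def)
    qed
  qed
qed

lemma same_piece: assumes "lo \<phi> < \<psi>" "\<psi> \<le> hi \<phi>" shows "lo \<psi> = lo \<phi>" "hi \<psi> = hi \<phi>"
proof -
  have "lo \<phi> \<le> lo \<psi>" "hi \<psi> \<le> hi \<phi>" using cut_separates[OF cut_lo_hi(1)] cut_separates[OF cut_lo_hi(2)] assms by auto
  moreover have "lo \<psi> \<le> lo \<phi>"
  proof (rule ccontr)
    assume "\<not> lo \<psi> \<le> lo \<phi>"
    then have "lo \<phi> < lo \<psi>" by simp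
    moreover have "lo \<psi> < hi \<phi>" using lo_hi(1)[of \<psi>] assms by simp
    ultimately show False
      using cut_separates(1)[OF cut_lo_hi(1)[of \<psi>], of \<phi>] cut_separates(2)[OF cut_lo_hi(1)[of \<psi>], of \<phi>] by linarith
  qed
  moreover have "hi \<phi> \<le> hi \<psi>"
  proof (rule ccontr)
    assume "\<not> hi \<phi> \<le> hi \<psi>"
    then have "hi \<psi> < hi \<phi>" by simp
    moreover have "lo \<phi> < hi \<psi>" using lo_hi(2)[of \<psi>] assms by simp
    ultimately show False
      using cut_separates(1)[OF cut_lo_hi(2)[of \<psi>], of \<phi>] cut_separates(2)[OF cut_lo_hi(2)[of \<psi>], of \<phi>] by linarith
  qed
  ultimately show "lo \<psi> = lo \<phi>" "hi \<psi> = hi \<phi>" by auto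
qed

lemma lo_hi_shift: "lo (\<phi> + 1) = lo \<phi> + 1" "hi (\<phi> + 1) = hi \<phi> + 1"
proof -
  have "base (\<phi> + 1) = base \<phi> + 1" by (simp add: base_def)
  then show "lo (\<phi> + 1) = lo \<phi> + 1" "hi (\<phi> + 1) = hi \<phi> + 1" by (auto simp: lo_def hi_def)
qed

definition "P \<phi> = {E. sstab (lo \<phi>) (hi \<phi>) \<phi> E}"

lemma P_GG: "E \<in> P \<phi> \<Longrightarrow> E \<in> GG {lo \<phi><..hi \<phi>}" unfolding P_def sstab_def by blast

lemma P_ob: "E \<in> P \<phi> \<Longrightarrow> E \<in> Ob D" using P_GG GG_ob by blast

lemma piece_at: "piece D (GG {lo \<phi><..}) (GG {..lo \<phi>}) (GG {hi \<phi><..}) (GG {..hi \<phi>}) Z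
    (c0 * cos (pi * ((hi \<phi> - lo \<phi>) / 2))) ((lo \<phi> + hi \<phi>) / 2) (lo \<phi>) (hi \<phi>)"
  using GG_piece cut_good cut_lo_hi lo_hi by blast

lemma P_sst: assumes "lo \<phi> < \<psi>" "\<psi> \<le> hi \<phi>"
  shows "E \<in> P \<psi> \<longleftrightarrow> piece.sst D (GG {lo \<phi><..}) (GG {..hi \<phi>}) Z \<psi> E"
  unfolding P_def using same_piece[OF assms] sstab_piece(1)[of "lo \<phi>" "hi \<phi>" \<psi> E] cut_good cut_lo_hi lo_hi by simp

definition "HNable b c \<longleftrightarrow> (\<forall>E \<in> GG {b<..c}. \<not> zero_object D E \<longrightarrow> (\<exists>t u. hn D P E t u \<and> b < u \<and> t \<le> c))"

lemma HNable_piece: "HNable (lo \<phi>) (hi \<phi>)"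
  unfolding HNable_def
proof (intro ballI impI)
  fix E assume E: "E \<in> GG {lo \<phi><..hi \<phi>}" "\<not> zero_object D E"
  interpret p: piece D "GG {lo \<phi><..}" "GG {..lo \<phi>}" "GG {hi \<phi><..}" "GG {..hi \<phi>}" Z
    "c0 * cos (pi * ((hi \<phi> - lo \<phi>) / 2))" "(lo \<phi> + hi \<phi>) / 2" "lo \<phi>" "hi \<phi>" by (rule piece_at)
  have "E \<in> p.Q" using E(1) sstab_piece(2)[of "lo \<phi>" "hi \<phi>"] cut_good cut_lo_hi lo_hi by simp
  then show "\<exists>t u. hn D P E t u \<and> lo \<phi> < u \<and> t \<le> hi \<phi>" using p.hn_in_piece[OF P_sst _ E(2)] by blast
qed

text \<open>
  Truncate at \<open>c\<close> and concatenate: all phases of the subobject are greater than \<open>c\<close>, those of the quotient are at most \<open>c\<close>.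
\<close>

lemma HNable_join:
  assumes g: "good b" "good c" "good d" and bcd: "b < c" "c < d" and H: "HNable b c" "HNable c d"
  shows "HNable b d"
  unfolding HNable_def
proof (intro ballI impI)
  fix E assume E: "E \<in> GG {b<..d}" "\<not> zero_object D E"
  obtain T F where T: "T \<in> GG {c<..}" "F \<in> GG {..c}" "exact_triangle D T E F"
    using ts_trunc[OF GG_ts[OF g(2)] GG_ob[OF E(1)]] .
  have bd: "b < d" using bcd by simp
  have Eb: "E \<in> GG {b<..}" "E \<in> GG {..d}" using E(1) GG_Int[OF bd] by auto
  have "F \<in> GG {..d}" by (rule GG_mono[OF _ T(2)]) (use bcd in auto)
  then have T': "T \<in> GG {c<..d}" using ts_L_fibre[OF GG_ts[OF g(3)] T(3) Eb(2)] T(1) GG_Int[OF bcd(2)] by blast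
  have "T \<in> GG {b<..}" by (rule GG_mono[OF _ T(1)]) (use bcd in auto)
  then have F': "F \<in> GG {b<..c}" using ts_G_cone[OF GG_ts[OF g(1)] T(3) _ Eb(1)] T(2) GG_Int[OF bcd(1)] by blast
  have P_iso: "Y \<in> P \<phi>" if "isomorphic D X Y" "X \<in> P \<phi>" for X Y \<phi>
  proof -
    interpret p: piece D "GG {lo \<phi><..}" "GG {..lo \<phi>}" "GG {hi \<phi><..}" "GG {..hi \<phi>}" Z
      "c0 * cos (pi * ((hi \<phi> - lo \<phi>) / 2))" "(lo \<phi> + hi \<phi>) / 2" "lo \<phi>" "hi \<phi>" by (rule piece_at)
    show ?thesis using p.sst_iso[OF that(1)] that(2) P_sst[OF lo_hi(1,2)] by blast
  qed
  have hn_iso: "hn D P Y t u" if "hn D P X t u" "isomorphic D X Y" for X Y t u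
    using that(1)
  proof cases
    case single
    then show ?thesis using P_iso[OF that(2)] zero_iso[OF isomorphic_sym[OF that(2)]] hn.single[where P=P] by metis
  next
    case (step F b A)
    have ob: "F \<in> Ob D" "A \<in> Ob D" using exact_obs[OF step(2)] by auto
    have "exact_triangle D F Y A" using exact_iso[OF step(2) isomorphic_refl that(2) isomorphic_refl] ob by blast
    then show ?thesis using hn.step[where P=P, OF step(1) _ step(3-5)] by blast
  qed
  show "\<exists>t u. hn D P E t u \<and> b < u \<and> t \<le> d"
  proof (cases "zero_object D T")
    case True
    have i: "isomorphic D F E" using exact_fibre_zero[OF T(3) True] isomorphic_sym by blast
    then have "\<not> zero_object D F" using zero_iso E(2) by blast
    then obtain t u where "hn D P F t u" "b < u" "t \<le> c" using H(1) F' unfolding HNable_def by blast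
    then show ?thesis using hn_iso[OF _ i] bcd(2) by (meson less_imp_le order_trans)
  next
    case nzT: False
    then obtain t u where h: "hn D P T t u" "c < u" "t \<le> d" using H(2) T' unfolding HNable_def by blast
    show ?thesis
    proof (cases "zero_object D F")
      case True
      have i: "isomorphic D T E" using exact_cone_zero[OF T(3) True] .
      then show ?thesis using hn_iso[OF h(1) i] h bcd(1) by (meson less_trans)
    next
      case False
      then obtain t' u' where "hn D P F t' u'" "b < u'" "t' \<le> c" using H(1) F' unfolding HNable_def by blast
      then have "hn D P E t u'" using hn_append[OF h(1) _ T(3)] h(2) by auto
      then show ?thesis using \<open>b < u'\<close> h(3) by blast
    qed
  qed
qed

lemma cut_int: "cutpoint (of_int n)" "cutpoint (real m)" "cutpoint (- real m)"
  unfolding cutpoint_def by (blast, metis of_int_of_nat_eq, metis of_int_minus of_int_of_nat_eq)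

lemma HNable_unit: "HNable (of_int n) (of_int n + 1)"
proof -
  have b1: "base (of_int n + a) = of_int n" by (rule base_eq) (use a in auto)
  have b2: "base (of_int n + 1) = of_int n" by (rule base_eq) auto
  have 1: "HNable (of_int n) (of_int n + a)" using HNable_piece[of "of_int n + a"] b1 by (simp add: lo_def hi_def)
  have 2: "HNable (of_int n + a) (of_int n + 1)" using HNable_piece[of "of_int n + 1"] b2 a by (simp add: lo_def hi_def)
  have "good (of_int n + a)" by (rule cut_good) (auto simp: cutpoint_def)
  then show ?thesis
    using HNable_join[OF cut_good[OF cut_int(1)] _ _ _ _ 1 2] cut_good[OF cut_int(1)[of "n + 1"]] a by simp
qed

lemma HNable_ints: "HNable (of_int n) (of_int n + real (Suc k))"
proof (induction k)
  case 0 then show ?case using HNable_unit[of n] by simp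
next
  case (Suc k)
  have g: "good (of_int n + real m)" for m using cut_good[OF cut_int(1)[of "n + int m"]] by simp
  have u: "HNable (of_int n + real (Suc k)) (of_int n + real (Suc (Suc k)))"
    using HNable_unit[of "n + int (Suc k)"] by (simp add: algebra_simps)
  show ?case
    by (rule HNable_join[OF cut_good[OF cut_int(1)] g g _ _ Suc u]) auto
qed

lemma hn_exists: assumes "E \<in> Ob D" "\<not> zero_object D E" shows "\<exists>t u. hn D P E t u"
proof -
  obtain n :: nat where "E \<in> GG {- real n<..real n}" using GG_bounded[OF assms(1)] by blast
  then have "E \<in> GG {of_int (- int n - 1)<..of_int (- int n - 1) + real (Suc (2 * n))}"
    by (rule GG_mono[rotated]) auto
  then show ?thesis using HNable_ints[of "- int n - 1" "2 * n"] assms unfolding HNable_def by blast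
qed

lemma slicing: "slicing D P"
  unfolding slicing_def
proof (intro conjI allI impI ballI)
  fix \<phi>
  interpret p: piece D "GG {lo \<phi><..}" "GG {..lo \<phi>}" "GG {hi \<phi><..}" "GG {..hi \<phi>}" Z
    "c0 * cos (pi * ((hi \<phi> - lo \<phi>) / 2))" "(lo \<phi> + hi \<phi>) / 2" "lo \<phi>" "hi \<phi>" by (rule piece_at)
  note P_sst = P_sst[OF lo_hi(1,2)]
  show "full_additive_subcategory D (P \<phi>)"
    unfolding full_additive_subcategory_def
  proof (intro conjI allI impI ballI)
    show "P \<phi> \<subseteq> Ob D" using P_ob by blast
    show "iso_closed D (P \<phi>)" unfolding iso_closed_def using P_sst p.sst_iso by blast
    show "X \<in> P \<phi>" if "zero_object D X" for X using P_sst p.sst_zero[OF that lo_hi(1,2)] by blast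
    show "C \<in> P \<phi>" if "A \<in> P \<phi>" "B \<in> P \<phi>" "biproduct D A B C" for A B C
      using p.sst_ext[OF biproduct_exact[OF that(3)] _ _ lo_hi(1,2)] that P_sst by blast
  qed
  show "Shift D ` P \<phi> = P (\<phi> + 1)"
  proof
    show "Shift D ` P \<phi> \<subseteq> P (\<phi> + 1)" using sstab_shift by (auto simp: P_def lo_hi_shift)
    show "P (\<phi> + 1) \<subseteq> Shift D ` P \<phi>"
    proof
      fix E assume E: "E \<in> P (\<phi> + 1)"
      then have "Unshift D E \<in> P \<phi>" using sstab_unshift by (auto simp: P_def lo_hi_shift)
      moreover have "E = Shift D (Unshift D E)" using P_ob[OF E] by simp
      ultimately show "E \<in> Shift D ` P \<phi>" by blast
    qed
  qed
next
  fix \<phi>1 \<phi>2 A B assume lt: "\<phi>2 < \<phi>1" and A: "A \<in> P \<phi>1" and B: "B \<in> P \<phi>2"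
  interpret p: piece D "GG {lo \<phi>2<..}" "GG {..lo \<phi>2}" "GG {hi \<phi>2<..}" "GG {..hi \<phi>2}" Z
    "c0 * cos (pi * ((hi \<phi>2 - lo \<phi>2) / 2))" "(lo \<phi>2 + hi \<phi>2) / 2" "lo \<phi>2" "hi \<phi>2" by (rule piece_at)
  have "orth D A B"
  proof (cases "\<phi>1 \<le> hi \<phi>2")
    case True
    have l: "lo \<phi>2 < \<phi>1" using lo_hi(1)[of \<phi>2] lt by simp
    show ?thesis using p.sst_orth[of \<phi>1 A \<phi>2 B] P_sst[OF l True] P_sst[OF lo_hi(1,2)] A B lt True lo_hi(1) by blast
  next
    case False
    then have "hi \<phi>2 \<le> lo \<phi>1" using cut_separates(1)[OF cut_lo_hi(2)] by simp
    then have "A \<in> GG {hi \<phi>2<..}" by (intro GG_mono[OF _ P_GG[OF A]]) auto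
    moreover have "B \<in> GG {..hi \<phi>2}" by (rule GG_mono[OF _ P_GG[OF B]]) auto
    ultimately show ?thesis using GG_orth[OF cut_good[OF cut_lo_hi(2)]] by blast
  qed
  then show "Hom D A B = {Zer D A B}" by (simp add: orth_def)
next
  fix E assume E: "E \<in> Ob D" "\<not> zero_object D E"
  obtain Z0 where z: "zero_object D Z0" by (rule obtain_zero)
  show "has_HN_filtration D P E"
  proof -
    obtain t u where h: "hn D P E t u" using hn_exists[OF E] by blast
    show ?thesis by (rule filtration_of_hn[OF additive_category_axioms exact_zero_left[OF _ z] z P_ob h])
  qed
qed

lemma P_phase: assumes "E \<in> P \<phi>" "\<not> zero_object D E" shows "\<exists>m>0. Z E = of_real m * cis (pi * \<phi>)"
proof -
  interpret p: piece D "GG {lo \<phi><..}" "GG {..lo \<phi>}" "GG {hi \<phi><..}" "GG {..hi \<phi>}" Z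
    "c0 * cos (pi * ((hi \<phi> - lo \<phi>) / 2))" "(lo \<phi> + hi \<phi>) / 2" "lo \<phi>" "hi \<phi>" by (rule piece_at)
  have E: "E \<in> GG {lo \<phi><..}" "E \<in> GG {..hi \<phi>}" using P_GG[OF assms(1)] GG_Int[OF lo_hi(4)] by auto
  obtain r \<psi> where r: "0 < r" "lo \<phi> < \<psi>" "\<psi> \<le> hi \<phi>" "Z E = of_real r * cis (pi * \<psi>)"
    using sector_phase[OF lo_hi(4,3)] p.sector[OF E assms(2)] by metis
  have "hgt \<phi> (Z E) = 0" using assms(1) by (simp add: P_def sstab_def)
  then have "\<psi> = \<phi>" using hgt_sign(3)[OF r(1), of \<psi> \<phi>] r lo_hi[of \<phi>] by auto
  then show ?thesis using r by blast
qed

lemma stability: "stability D P Z"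
  by unfold_locales (use slicing Z_additive P_phase in auto)

text \<open>
  Both sides belong to t-structures, so it suffices that the slicing is contained in the glued classes.
\<close>

lemma PR_eq_GG: assumes "cutpoint t" shows "phase_range D P {t<..} = GG {t<..}" "phase_range D P {..t} = GG {..t}"
proof -
  interpret P: slicing_on D P by unfold_locales (rule slicing)
  note ts = GG_ts[OF cut_good[OF assms]]
  have "P.PR {t<..} \<subseteq> GG {t<..}"
  proof
    fix E assume "E \<in> P.PR {t<..}"
    then show "E \<in> GG {t<..}"
    proof (rule phase_range_least)
      show "P \<phi> \<subseteq> GG {t<..}" if "\<phi> \<in> {t<..}" for \<phi>
      proof
        fix A assume A: "A \<in> P \<phi>"
        show "A \<in> GG {t<..}" by (rule GG_mono[OF _ P_GG[OF A]]) (use cut_separates(1)[OF assms] that in fastforce)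
      qed
    qed (rule ts_G_ext[OF ts])
  qed
  moreover have "P.PR {..t} \<subseteq> GG {..t}"
  proof
    fix E assume "E \<in> P.PR {..t}"
    then show "E \<in> GG {..t}"
    proof (rule phase_range_least)
      show "P \<phi> \<subseteq> GG {..t}" if "\<phi> \<in> {..t}" for \<phi>
      proof
        fix A assume A: "A \<in> P \<phi>"
        show "A \<in> GG {..t}" by (rule GG_mono[OF _ P_GG[OF A]]) (use cut_separates(2)[OF assms] that in fastforce)
      qed
    qed (rule ts_L_ext[OF ts])
  qed
  ultimately show "P.PR {t<..} = GG {t<..}" "P.PR {..t} = GG {..t}"
    using t_structure_eq[OF P.ts_gt ts] by auto
qed

lemma P_mass: assumes "E \<in> P \<phi>" "\<not> zero_object D E"
  shows "c0 * min (cos (pi * (a / 2))) (cos (pi * ((1 - a) / 2))) \<le> cmod (Z E)"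
proof -
  interpret p: piece D "GG {lo \<phi><..}" "GG {..lo \<phi>}" "GG {hi \<phi><..}" "GG {..hi \<phi>}" Z
    "c0 * cos (pi * ((hi \<phi> - lo \<phi>) / 2))" "(lo \<phi> + hi \<phi>) / 2" "lo \<phi>" "hi \<phi>" by (rule piece_at)
  have E: "E \<in> GG {lo \<phi><..}" "E \<in> GG {..hi \<phi>}" using P_GG[OF assms(1)] GG_Int[OF lo_hi(4)] by auto
  have "min (cos (pi * (a / 2))) (cos (pi * ((1 - a) / 2))) \<le> cos (pi * ((hi \<phi> - lo \<phi>) / 2))"
    by (auto simp: lo_def hi_def)
  then have "c0 * min (cos (pi * (a / 2))) (cos (pi * ((1 - a) / 2))) \<le> c0 * cos (pi * ((hi \<phi> - lo \<phi>) / 2))"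
    using c0 by (intro mult_left_mono) auto
  also have "\<dots> \<le> wid ((lo \<phi> + hi \<phi>) / 2) (Z E)" using p.mass[OF E assms(2)] .
  also have "\<dots> \<le> cmod (Z E)" by (rule wid_le)
  finally show ?thesis .
qed

lemma glued_exists:
  obtains \<sigma> where "stability_condition D \<sigma>" "reasonable D \<sigma>" "slices \<sigma> = P"
    "\<And>E. E \<in> Ob D \<Longrightarrow> charge D \<sigma> E = Z E" "heart D \<sigma> = GG {0<..1}"
proof -
  interpret P: stability D P Z by (rule stability)
  obtain W where W: "W \<in> hom (K0 D) complex_add_group \<inter> extensional (carrier (K0 D))"
    "\<And>E. E \<in> Ob D \<Longrightarrow> W (K0_class D E) = Z E"
    using K0_hom_of_additive[OF Z_additive] by blast
  let ?\<sigma> = "(W, P)"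
  have ch: "charge D ?\<sigma> E = Z E" if "E \<in> Ob D" for E using W(2)[OF that] by (simp add: charge_def)
  have st: "stability_condition D ?\<sigma>"
    unfolding stability_condition_def exp_phase using W(1) slicing P_phase ch P_ob by auto
  have "reasonable D ?\<sigma>"
  proof (rule reasonableI)
    show "0 < c0 * min (cos (pi * (a / 2))) (cos (pi * ((1 - a) / 2)))"
      using c0 a cos_pi_pos[of "a / 2"] cos_pi_pos[of "(1 - a) / 2"] by simp
    show "c0 * min (cos (pi * (a / 2))) (cos (pi * ((1 - a) / 2))) \<le> cmod (charge D ?\<sigma> E)"
      if "E \<in> nonzero_semistable D ?\<sigma>" for E
      using that P_mass ch P_ob by (auto simp: nonzero_semistable_def)
  qed
  moreover have "heart D ?\<sigma> = GG {0<..1}"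
    using P.PR_gt_le[of 0 1] PR_eq_GG(1)[of 0] PR_eq_GG(2)[of 1] cut_int(1)[of 0] cut_int(1)[of 1] GG_Int[of 0 1]
    by (simp add: heart_def)
  ultimately show ?thesis using that st ch by (metis snd_conv)
qed

end

section \<open>Neighbourhoods in the space of stability conditions\<close>

definition close_slicing :: "('o, 'm) tcat \<Rightarrow> real \<Rightarrow> (real \<Rightarrow> 'o set) \<Rightarrow> (real \<Rightarrow> 'o set) \<Rightarrow> bool" where
  "close_slicing D d P Q \<longleftrightarrow> (\<forall>\<phi>. Q \<phi> \<subseteq> phase_range D P {\<phi> - d..\<phi> + d})"

definition close_charge :: "('o, 'm) tcat \<Rightarrow> real \<Rightarrow> 'o stab \<Rightarrow> 'o stab \<Rightarrow> bool" where
  "close_charge D k \<sigma> \<tau> \<longleftrightarrow> (\<forall>E \<in> nonzero_semistable D \<sigma>.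
     cmod (charge D \<tau> E - charge D \<sigma> E) \<le> k * cmod (charge D \<sigma> E))"

text \<open>
  Neighbourhoods of \<open>\<sigma>\<close> that are convenient to work with. The strict inequalities for \<open>k'\<close> and \<open>d\<close> leave room for a ball around each
  member, which is why these sets are open (\<open>openin_nbhd\<close>).
\<close>

definition nbhd :: "('o, 'm) tcat \<Rightarrow> real \<Rightarrow> real \<Rightarrow> 'o stab \<Rightarrow> 'o stab set" where
  "nbhd D k \<delta> \<sigma> = {\<tau> \<in> Stab D. (\<exists>k'. 0 \<le> k' \<and> k' < k \<and> close_charge D k' \<sigma> \<tau>) \<and>
     (\<exists>d. 0 \<le> d \<and> d < \<delta> \<and> close_slicing D d (slices \<sigma>) (slices \<tau>))}"

lemma close_slicing_range:
  assumes "close_slicing D d P Q" "\<And>\<phi> \<psi>. \<phi> \<in> I \<Longrightarrow> \<phi> - d \<le> \<psi> \<Longrightarrow> \<psi> \<le> \<phi> + d \<Longrightarrow> \<psi> \<in> J"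
  shows "phase_range D Q I \<subseteq> phase_range D P J"
proof (rule phase_range_subset_trans)
  fix \<phi> assume "\<phi> \<in> I"
  then have "{\<phi> - d..\<phi> + d} \<subseteq> J" using assms(2) by auto
  then show "Q \<phi> \<subseteq> phase_range D P J"
    using assms(1) phase_range_mono[of "{\<phi> - d..\<phi> + d}" J D P] unfolding close_slicing_def by blast
qed

lemma close_slicing_trans:
  assumes "close_slicing D d P Q" "close_slicing D e Q R" shows "close_slicing D (d + e) P R"
  unfolding close_slicing_def
proof
  fix \<phi>
  have "R \<phi> \<subseteq> phase_range D Q {\<phi> - e..\<phi> + e}" using assms(2) unfolding close_slicing_def by blast
  also have "\<dots> \<subseteq> phase_range D P {\<phi> - (d + e)..\<phi> + (d + e)}" by (rule close_slicing_range[OF assms(1)]) auto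
  finally show "R \<phi> \<subseteq> phase_range D P {\<phi> - (d + e)..\<phi> + (d + e)}" .
qed

lemma close_slicing_of_dist: assumes "slicing_dist D P Q < ennreal e"
  obtains d where "0 \<le> d" "d < e" "close_slicing D d P Q"
  using assms unfolding slicing_dist_def INF_less_iff close_slicing_def by (auto simp: ennreal_less_iff)

lemma dist_of_close_slicing: "0 \<le> d \<Longrightarrow> close_slicing D d P Q \<Longrightarrow> slicing_dist D P Q \<le> ennreal d"
  unfolding slicing_dist_def close_slicing_def by (intro INF_lower) auto

context triangulated_category
begin

text \<open>
  The condition says that \<open>Q(>t)\<close> is contained in \<open>P(>t-d)\<close> for all \<open>t\<close>, and likewise for \<open>Q(<t)\<close>. Passing to
  orthogonals exchanges \<open>P\<close> and \<open>Q\<close>.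
\<close>

lemma close_slicing_sym:
  assumes P: "slicing D P" and Q: "slicing D Q" and c: "close_slicing D d P Q" and d: "0 \<le> d"
  shows "close_slicing D d Q P"
  unfolding close_slicing_def
proof (intro allI subsetI)
  interpret P: slicing_on D P by unfold_locales (rule P)
  interpret Q: slicing_on D Q by unfold_locales (rule Q)
  fix \<phi> E assume E: "E \<in> P \<phi>"
  have EO: "E \<in> Ob D" using P.P_ob[OF E] .
  have "orth D X E" if "X \<in> Q.PR {\<phi> + d<..}" for X
  proof (rule ts_orth[OF P.ts_gt[of \<phi>]])
    show "X \<in> P.PR {\<phi><..}" using close_slicing_range[OF c, of "{\<phi> + d<..}" "{\<phi><..}"] that by auto
    show "E \<in> P.PR {..\<phi>}" using P.PR_base[OF _ E] by simp
  qed
  then have 1: "E \<in> Q.PR {..\<phi> + d}" using ts_L_iff[OF Q.ts_gt] EO by blast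
  have "orth D E X" if "X \<in> Q.PR {..<\<phi> - d}" for X
  proof (rule ts_orth[OF P.ts_ge[of \<phi>]])
    show "X \<in> P.PR {..<\<phi>}" using close_slicing_range[OF c, of "{..<\<phi> - d}" "{..<\<phi>}"] that by auto
    show "E \<in> P.PR {\<phi>..}" using P.PR_base[OF _ E] by simp
  qed
  then have 2: "E \<in> Q.PR {\<phi> - d..}" using ts_G_iff[OF Q.ts_ge] EO by blast
  show "E \<in> Q.PR {\<phi> - d..\<phi> + d}" using 1 2 Q.PR_ge_le[of "\<phi> - d" "\<phi> + d"] d by auto
qed

lemma close_charge_of_dist:
  assumes "stability_condition D \<sigma>" "charge_dist D \<sigma> \<tau> < ennreal k" "0 \<le> k" shows "close_charge D k \<sigma> \<tau>"
  unfolding close_charge_def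
proof
  interpret P: stability D "slices \<sigma>" "charge D \<sigma>" by (rule stability_of_condition[OF assms(1)])
  fix E assume E: "E \<in> nonzero_semistable D \<sigma>"
  then obtain m \<phi> where "m > 0" "charge D \<sigma> E = of_real m * cis (pi * \<phi>)"
    using P.phase unfolding nonzero_semistable_def by blast
  then have nz: "cmod (charge D \<sigma> E) > 0" by (simp add: norm_mult)
  have "ennreal (cmod (charge D \<tau> E - charge D \<sigma> E) / cmod (charge D \<sigma> E)) \<le> charge_dist D \<sigma> \<tau>"
    unfolding charge_dist_def by (rule SUP_upper[OF E])
  then have "ennreal (cmod (charge D \<tau> E - charge D \<sigma> E) / cmod (charge D \<sigma> E)) \<le> ennreal k"
    using assms(2) by (meson less_imp_le order_trans)
  then have "cmod (charge D \<tau> E - charge D \<sigma> E) / cmod (charge D \<sigma> E) \<le> k" using assms(3) by (simp add: ennreal_le_iff)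
  then show "cmod (charge D \<tau> E - charge D \<sigma> E) \<le> k * cmod (charge D \<sigma> E)" using nz by (simp add: field_simps)
qed

lemma dist_of_close_charge:
  assumes "stability_condition D \<sigma>" "close_charge D k \<sigma> \<tau>" "0 \<le> k" shows "charge_dist D \<sigma> \<tau> \<le> ennreal k"
  unfolding charge_dist_def
proof (rule SUP_least)
  interpret P: stability D "slices \<sigma>" "charge D \<sigma>" by (rule stability_of_condition[OF assms(1)])
  fix E assume E: "E \<in> nonzero_semistable D \<sigma>"
  then obtain m \<phi> where "m > 0" "charge D \<sigma> E = of_real m * cis (pi * \<phi>)"
    using P.phase unfolding nonzero_semistable_def by blast
  then have nz: "cmod (charge D \<sigma> E) > 0" by (simp add: norm_mult)
  have "cmod (charge D \<tau> E - charge D \<sigma> E) \<le> k * cmod (charge D \<sigma> E)"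
    using assms(2) E unfolding close_charge_def by blast
  then show "ennreal (cmod (charge D \<tau> E - charge D \<sigma> E) / cmod (charge D \<sigma> E)) \<le> ennreal k"
    using nz by (intro ennreal_leI) (simp add: field_simps)
qed

lemma StabD: "\<sigma> \<in> Stab D \<Longrightarrow> stability D (slices \<sigma>) (charge D \<sigma>)" "\<sigma> \<in> Stab D \<Longrightarrow> stability_condition D \<sigma>"
  using stability_of_condition by (auto simp: Stab_def)

lemma additive_diff: "additive_on D Z \<Longrightarrow> additive_on D W \<Longrightarrow> additive_on D (\<lambda>E. W E - Z E)"
  unfolding additive_on_def by (metis add_diff_add)

lemma close_charge_nearby:
  assumes "\<sigma> \<in> Stab D" "\<tau> \<in> Stab D" "close_charge D k \<sigma> \<tau>" "0 \<le> k" "0 \<le> d" "d < 1/2"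
    and E: "E \<in> phase_range D (slices \<sigma>) {\<phi> - d..\<phi> + d}"
  shows "cmod (charge D \<tau> E - charge D \<sigma> E) \<le> k / cos (pi * d) * wid \<phi> (charge D \<sigma> E)"
proof -
  interpret P: stability D "slices \<sigma>" "charge D \<sigma>" by (rule StabD[OF assms(1)])
  interpret Q: stability D "slices \<tau>" "charge D \<tau>" by (rule StabD[OF assms(2)])
  show ?thesis
  proof (rule P.PR_compare[OF E _ assms(6,5,4) additive_diff[OF P.Z_additive Q.Z_additive]])
    show "\<bar>\<psi> - \<phi>\<bar> \<le> d" if "\<psi> \<in> {\<phi> - d..\<phi> + d}" for \<psi> using that by auto
    show "cmod (charge D \<tau> A - charge D \<sigma> A) \<le> k * cmod (charge D \<sigma> A)"
      if "A \<in> slices \<sigma> \<psi>" "\<not> zero_object D A" for \<psi> A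
      using assms(3) that unfolding close_charge_def nonzero_semistable_def by blast
  qed
qed

lemma nbhd_self: assumes "\<sigma> \<in> Stab D" "0 < k" "0 < \<delta>" shows "\<sigma> \<in> nbhd D k \<delta> \<sigma>"
proof -
  have "close_charge D 0 \<sigma> \<sigma>" by (simp add: close_charge_def)
  moreover have "close_slicing D 0 (slices \<sigma>) (slices \<sigma>)"
    unfolding close_slicing_def using phase_range_base[of _ "{_}" _ "slices \<sigma>" D] by fastforce
  ultimately show ?thesis using assms unfolding nbhd_def by blast
qed

text \<open>
  The distance of slicings satisfies the triangle inequality. Relative distances of charges are measured on different
  semistable objects; for a nearby slicing this costs a bounded factor by \<open>close_charge_nearby\<close>.
\<close>

lemma openin_nbhd: assumes \<sigma>: "\<sigma> \<in> Stab D" and \<delta>: "\<delta> < 1/2" shows "openin (stab_topology D) (nbhd D k \<delta> \<sigma>)"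
  unfolding openin_stab_topology
proof (intro conjI ballI)
  show "nbhd D k \<delta> \<sigma> \<subseteq> Stab D" by (auto simp: nbhd_def)
  interpret P: stability D "slices \<sigma>" "charge D \<sigma>" by (rule StabD[OF \<sigma>])
  fix \<tau> assume "\<tau> \<in> nbhd D k \<delta> \<sigma>"
  then obtain k' d where \<tau>: "\<tau> \<in> Stab D" and k': "0 \<le> k'" "k' < k" "close_charge D k' \<sigma> \<tau>"
    and d: "0 \<le> d" "d < \<delta>" "close_slicing D d (slices \<sigma>) (slices \<tau>)" unfolding nbhd_def by blast
  interpret Q: stability D "slices \<tau>" "charge D \<tau>" by (rule StabD[OF \<tau>])
  have cp: "0 < cos (pi * d)" using cos_pi_pos d \<delta> by simp
  \<comment> \<open>a perturbation of \<open>\<tau>\<close> of relative size \<open>sin(\<pi>g)\<close> has size at most \<open>g M\<close> relative to \<open>\<sigma>\<close>\<close>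
  define M where "M = pi * (1 + k') / cos (pi * d)"
  have M: "0 < M" using cp k' by (simp add: M_def)
  define g where "g = min ((\<delta> - d) / 2) (min ((k - k') / (2 * M)) (1/16))"
  have g: "0 < g" "g \<le> (\<delta> - d) / 2" "g \<le> (k - k') / (2 * M)" "g \<le> 1/16"
  proof -
    show "0 < g" using d k' M by (simp add: g_def)
    show "g \<le> (\<delta> - d) / 2" unfolding g_def by (rule min.cobounded1)
    show "g \<le> (k - k') / (2 * M)" unfolding g_def by (rule order_trans[OF min.cobounded2 min.cobounded1])
    show "g \<le> 1/16" unfolding g_def by (rule order_trans[OF min.cobounded2 min.cobounded2])
  qed
  have gM: "g * M < k - k'"
  proof -
    have "g * M \<le> (k - k') / (2 * M) * M" using g(3) M by (intro mult_right_mono) auto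
    also have "\<dots> = (k - k') / 2" using M by simp
    finally show ?thesis using k' by simp
  qed
  have "pi * g \<le> pi * (1/16)" using g(4) by (intro mult_left_mono) auto
  then have "pi * g \<le> pi" using pi_gt_zero by linarith
  then have s0: "0 \<le> sin (pi * g)" using g(1) by (intro sin_ge_zero) auto
  have s1: "sin (pi * g) \<le> pi * g" using g(1) by (intro sin_x_le_x) auto
  have "stab_ball D g \<tau> \<subseteq> nbhd D k \<delta> \<sigma>"
  proof
    fix \<upsilon> assume "\<upsilon> \<in> stab_ball D g \<tau>"
    then have \<upsilon>: "\<upsilon> \<in> Stab D" "charge_dist D \<tau> \<upsilon> < ennreal (sin (pi * g))"
        "slicing_dist D (slices \<tau>) (slices \<upsilon>) < ennreal g" by (auto simp: stab_ball_def)
    obtain e where e: "0 \<le> e" "e < g" "close_slicing D e (slices \<tau>) (slices \<upsilon>)"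
      using close_slicing_of_dist[OF \<upsilon>(3)] .
    have "close_slicing D (d + e) (slices \<sigma>) (slices \<upsilon>)" using close_slicing_trans[OF d(3) e(3)] .
    moreover have "0 \<le> d + e" "d + e < \<delta>" using d e g by auto
    moreover have cc: "close_charge D (sin (pi * g)) \<tau> \<upsilon>"
      using close_charge_of_dist[OF StabD(2)[OF \<tau>] \<upsilon>(2) s0] .
    have "close_charge D (k' + g * M) \<sigma> \<upsilon>"
      unfolding close_charge_def
    proof
      fix E assume E: "E \<in> nonzero_semistable D \<sigma>"
      then obtain \<phi> where \<phi>: "E \<in> slices \<sigma> \<phi>" by (auto simp: nonzero_semistable_def)
      have "close_slicing D d (slices \<tau>) (slices \<sigma>)"
        using close_slicing_sym[OF P.slicing Q.slicing d(3,1)] .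
      then have "E \<in> Q.PR {\<phi> - d..\<phi> + d}" using \<phi> unfolding close_slicing_def by blast
      then have "cmod (charge D \<upsilon> E - charge D \<tau> E) \<le> sin (pi * g) / cos (pi * d) * wid \<phi> (charge D \<tau> E)"
        using close_charge_nearby[OF \<tau> \<upsilon>(1) cc s0 d(1)] d(2) \<delta> by simp
      also have "\<dots> \<le> sin (pi * g) / cos (pi * d) * cmod (charge D \<tau> E)"
        using wid_le[of \<phi> "charge D \<tau> E"] s0 cp by (intro mult_left_mono) auto
      also have "\<dots> \<le> (pi * g) / cos (pi * d) * cmod (charge D \<tau> E)"
        using s1 cp by (intro mult_right_mono divide_right_mono) auto
      also have "\<dots> \<le> (pi * g) / cos (pi * d) * ((1 + k') * cmod (charge D \<sigma> E))"
      proof (rule mult_left_mono)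
        have "cmod (charge D \<tau> E) \<le> cmod (charge D \<tau> E - charge D \<sigma> E) + cmod (charge D \<sigma> E)"
          using norm_triangle_ineq[of "charge D \<tau> E - charge D \<sigma> E" "charge D \<sigma> E"] by simp
        moreover have "cmod (charge D \<tau> E - charge D \<sigma> E) \<le> k' * cmod (charge D \<sigma> E)"
          using k'(3) E unfolding close_charge_def by blast
        ultimately show "cmod (charge D \<tau> E) \<le> (1 + k') * cmod (charge D \<sigma> E)" by (simp add: algebra_simps)
        show "0 \<le> pi * g / cos (pi * d)" using g(1) cp by simp
      qed
      also have "\<dots> = g * M * cmod (charge D \<sigma> E)" by (simp add: M_def)
      finally have 1: "cmod (charge D \<upsilon> E - charge D \<tau> E) \<le> g * M * cmod (charge D \<sigma> E)" .
      have 2: "cmod (charge D \<tau> E - charge D \<sigma> E) \<le> k' * cmod (charge D \<sigma> E)"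
        using k'(3) E unfolding close_charge_def by blast
      have "cmod (charge D \<upsilon> E - charge D \<sigma> E) \<le> cmod (charge D \<upsilon> E - charge D \<tau> E) + cmod (charge D \<tau> E - charge D \<sigma> E)"
        using norm_triangle_ineq[of "charge D \<upsilon> E - charge D \<tau> E" "charge D \<tau> E - charge D \<sigma> E"] by simp
      also have "\<dots> \<le> (k' + g * M) * cmod (charge D \<sigma> E)" using 1 2 by (simp add: algebra_simps)
      finally show "cmod (charge D \<upsilon> E - charge D \<sigma> E) \<le> (k' + g * M) * cmod (charge D \<sigma> E)" .
    qed
    moreover have "0 \<le> k' + g * M" "k' + g * M < k" using gM g(1) M k' by (auto simp: add_nonneg_nonneg)
    ultimately show "\<upsilon> \<in> nbhd D k \<delta> \<sigma>" using \<upsilon>(1) unfolding nbhd_def by blast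
  qed
  then show "\<exists>\<epsilon>. 0 < \<epsilon> \<and> \<epsilon> < 1/8 \<and> stab_ball D \<epsilon> \<tau> \<subseteq> nbhd D k \<delta> \<sigma>" using g by (intro exI[of _ g]) auto
qed

text \<open>
  For \<open>\<tau>\<close> near \<open>\<sigma>\<close> the charge of a \<open>\<tau>\<close>-semistable object is close to its charge for \<open>\<sigma>\<close>, and by \<open>PR_wid\<close>
  the latter is bounded below: the \<open>\<sigma>\<close>-phases of such an object are concentrated in a narrow interval. The numbers \<open>1/4\<close> and \<open>1/2\<close>
  ensure \<open>k < cos(\<pi>\<delta>)\<close>.
\<close>

lemma nbhd_reasonable:
  assumes \<sigma>: "\<sigma> \<in> Stab D" "reasonable D \<sigma>" and \<tau>: "\<tau> \<in> nbhd D k \<delta> \<sigma>" and \<delta>: "\<delta> \<le> 1/4" and k: "k \<le> 1/2"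
  shows "reasonable D \<tau>"
proof -
  interpret P: stability D "slices \<sigma>" "charge D \<sigma>" by (rule StabD[OF \<sigma>(1)])
  obtain k' d where \<tau>S: "\<tau> \<in> Stab D" and k': "0 \<le> k'" "k' < k" "close_charge D k' \<sigma> \<tau>"
    and d: "0 \<le> d" "d < \<delta>" "close_slicing D d (slices \<sigma>) (slices \<tau>)" using \<tau> unfolding nbhd_def by blast
  obtain c where c: "0 < c" "\<And>E. E \<in> nonzero_semistable D \<sigma> \<Longrightarrow> c \<le> cmod (charge D \<sigma> E)" using reasonableE[OF \<sigma>(2)] by metis
  have dd: "d < 1/2" using d \<delta> by simp
  have "cos (pi * (1/4)) \<le> cos (pi * d)" by (rule cos_pi_ge) (use d \<delta> in auto)
  then have "sqrt 2 / 2 \<le> cos (pi * d)" by (simp add: cos_45)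
  moreover have "1 < sqrt (2::real)" by simp
  ultimately have cp: "1/2 < cos (pi * d)" by linarith
  define q where "q = 1 - k' / cos (pi * d)"
  have q: "0 < q" using k' k cp by (simp add: q_def field_simps)
  show ?thesis
  proof (rule reasonableI)
    show "0 < q * (c * cos (pi * d))" using q c cp by simp
    fix E assume "E \<in> nonzero_semistable D \<tau>"
    then obtain \<phi> where \<phi>: "E \<in> slices \<tau> \<phi>" "\<not> zero_object D E" by (auto simp: nonzero_semistable_def)
    have E: "E \<in> P.PR {\<phi> - d..\<phi> + d}" using d(3) \<phi> unfolding close_slicing_def by blast
    have "zero_object D E \<or> c * cos (pi * d) \<le> wid \<phi> (charge D \<sigma> E)"
      by (rule P.PR_wid[OF E _ dd d(1) c(1)]) (use c(2) in \<open>auto simp: nonzero_semistable_def\<close>)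
    then have "q * (c * cos (pi * d)) \<le> q * wid \<phi> (charge D \<sigma> E)" using \<phi>(2) q by simp
    also have "\<dots> = wid \<phi> (charge D \<sigma> E) - k' / cos (pi * d) * wid \<phi> (charge D \<sigma> E)" by (simp add: q_def algebra_simps)
    also have "\<dots> \<le> wid \<phi> (charge D \<sigma> E) - cmod (charge D \<tau> E - charge D \<sigma> E)"
      using close_charge_nearby[OF \<sigma>(1) \<tau>S k'(3,1) d(1) dd E] by simp
    also have "\<dots> \<le> wid \<phi> (charge D \<tau> E)"
      using wid_le[of \<phi> "charge D \<sigma> E - charge D \<tau> E"] by (simp add: norm_minus_commute)
    also have "\<dots> \<le> cmod (charge D \<tau> E)" by (rule wid_le)
    finally show "q * (c * cos (pi * d)) \<le> cmod (charge D \<tau> E)" .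
  qed
qed

lemma topspace_stab: "topspace (stab_topology D) = Stab D"
proof
  show "topspace (stab_topology D) \<subseteq> Stab D"
    using openin_topspace[of "stab_topology D"] unfolding openin_stab_topology by blast
  have "openin (stab_topology D) (Stab D)"
    unfolding openin_stab_topology by (auto simp: stab_ball_def intro!: exI[of _ "1/16"])
  then show "Stab D \<subseteq> topspace (stab_topology D)" by (rule openin_subset)
qed

section \<open>The vanishing condition\<close>

lemma shift_pow_nonpos: "i \<le> 0 \<Longrightarrow> shift_pow D i B = (Unshift D ^^ nat (- i)) B"
proof -
  assume "i \<le> 0"
  have "Unshift D = inv_into (Ob D) (Shift D)" by (simp add: fun_eq_iff Unshift_def)
  then show ?thesis using \<open>i \<le> 0\<close> by (auto simp: shift_pow_def)
qed

lemma Unshift_pow_ob: "A \<in> Ob D \<Longrightarrow> (Unshift D ^^ n) A \<in> Ob D"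
  by (induction n) auto

lemma orth_Unshift_pow: "A \<in> Ob D \<Longrightarrow> B \<in> Ob D \<Longrightarrow> orth D ((Unshift D ^^ n) A) ((Unshift D ^^ n) B) \<longleftrightarrow> orth D A B"
proof (induction n)
  case (Suc n)
  then show ?case using orth_shift[of "Unshift D ((Unshift D ^^ n) A)" "Unshift D ((Unshift D ^^ n) B)"] Unshift_pow_ob
    by (simp add: Unshift_ob)
qed simp

lemma Unshift_pow_Shift_pow: "B \<in> Ob D \<Longrightarrow> (Unshift D ^^ n) ((Shift D ^^ n) B) = B \<and> (Shift D ^^ n) B \<in> Ob D"
proof (induction n arbitrary: B)
  case (Suc n)
  have "(Unshift D ^^ Suc n) ((Shift D ^^ Suc n) B) = (Unshift D ^^ n) (Unshift D (Shift D ((Shift D ^^ n) B)))"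
    by (simp add: funpow_swap1)
  then show ?case using Suc by (simp add: Shift_ob)
qed simp

end

context semiorthogonal
begin

definition "compatible e P1 P2 \<longleftrightarrow> (\<forall>A \<in> phase_range C1 P1 {- e<..}. \<forall>B \<in> phase_range C2 P2 {..<1 + e}. orth D A B)"

text \<open>
  Every \<open>A \<in> P\<^sub>1(>-\<epsilon>)\<close> is built from objects \<open>A'[n]\<close> with \<open>n \<ge> 0\<close> and \<open>A' \<in> P\<^sub>1(-\<epsilon>, 1]\<close>, and every \<open>B \<in> P\<^sub>2(<1+\<epsilon>)\<close> from
  objects \<open>B'[-m]\<close> with \<open>m \<ge> 0\<close> and \<open>B' \<in> P\<^sub>2(0, 1+\<epsilon>)\<close>; and \<open>Hom(A'[n], B'[-m]) = Hom\<^sup>-\<^sup>n\<^sup>-\<^sup>m(A', B')\<close>.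
\<close>

lemma compatible_iff:
  assumes "slicing C1 P1" "slicing C2 P2" and e: "0 < e"
  shows "Hom_le_vanishes D 0 (phase_range C1 P1 {- e<..1}) (phase_range C2 P2 {0<..<1 + e}) \<longleftrightarrow> compatible e P1 P2"
proof -
  interpret T1: triangulated_category C1 by (rule S1.sub_triangulated)
  interpret T2: triangulated_category C2 by (rule S2.sub_triangulated)
  interpret A1: slicing_on C1 P1 using assms(1) by unfold_locales
  interpret A2: slicing_on C2 P2 using assms(2) by unfold_locales
  have mem1: "A \<in> D1 \<and> A \<in> Ob D" if "A \<in> A1.PR I" for A I
    using A1.PR_ob[OF that] S1.sub_ob by (auto simp: full_subcategory_sel)
  have mem2: "A \<in> D2 \<and> A \<in> Ob D" if "A \<in> A2.PR I" for A I
    using A2.PR_ob[OF that] S2.sub_ob by (auto simp: full_subcategory_sel)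
  show ?thesis
  proof
    assume H: "Hom_le_vanishes D 0 (A1.PR {- e<..1}) (A2.PR {0<..<1 + e})"
    have un1: "(Unshift D ^^ n) A \<in> P1 (\<phi> - real n)" if "A \<in> P1 \<phi>" for A \<phi> n
    proof (induction n)
      case (Suc n)
      have "(Unshift D ^^ n) A \<in> D1" using Suc A1.P_ob by (auto simp: full_subcategory_sel)
      then show ?case using A1.P_unshift[OF Suc] Unshift_C(1) by (simp add: algebra_simps)
    qed (use that in simp)
    have sh2: "(Shift D ^^ n) B \<in> P2 (\<psi> + real n)" if "B \<in> P2 \<psi>" for B \<psi> n
    proof (induction n)
      case (Suc n)
      show ?case using A2.P_shift[OF Suc] by (simp add: full_subcategory_sel algebra_simps)
    qed (use that in simp)
    have base_orth: "orth D A B" if A: "A \<in> P1 \<phi>" "- e < \<phi>" and B: "B \<in> P2 \<psi>" "\<psi> < 1 + e" for A \<phi> B \<psi>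
    proof -
      have AO: "A \<in> Ob D" using mem1 A1.PR_base[OF singletonI A(1)] by blast
      have BO: "B \<in> Ob D" using mem2 A2.PR_base[OF singletonI B(1)] by blast
      define n where "n = nat (\<lceil>\<phi>\<rceil> - 1)"
      define m where "m = nat (1 - \<lceil>\<psi>\<rceil>)"
      have n: "- e < \<phi> - real n" "\<phi> - real n \<le> 1"
      proof -
        have "real n = (if 1 \<le> \<lceil>\<phi>\<rceil> then of_int \<lceil>\<phi>\<rceil> - 1 else 0)" by (simp add: n_def)
        then show "- e < \<phi> - real n" "\<phi> - real n \<le> 1" using A(2) e by (auto split: if_splits) linarith+
      qed
      have m: "0 < \<psi> + real m" "\<psi> + real m < 1 + e"
      proof -
        have "real m = (if \<lceil>\<psi>\<rceil> \<le> 1 then 1 - of_int \<lceil>\<psi>\<rceil> else 0)" by (simp add: m_def)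
        then show "0 < \<psi> + real m" "\<psi> + real m < 1 + e" using B(2) e by (auto split: if_splits) linarith+
      qed
      let ?A = "(Unshift D ^^ n) A" and ?B = "(Shift D ^^ m) B"
      have "?A \<in> A1.PR {- e<..1}" using A1.PR_base[OF _ un1[OF A(1), of n]] n by simp
      moreover have "?B \<in> A2.PR {0<..<1 + e}" using A2.PR_base[OF _ sh2[OF B(1), of m]] m by simp
      ultimately have "orth D ?A (shift_pow D (- int (n + m)) ?B)"
        using H unfolding Hom_le_vanishes_def orth_def by auto
      moreover have "shift_pow D (- int (n + m)) ?B = (Unshift D ^^ n) B"
      proof -
        have "shift_pow D (- int (n + m)) ?B = (Unshift D ^^ (n + m)) ?B"
          using shift_pow_nonpos[of "- int (n + m)" ?B] by (simp only: minus_minus nat_int)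
        also have "\<dots> = (Unshift D ^^ n) ((Unshift D ^^ m) ?B)" by (simp add: funpow_add)
        finally show ?thesis using Unshift_pow_Shift_pow[OF BO, of m] by simp
      qed
      ultimately show ?thesis using orth_Unshift_pow[OF AO BO] by simp
    qed
    show "compatible e P1 P2"
      unfolding compatible_def
    proof (intro ballI)
      fix A B assume A: "A \<in> A1.PR {- e<..}" and B: "B \<in> A2.PR {..<1 + e}"
      show "orth D A B" using A
      proof (induction rule: phase_range_induct)
        case (base \<phi> A)
        show ?case using B
        proof (induction rule: phase_range_induct)
          case (base \<psi> B) then show ?case using \<open>\<phi> \<in> {- e<..}\<close> \<open>A \<in> P1 \<phi>\<close> base_orth[of A \<phi> B \<psi>] base by simp
        next
          case (ext X Y W) then show ?case using S2.exact_sub orth_ext_right by blast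
        qed
      next
        case (ext X Y W) then show ?case using S1.exact_sub orth_ext_left by blast
      qed
    qed
  next
    assume H: "compatible e P1 P2"
    show "Hom_le_vanishes D 0 (A1.PR {- e<..1}) (A2.PR {0<..<1 + e})"
      unfolding Hom_le_vanishes_def orth_def[symmetric]
    proof (intro ballI allI impI)
      fix A B and i :: int assume A: "A \<in> A1.PR {- e<..1}" and B: "B \<in> A2.PR {0<..<1 + e}" and i: "i \<le> 0"
      have "(Unshift D ^^ n) B \<in> A2.PR {..<1 + e}" for n
      proof (induction n)
        case 0
        have "B \<in> A2.PR {..<1 + e}" by (rule A2.PR_mono[OF B]) auto
        then show ?case by simp
      next
        case (Suc n)
        have "Unshift C2 ((Unshift D ^^ n) B) \<in> A2.PR {..<1 + e}" by (rule A2.PR_unshift[OF Suc]) auto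
        then show ?case using Unshift_C(2) mem2[OF Suc] by simp
      qed
      moreover have "A \<in> A1.PR {- e<..}" by (rule A1.PR_mono[OF A]) auto
      ultimately show "orth D A (shift_pow D i B)" using H shift_pow_nonpos[OF i] unfolding compatible_def by simp
    qed
  qed
qed

end

text \<open>
  The sine of \<open>\<pi>x\<close> on \<open>[d, 1-d]\<close> is smallest at the end points.
\<close>

lemma sin_pi_ge: assumes "0 < d" "d \<le> x" "x \<le> 1 - d" shows "sin (pi * d) \<le> sin (pi * x)"
proof -
  have *: "sin (pi * d) \<le> sin (pi * y)" if "d \<le> y" "y \<le> 1/2" for y
  proof (rule sin_monotone_2pi_le)
    have "0 \<le> pi * d" using assms by simp
    then show "- (pi / 2) \<le> pi * d" using pi_gt_zero by linarith
    show "pi * d \<le> pi * y" using that by simp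
    have "pi * y \<le> pi * (1/2)" using that by (intro mult_left_mono) auto
    then show "pi * y \<le> pi / 2" by simp
  qed
  show ?thesis
  proof (cases "x \<le> 1/2")
    case True then show ?thesis using * assms by blast
  next
    case False
    have "sin (pi * (1 - x)) = sin (pi * x)" using sin_pi_minus[of "pi * x"] by (simp add: algebra_simps)
    then show ?thesis using *[of "1 - x"] False assms by auto
  qed
qed

section \<open>Continuity of the gluing map\<close>

locale glue_pair = semiorthogonal +
  fixes \<sigma>1 \<sigma>2 :: "'a stab" and \<epsilon> c0 :: real
  assumes Stab1: "\<sigma>1 \<in> Stab (full_subcategory D D1)" and Stab2: "\<sigma>2 \<in> Stab (full_subcategory D D2)"
    and data: "glue_data D D1 D2 (slices \<sigma>1) (charge (full_subcategory D D1) \<sigma>1)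
      (slices \<sigma>2) (charge (full_subcategory D D2) \<sigma>2) \<epsilon> c0"

sublocale glue_pair \<subseteq> glue_data D D1 D2 "slices \<sigma>1" "charge (full_subcategory D D1) \<sigma>1"
    "slices \<sigma>2" "charge (full_subcategory D D2) \<sigma>2" \<epsilon> c0
  by (rule data)

context glue_pair
begin

lemma glued_from_iff: "glued_from D D1 D2 \<sigma>1 \<sigma>2 \<sigma> \<longleftrightarrow>
    stability_condition D \<sigma> \<and> heart D \<sigma> = GG {0<..1} \<and> (\<forall>E \<in> Ob D. charge D \<sigma> E = Z E)"
proof -
  have "compatible \<epsilon> (slices \<sigma>1) (slices \<sigma>2)" unfolding compatible_def using compat by blast
  then have "Hom_le_vanishes D 0 (R1 {- \<epsilon><..1}) (R2 {0<..<1 + \<epsilon>})"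
    using compatible_iff[OF A1.slicing A2.slicing eps] by blast
  moreover have "R1 {0<..1} \<subseteq> R1 {- \<epsilon><..1}" by (rule phase_range_mono) (use eps in auto)
  moreover have "R2 {0<..1} \<subseteq> R2 {0<..<1 + \<epsilon>}" by (rule phase_range_mono) (use eps in auto)
  ultimately have "Hom_le_vanishes D 0 (R1 {0<..1}) (R2 {0<..1})"
    unfolding Hom_le_vanishes_def by blast
  then show ?thesis unfolding glued_from_def Let_def Z_def GG_def heart_def by auto
qed

lemma glued_unique: "glued_from D D1 D2 \<sigma>1 \<sigma>2 \<sigma> \<Longrightarrow> glued_from D D1 D2 \<sigma>1 \<sigma>2 \<tau> \<Longrightarrow> \<sigma> = \<tau>"
  unfolding glued_from_iff by (rule stability_condition_eqI) auto

abbreviation "glued \<equiv> gluing_map D D1 D2 (\<sigma>1, \<sigma>2)"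

lemma glued_eqI: assumes "glued_from D D1 D2 \<sigma>1 \<sigma>2 \<sigma>" shows "glued = \<sigma>"
proof -
  have "(THE \<sigma>. glued_from D D1 D2 \<sigma>1 \<sigma>2 \<sigma>) = \<sigma>"
    using assms glued_unique by (intro the_equality) blast+
  then show ?thesis by (simp add: gluing_map_def)
qed

lemma glue_cutI: "good a \<Longrightarrow> 0 < a \<Longrightarrow> a < 1 \<Longrightarrow>
   glue_cut D D1 D2 (slices \<sigma>1) (charge (full_subcategory D D1) \<sigma>1)
    (slices \<sigma>2) (charge (full_subcategory D D2) \<sigma>2) \<epsilon> c0 a"
  by unfold_locales

lemma glued_cut:
  assumes "good a" "0 < a" "a < 1"
  shows "glued_from D D1 D2 \<sigma>1 \<sigma>2 glued" "reasonable D glued"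
    "slices glued = glue_cut.P D D1 D2 (slices \<sigma>1) (charge (full_subcategory D D1) \<sigma>1)
      (slices \<sigma>2) (charge (full_subcategory D D2) \<sigma>2) a"
proof -
  interpret c: glue_cut D D1 D2 "slices \<sigma>1" "charge (full_subcategory D D1) \<sigma>1"
    "slices \<sigma>2" "charge (full_subcategory D D2) \<sigma>2" \<epsilon> c0 a by (rule glue_cutI[OF assms])
  obtain \<sigma> where \<sigma>: "stability_condition D \<sigma>" "reasonable D \<sigma>" "slices \<sigma> = c.P"
    "\<And>E. E \<in> Ob D \<Longrightarrow> charge D \<sigma> E = Z E" "heart D \<sigma> = GG {0<..1}" using c.glued_exists by blast
  then have "glued_from D D1 D2 \<sigma>1 \<sigma>2 \<sigma>" using glued_from_iff by blast
  moreover from this have "glued = \<sigma>" by (rule glued_eqI)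
  ultimately show "glued_from D D1 D2 \<sigma>1 \<sigma>2 glued" "reasonable D glued" "slices glued = c.P" using \<sigma> by auto
qed

lemma good_near: "\<bar>t\<bar> < \<epsilon> \<Longrightarrow> good t" "\<bar>t\<bar> < \<epsilon> \<Longrightarrow> good (t + 1)"
  unfolding good_def by (auto intro: exI[of _ 0] exI[of _ 1])

lemma cut0: "good (min (\<epsilon> / 2) (1/2))" "0 < min (\<epsilon> / 2) (1/2)" "min (\<epsilon> / 2) (1/2) < 1"
  using eps by (auto intro!: good_near(1))

lemma glued_from_glued: "glued_from D D1 D2 \<sigma>1 \<sigma>2 glued" using glued_cut(1)[OF cut0] .
lemma glued_stable: "stability_condition D glued" using glued_from_glued glued_from_iff by blast
lemma glued_charge: "E \<in> Ob D \<Longrightarrow> charge D glued E = Z E" using glued_from_glued glued_from_iff by blast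
lemma glued_Stab: "glued \<in> Stab D"
  using glued_stable reasonable_locally_finite[OF glued_stable glued_cut(2)[OF cut0]] by (simp add: Stab_def)

text \<open>
  By uniqueness the glued stability condition can be constructed with any admissible cut \<open>a\<close>. Taking \<open>a = t\<close> for positive \<open>t\<close> and
  \<open>a = 1 + t\<close> for negative \<open>t\<close> makes \<open>t\<close> and \<open>t + 1\<close> cut points.
\<close>

lemma glued_PR: assumes t: "\<bar>t\<bar> < \<epsilon>" "\<bar>t\<bar> < 1"
  shows "phase_range D (slices glued) {t<..} = GG {t<..}" "phase_range D (slices glued) {..t + 1} = GG {..t + 1}"
proof -
  obtain a n where a: "good a" "0 < a" "a < 1" and n: "t = of_int n \<or> t = of_int n + a"
  proof (cases "t = 0")
    case True then show ?thesis using that[OF cut0, of 0] by simp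
  next
    case False
    show ?thesis
    proof (cases "0 < t")
      case True then show ?thesis using that[OF good_near(1)[OF t(1)], of 0] t by simp
    next
      case False then show ?thesis using that[OF good_near(2)[OF t(1)], of "-1"] t \<open>t \<noteq> 0\<close> by simp
    qed
  qed
  interpret c: glue_cut D D1 D2 "slices \<sigma>1" "charge (full_subcategory D D1) \<sigma>1"
    "slices \<sigma>2" "charge (full_subcategory D D2) \<sigma>2" \<epsilon> c0 a by (rule glue_cutI[OF a])
  have "c.cutpoint t" using n unfolding c.cutpoint_def by blast
  moreover have "c.cutpoint (t + 1)" unfolding c.cutpoint_def using n by (intro exI[of _ "n + 1"]) auto
  ultimately show "phase_range D (slices glued) {t<..} = GG {t<..}" "phase_range D (slices glued) {..t + 1} = GG {..t + 1}"
    using c.PR_eq_GG glued_cut(3)[OF a] by auto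
qed

lemma glued_PR_interval: assumes "\<bar>l\<bar> < \<epsilon>" "\<bar>l\<bar> < 1" "\<bar>u - 1\<bar> < \<epsilon>" "\<bar>u - 1\<bar> < 1" "l < u"
  shows "phase_range D (slices glued) {l<..u} = GG {l<..u}"
proof -
  interpret s: stability D "slices glued" "charge D glued" by (rule stability_of_condition[OF glued_stable])
  show ?thesis using s.PR_gt_le[OF assms(5)] GG_Int[OF assms(5)] glued_PR(1)[OF assms(1,2)] glued_PR(2)[OF assms(3,4)] by simp
qed

end

text \<open>
  Two nearby points of the domain. The slicings are at distance at most \<open>\<delta>\<close> and the charges at relative distance at most \<open>k\<close>. Within
  distance \<open>e\<close> of integers both pairs can be glued; \<open>\<delta>\<close> is small against \<open>e\<close>, so that intervals of width \<open>1 - e\<close> can be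
  enlarged several times by \<open>\<delta>\<close> and still have width less than \<open>1\<close>.
\<close>

locale nearby_pairs = p: glue_pair D D1 D2 \<sigma>1 \<sigma>2 \<epsilon> c0 + q: glue_pair D D1 D2 \<tau>1 \<tau>2 \<epsilon>' c0'
  for D :: "('a, 'b) tcat" and D1 D2 \<sigma>1 \<sigma>2 \<epsilon> c0 \<tau>1 \<tau>2 \<epsilon>' c0' +
  fixes e \<delta> k :: real
  assumes e: "0 < e" "e \<le> 1/4" "e < \<epsilon>" "e < \<epsilon>'" and \<delta>: "0 \<le> \<delta>" "\<delta> \<le> e / 8" and k: "0 \<le> k"
    and close1: "close_slicing (full_subcategory D D1) \<delta> (slices \<sigma>1) (slices \<tau>1)"
    and close2: "close_slicing (full_subcategory D D2) \<delta> (slices \<sigma>2) (slices \<tau>2)"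
    and charge1: "close_charge (full_subcategory D D1) k \<sigma>1 \<tau>1"
    and charge2: "close_charge (full_subcategory D D2) k \<sigma>2 \<tau>2"
begin

lemma GG_nearby: "q.GG {l<..u} \<subseteq> p.GG {l - \<delta><..u + \<delta>}" "p.GG {l<..u} \<subseteq> q.GG {l - \<delta><..u + \<delta>}"
proof -
  have c1: "close_slicing p.C1 \<delta> (slices \<tau>1) (slices \<sigma>1)"
    using p.A1.close_slicing_sym[OF p.A1.slicing q.A1.slicing close1 \<delta>(1)] .
  have c2: "close_slicing p.C2 \<delta> (slices \<tau>2) (slices \<sigma>2)"
    using p.A2.close_slicing_sym[OF p.A2.slicing q.A2.slicing close2 \<delta>(1)] .
  have "q.R1 {l<..u} \<subseteq> p.R1 {l - \<delta><..u + \<delta>}" "q.R2 {l<..u} \<subseteq> p.R2 {l - \<delta><..u + \<delta>}"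
    using close_slicing_range[OF close1, of "{l<..u}" "{l - \<delta><..u + \<delta>}"]
      close_slicing_range[OF close2, of "{l<..u}" "{l - \<delta><..u + \<delta>}"] by auto
  then show "q.GG {l<..u} \<subseteq> p.GG {l - \<delta><..u + \<delta>}" unfolding p.GG_def q.GG_def by blast
  have "p.R1 {l<..u} \<subseteq> q.R1 {l - \<delta><..u + \<delta>}" "p.R2 {l<..u} \<subseteq> q.R2 {l - \<delta><..u + \<delta>}"
    using close_slicing_range[OF c1, of "{l<..u}" "{l - \<delta><..u + \<delta>}"]
      close_slicing_range[OF c2, of "{l<..u}" "{l - \<delta><..u + \<delta>}"] by auto
  then show "p.GG {l<..u} \<subseteq> q.GG {l - \<delta><..u + \<delta>}" unfolding p.GG_def q.GG_def by blast
qed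

text \<open>
  The window is \<open>(0, 1-e]\<close> for \<open>\<phi> \<le> 1 - e\<close> and \<open>(e, 1]\<close> otherwise. Its end points are within \<open>e\<close> of integers, and the interval
  \<open>(b, b+1]\<close> contains its enlargement by \<open>2\<delta>\<close>.
\<close>

lemma window: assumes "0 < \<phi>" "\<phi> \<le> 1"
  obtains l u b where "l < \<phi>" "\<phi> \<le> u" "u - l = 1 - e" "0 \<le> l" "l \<le> e" "1 - e \<le> u" "u \<le> 1"
    "b \<le> l - 2 * \<delta>" "u + 2 * \<delta> \<le> b + 1" "b < \<phi>" "\<phi> \<le> b + 1"
proof (cases "\<phi> \<le> 1 - e")
  case True
  show ?thesis by (rule that[of 0 "1 - e" "- 2 * \<delta>"]) (use True assms e \<delta> in auto)
next
  case False
  show ?thesis by (rule that[of e 1 "2 * \<delta>"]) (use False assms e \<delta> in auto)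
qed

text \<open>
  The factor lost by \<open>PR_compare\<close> on a window, whose radius is \<open>(1-e)/2\<close>.
\<close>

definition "\<kappa> = k / cos (pi * ((1 - e) / 2))"

lemma cos_e: "0 < cos (pi * ((1 - e) / 2))"
  using cos_pi_pos[of "(1 - e) / 2"] e by simp

text \<open>
  By shifting, assume that the phase is in \<open>(0, 1]\<close>. The two components of a semistable object of the glued stability condition then lie
  in the same window, so their rotated real parts add up without cancellation.
\<close>

lemma glued_charge_close: "A \<in> slices p.glued \<psi> \<Longrightarrow> cmod (q.Z A - p.Z A) \<le> \<kappa> * cmod (p.Z A)"
proof -
  interpret P: stability D "slices p.glued" "charge D p.glued" by (rule p.stability_of_condition[OF p.glued_stable])
  have *: "cmod (q.Z A - p.Z A) \<le> \<kappa> * cmod (p.Z A)" if \<psi>: "0 < \<psi>" "\<psi> \<le> 1" and A: "A \<in> slices p.glued \<psi>" for A \<psi>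
  proof -
    obtain l u b where lu: "l < \<psi>" "\<psi> \<le> u" "u - l = 1 - e" "0 \<le> l" "l \<le> e" "1 - e \<le> u" "u \<le> 1"
      using window[OF \<psi>] by metis
    have "A \<in> P.PR {l<..u}" using P.PR_base[OF _ A, of "{l<..u}"] lu by auto
    moreover have "P.PR {l<..u} = p.GG {l<..u}" by (rule p.glued_PR_interval) (use lu e in auto)
    ultimately have G: "p.lam A \<in> p.R1 {l<..u}" "p.rho A \<in> p.R2 {l<..u}" unfolding p.GG_def by auto
    let ?\<theta> = "(l + u) / 2" and ?w = "(1 - e) / 2"
    have w: "\<bar>\<psi> - ?\<theta>\<bar> \<le> ?w" if "\<psi> \<in> {l<..u}" for \<psi> using that lu(3) unfolding abs_le_iff by (auto simp: field_simps)
    have w': "?w < 1/2" "0 \<le> ?w" using e by auto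
    have 1: "cmod (charge p.C1 \<tau>1 (p.lam A) - charge p.C1 \<sigma>1 (p.lam A)) \<le> \<kappa> * wid ?\<theta> (charge p.C1 \<sigma>1 (p.lam A))"
      unfolding \<kappa>_def
    proof (rule p.A1.PR_compare[OF G(1) w w' k p.A1.additive_diff[OF p.A1.Z_additive q.A1.Z_additive]])
      show "cmod (charge p.C1 \<tau>1 A - charge p.C1 \<sigma>1 A) \<le> k * cmod (charge p.C1 \<sigma>1 A)"
        if "A \<in> slices \<sigma>1 \<psi>" "\<not> zero_object p.C1 A" for \<psi> A
        using charge1 that unfolding close_charge_def nonzero_semistable_def by blast
    qed
    have 2: "cmod (charge p.C2 \<tau>2 (p.rho A) - charge p.C2 \<sigma>2 (p.rho A)) \<le> \<kappa> * wid ?\<theta> (charge p.C2 \<sigma>2 (p.rho A))"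
      unfolding \<kappa>_def
    proof (rule p.A2.PR_compare[OF G(2) w w' k p.A2.additive_diff[OF p.A2.Z_additive q.A2.Z_additive]])
      show "cmod (charge p.C2 \<tau>2 A - charge p.C2 \<sigma>2 A) \<le> k * cmod (charge p.C2 \<sigma>2 A)"
        if "A \<in> slices \<sigma>2 \<psi>" "\<not> zero_object p.C2 A" for \<psi> A
        using charge2 that unfolding close_charge_def nonzero_semistable_def by blast
    qed
    have "q.Z A - p.Z A = (charge p.C1 \<tau>1 (p.lam A) - charge p.C1 \<sigma>1 (p.lam A)) +
        (charge p.C2 \<tau>2 (p.rho A) - charge p.C2 \<sigma>2 (p.rho A))"
      by (simp add: p.Z_def q.Z_def)
    then have "cmod (q.Z A - p.Z A) \<le> \<kappa> * wid ?\<theta> (charge p.C1 \<sigma>1 (p.lam A)) + \<kappa> * wid ?\<theta> (charge p.C2 \<sigma>2 (p.rho A))"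
      using order_trans[OF norm_triangle_ineq add_mono[OF 1 2]] by simp
    also have "\<dots> = \<kappa> * wid ?\<theta> (p.Z A)" by (simp add: p.Z_def algebra_simps)
    also have "\<dots> \<le> \<kappa> * cmod (p.Z A)" using wid_le k cos_e by (intro mult_left_mono) (auto simp: \<kappa>_def)
    finally show ?thesis .
  qed
  let ?R = "\<lambda>\<psi>. \<forall>A \<in> slices p.glued \<psi>. cmod (q.Z A - p.Z A) \<le> \<kappa> * cmod (p.Z A)"
  have sh: "cmod (q.Z (Shift D A) - p.Z (Shift D A)) = cmod (q.Z A - p.Z A)"
    "cmod (p.Z (Shift D A)) = cmod (p.Z A)" if "A \<in> Ob D" for A
    using p.additive_shift[OF p.Z_additive that] p.additive_shift[OF q.Z_additive that]
    by (simp_all add: norm_minus_commute)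
  have "?R \<psi>" for \<psi>
  proof (rule real_shift_induct[where R = ?R])
    show "?R (x + 1) \<longleftrightarrow> ?R x" for x
      using sh P.P_ob unfolding P.P_shift_eq[of x, symmetric] by auto
  qed (use * in blast)
  then show "A \<in> slices p.glued \<psi> \<Longrightarrow> cmod (q.Z A - p.Z A) \<le> \<kappa> * cmod (p.Z A)" by blast
qed

text \<open>
  By shifting, it suffices to treat \<open>E\<close> semistable of phase \<open>\<phi> \<in> (0, 1]\<close> for the second pair. On a window enlarged by
  \<open>\<delta>\<close> the two glued slicings are comparable, which provides the common interval for
  \<open>truncation_upper\<close> and \<open>truncation_lower\<close>. Their hypothesis on charges holds because the charges of a
  semistable object for the two pairs differ in direction by less than \<open>\<pi>d\<close>.
\<close>

lemma glued_slicing_close: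
  assumes d: "0 < d" "d \<le> e / 2" and \<kappa>: "\<kappa> < sin (pi * d)"
  shows "close_slicing D d (slices p.glued) (slices q.glued)"
  unfolding close_slicing_def
proof
  interpret P: stability D "slices p.glued" "charge D p.glued" by (rule p.stability_of_condition[OF p.glued_stable])
  interpret Q: stability D "slices q.glued" "charge D q.glued" by (rule p.stability_of_condition[OF q.glued_stable])
  have charges: "\<exists>m>0. charge D p.glued A = of_real m * cis (pi * \<psi>) \<and>
      \<bar>hgt \<phi> (charge D q.glued A) - m * sin (pi * (\<psi> - \<phi>))\<bar> < m * sin (pi * d)"
    if A: "A \<in> slices p.glued \<psi>" "\<not> zero_object D A" for A \<psi> \<phi>
  proof -
    have AO: "A \<in> Ob D" using P.P_ob[OF A(1)] .
    obtain m where m: "m > 0" "charge D p.glued A = of_real m * cis (pi * \<psi>)" using P.phase[OF A] by blast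
    have "\<bar>hgt \<phi> (q.Z A - p.Z A)\<bar> \<le> \<kappa> * cmod (p.Z A)"
      using abs_hgt_le[of \<phi> "q.Z A - p.Z A"] glued_charge_close[OF A(1)] by linarith
    also have "\<kappa> * cmod (p.Z A) = \<kappa> * m" using m p.glued_charge[OF AO] by (simp add: norm_mult)
    also have "\<dots> < sin (pi * d) * m" using \<kappa> m(1) by simp
    finally have "\<bar>hgt \<phi> (q.Z A) - hgt \<phi> (p.Z A)\<bar> < m * sin (pi * d)" by (simp add: mult.commute)
    moreover have "hgt \<phi> (p.Z A) = m * sin (pi * (\<psi> - \<phi>))" using m(2) p.glued_charge[OF AO] by (simp add: hgt_polar)
    ultimately show ?thesis using m q.glued_charge[OF AO] by (intro exI[of _ m]) simp
  qed
  fix \<phi>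
  show "slices q.glued \<phi> \<subseteq> P.PR {\<phi> - d..\<phi> + d}"
  proof (rule p.slicing_subset_from_heart[OF Q.slicing P.slicing])
    fix \<phi> :: real assume \<phi>: "0 < \<phi>" "\<phi> \<le> 1"
    obtain l u b where lu: "l < \<phi>" "\<phi> \<le> u" "u - l = 1 - e" "0 \<le> l" "l \<le> e" "1 - e \<le> u" "u \<le> 1"
      and b: "b \<le> l - 2 * \<delta>" "u + 2 * \<delta> \<le> b + 1" "b < \<phi>" "\<phi> \<le> b + 1"
      using window[OF \<phi>] by metis
    have luless: "l < u" using lu by simp
    show "slices q.glued \<phi> \<subseteq> P.PR {\<phi> - d..\<phi> + d}"
    proof
      fix E assume E: "E \<in> slices q.glued \<phi>"
      have "E \<in> Q.PR {l<..u}" using Q.PR_base[OF _ E, of "{l<..u}"] lu by auto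
      also have "Q.PR {l<..u} = q.GG {l<..u}" by (rule q.glued_PR_interval) (use lu e in auto)
      also have "q.GG {l<..u} \<subseteq> p.GG {l - \<delta><..u + \<delta>}" by (rule GG_nearby)
      also have pI: "p.GG {l - \<delta><..u + \<delta>} = P.PR {l - \<delta><..u + \<delta>}"
        by (rule p.glued_PR_interval[symmetric]) (use lu e \<delta> in \<open>auto simp: abs_less_iff\<close>)
      finally have EI: "E \<in> P.PR {l - \<delta><..u + \<delta>}" .
      have "P.PR {l - \<delta><..u + \<delta>} \<subseteq> q.GG {l - \<delta> - \<delta><..u + \<delta> + \<delta>}" unfolding pI[symmetric] by (rule GG_nearby)
      also have "\<dots> = Q.PR {l - \<delta> - \<delta><..u + \<delta> + \<delta>}"
        by (rule q.glued_PR_interval[symmetric]) (use lu e \<delta> in \<open>auto simp: abs_less_iff\<close>)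
      also have "\<dots> \<subseteq> Q.PR {b<..b + 1}" by (rule phase_range_mono) (use b in auto)
      finally have sub: "P.PR {l - \<delta><..u + \<delta>} \<subseteq> Q.PR {b<..b + 1}" .
      have len: "u + \<delta> - (l - \<delta>) \<le> 1 - d" using lu(3) d(2) \<delta> e by simp
      have lu': "l - \<delta> < u + \<delta>" using luless \<delta> by simp
      have EI': "E \<in> P.PR {l - \<delta><..}" "E \<in> P.PR {..u + \<delta>}" using EI P.PR_gt_le[OF lu'] by auto
      have up: "E \<in> P.PR {..\<phi> + d}"
      proof (cases "\<phi> + d \<le> u + \<delta>")
        case True
        show ?thesis
        proof (rule Q.truncation_upper[OF P.slicing EI sub b(3,4) _ _ True])
          show "E \<in> Q.PR {..\<phi>}" using Q.PR_base[OF _ E, of "{..\<phi>}"] by simp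
          show "l - \<delta> < \<phi> + d" using lu d \<delta> by simp
          fix \<psi> A assume A: "\<phi> + d < \<psi>" "\<psi> \<le> u + \<delta>" "A \<in> slices p.glued \<psi>" "\<not> zero_object D A"
          obtain m where m: "m > 0" "\<bar>hgt \<phi> (charge D q.glued A) - m * sin (pi * (\<psi> - \<phi>))\<bar> < m * sin (pi * d)"
            using charges[OF A(3,4)] by blast
          have "sin (pi * d) \<le> sin (pi * (\<psi> - \<phi>))" by (rule sin_pi_ge) (use A d lu \<delta> len in auto)
          then have "m * sin (pi * d) \<le> m * sin (pi * (\<psi> - \<phi>))" using m(1) by simp
          then show "0 < hgt \<phi> (charge D q.glued A)" using m(2) by linarith
        qed
      next
        case False then show ?thesis by (intro P.PR_mono[OF EI'(2)]) auto
      qed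
      have low: "E \<in> P.PR {\<phi> - d..}"
      proof (cases "l - \<delta> < \<phi> - d")
        case True
        show ?thesis
        proof (rule Q.truncation_lower[OF P.slicing EI sub b(3,4) _ True])
          show "E \<in> Q.PR {\<phi>..}" using Q.PR_base[OF _ E, of "{\<phi>..}"] by simp
          show "\<phi> - d \<le> u + \<delta>" using lu d \<delta> by simp
          fix \<psi> A assume A: "l - \<delta> < \<psi>" "\<psi> < \<phi> - d" "A \<in> slices p.glued \<psi>" "\<not> zero_object D A"
          obtain m where m: "m > 0" "\<bar>hgt \<phi> (charge D q.glued A) - m * sin (pi * (\<psi> - \<phi>))\<bar> < m * sin (pi * d)"
            using charges[OF A(3,4)] by blast
          have "sin (pi * d) \<le> sin (pi * (\<phi> - \<psi>))" by (rule sin_pi_ge) (use A d lu \<delta> len in auto)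
          also have "\<dots> = - sin (pi * (\<psi> - \<phi>))" using sin_minus[of "pi * (\<psi> - \<phi>)"] by (simp add: algebra_simps)
          finally have "m * sin (pi * d) \<le> m * - sin (pi * (\<psi> - \<phi>))" using m(1) by (intro mult_left_mono) auto
          then have "m * sin (pi * d) \<le> - (m * sin (pi * (\<psi> - \<phi>)))" by (simp only: mult_minus_right)
          then show "hgt \<phi> (charge D q.glued A) < 0" using m(2) by linarith
        qed
      next
        case False then show ?thesis by (intro P.PR_mono[OF EI'(1)]) auto
      qed
      show "E \<in> P.PR {\<phi> - d..\<phi> + d}" using up low P.PR_ge_le[of "\<phi> - d" "\<phi> + d"] d by auto
    qed
  qed
qed

lemma glued_in_ball:
  assumes \<epsilon>0: "0 < \<epsilon>0" "\<epsilon>0 < 1/8" and d: "0 < d" "d \<le> e / 2" "d < \<epsilon>0"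
    and \<kappa>: "\<kappa> < sin (pi * d)" "\<kappa> < sin (pi * \<epsilon>0)"
  shows "q.glued \<in> stab_ball D \<epsilon>0 p.glued"
proof -
  have \<kappa>0: "0 \<le> \<kappa>" using k cos_e by (simp add: \<kappa>_def)
  interpret P: stability D "slices p.glued" "charge D p.glued" by (rule p.stability_of_condition[OF p.glued_stable])
  have "close_charge D \<kappa> p.glued q.glued"
    unfolding close_charge_def nonzero_semistable_def
    using glued_charge_close p.glued_charge q.glued_charge P.P_ob by auto
  then have "charge_dist D p.glued q.glued \<le> ennreal \<kappa>"
    using p.dist_of_close_charge[OF p.glued_stable _ \<kappa>0] by blast
  moreover have "ennreal \<kappa> < ennreal (sin (pi * \<epsilon>0))" using \<kappa> \<kappa>0 by (simp add: ennreal_less_iff)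
  moreover have "slicing_dist D (slices p.glued) (slices q.glued) \<le> ennreal d"
    using dist_of_close_slicing[OF _ glued_slicing_close[OF d(1,2) \<kappa>(1)]] d(1) by simp
  moreover have "ennreal d < ennreal \<epsilon>0" using d by (simp add: ennreal_less_iff)
  ultimately show ?thesis using q.glued_Stab unfolding stab_ball_def by (auto intro: le_less_trans)
qed

end

context semiorthogonal
begin

lemma gluing_domain_iff: "(\<sigma>1, \<sigma>2) \<in> gluing_domain D D1 D2 \<longleftrightarrow>
    \<sigma>1 \<in> Stab C1 \<and> \<sigma>2 \<in> Stab C2 \<and> reasonable C1 \<sigma>1 \<and> reasonable C2 \<sigma>2 \<and>
    (\<exists>\<epsilon>>0. compatible \<epsilon> (slices \<sigma>1) (slices \<sigma>2))"
proof -
  interpret T1: triangulated_category C1 by (rule S1.sub_triangulated)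
  interpret T2: triangulated_category C2 by (rule S2.sub_triangulated)
  have "slicing C1 (slices \<sigma>1)" if "\<sigma>1 \<in> Stab C1" using that by (auto simp: Stab_def stability_condition_def)
  moreover have "slicing C2 (slices \<sigma>2)" if "\<sigma>2 \<in> Stab C2" using that by (auto simp: Stab_def stability_condition_def)
  ultimately show ?thesis unfolding gluing_domain_def Let_def using compatible_iff by auto
qed

lemma glue_pair_of:
  assumes "\<sigma>1 \<in> Stab C1" "\<sigma>2 \<in> Stab C2" "reasonable C1 \<sigma>1" "reasonable C2 \<sigma>2" "0 < \<epsilon>"
    "compatible \<epsilon> (slices \<sigma>1) (slices \<sigma>2)"
  obtains c0 where "glue_pair D D1 D2 \<sigma>1 \<sigma>2 \<epsilon> c0"
proof -
  interpret T1: triangulated_category C1 by (rule S1.sub_triangulated)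
  interpret T2: triangulated_category C2 by (rule S2.sub_triangulated)
  obtain c1 where c1: "0 < c1" "\<And>E. E \<in> nonzero_semistable C1 \<sigma>1 \<Longrightarrow> c1 \<le> cmod (charge C1 \<sigma>1 E)"
    using reasonableE[OF assms(3)] by metis
  obtain c2 where c2: "0 < c2" "\<And>E. E \<in> nonzero_semistable C2 \<sigma>2 \<Longrightarrow> c2 \<le> cmod (charge C2 \<sigma>2 E)"
    using reasonableE[OF assms(4)] by metis
  have "glue_pair D D1 D2 \<sigma>1 \<sigma>2 \<epsilon> (min c1 c2)"
  proof (intro glue_pair.intro glue_pair_axioms.intro glue_data.intro glue_data_axioms.intro semiorthogonal_axioms)
    show "\<sigma>1 \<in> Stab C1" "\<sigma>2 \<in> Stab C2" "0 < \<epsilon>" by fact+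
    show "stability C1 (slices \<sigma>1) (charge C1 \<sigma>1)" "stability C2 (slices \<sigma>2) (charge C2 \<sigma>2)"
      using T1.StabD(1)[OF assms(1)] T2.StabD(1)[OF assms(2)] .
    show "0 < min c1 c2" using c1 c2 by simp
    show "orth D A B" if "A \<in> phase_range C1 (slices \<sigma>1) {- \<epsilon><..}" "B \<in> phase_range C2 (slices \<sigma>2) {..<1 + \<epsilon>}" for A B
      using assms(6) that unfolding compatible_def by blast
    show "min c1 c2 \<le> cmod (charge C1 \<sigma>1 A)" if "A \<in> slices \<sigma>1 \<psi>" "\<not> zero_object D A" for A \<psi>
      using c1(2)[of A] that S1.zero_sub unfolding nonzero_semistable_def by fastforce
    show "min c1 c2 \<le> cmod (charge C2 \<sigma>2 B)" if "B \<in> slices \<sigma>2 \<psi>" "\<not> zero_object D B" for B \<psi>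
      using c2(2)[of B] that S2.zero_sub unfolding nonzero_semistable_def by fastforce
  qed
  then show ?thesis using that by blast
qed

lemma compatible_nearby:
  assumes "compatible \<epsilon> P1 P2" "close_slicing C1 d1 P1 Q1" "close_slicing C2 d2 P2 Q2"
    "d1 \<le> \<epsilon> / 2" "d2 \<le> \<epsilon> / 2" "0 \<le> d1" "0 \<le> d2"
  shows "compatible (\<epsilon> / 2) Q1 Q2"
proof -
  have "phase_range C1 Q1 {- (\<epsilon> / 2)<..} \<subseteq> phase_range C1 P1 {- \<epsilon><..}"
    by (rule close_slicing_range[OF assms(2)]) (use assms in auto)
  moreover have "phase_range C2 Q2 {..<1 + \<epsilon> / 2} \<subseteq> phase_range C2 P2 {..<1 + \<epsilon>}"
    by (rule close_slicing_range[OF assms(3)]) (use assms in auto)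
  ultimately show ?thesis using assms(1) unfolding compatible_def by blast
qed

lemma nbhd_subset_domain:
  assumes "\<sigma>1 \<in> Stab C1" "\<sigma>2 \<in> Stab C2" "reasonable C1 \<sigma>1" "reasonable C2 \<sigma>2" "0 < \<epsilon>"
    "compatible \<epsilon> (slices \<sigma>1) (slices \<sigma>2)" "\<delta> \<le> \<epsilon> / 2" "\<delta> \<le> 1/4" "k \<le> 1/2"
    and \<tau>: "\<tau>1 \<in> nbhd C1 k \<delta> \<sigma>1" "\<tau>2 \<in> nbhd C2 k \<delta> \<sigma>2"
  shows "\<tau>1 \<in> Stab C1 \<and> \<tau>2 \<in> Stab C2 \<and> reasonable C1 \<tau>1 \<and> reasonable C2 \<tau>2 \<and>
    compatible (\<epsilon> / 2) (slices \<tau>1) (slices \<tau>2)"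
proof -
  interpret T1: triangulated_category C1 by (rule S1.sub_triangulated)
  interpret T2: triangulated_category C2 by (rule S2.sub_triangulated)
  obtain d1 where d1: "0 \<le> d1" "d1 < \<delta>" "close_slicing C1 d1 (slices \<sigma>1) (slices \<tau>1)" using \<tau>(1) unfolding nbhd_def by blast
  obtain d2 where d2: "0 \<le> d2" "d2 < \<delta>" "close_slicing C2 d2 (slices \<sigma>2) (slices \<tau>2)" using \<tau>(2) unfolding nbhd_def by blast
  have "\<tau>1 \<in> Stab C1" "\<tau>2 \<in> Stab C2" using \<tau> by (auto simp: nbhd_def)
  moreover have "reasonable C1 \<tau>1" using T1.nbhd_reasonable[OF assms(1,3) \<tau>(1) assms(8,9)] .
  moreover have "reasonable C2 \<tau>2" using T2.nbhd_reasonable[OF assms(2,4) \<tau>(2) assms(8,9)] .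
  moreover have "compatible (\<epsilon> / 2) (slices \<tau>1) (slices \<tau>2)"
    by (rule compatible_nearby[OF assms(6) d1(3) d2(3)]) (use d1 d2 assms in auto)
  ultimately show ?thesis by blast
qed

text \<open>
  Choose \<open>e\<close> for the width of the windows and \<open>d\<close> for the distance of the glued slicings; then \<open>k\<close> is so small that the glued charges
  differ by less than \<open>sin(\<pi>d)\<close>, as the comparison of slicings requires, and by less than \<open>sin(\<pi>\<epsilon>0)\<close>.
\<close>

lemma gluing_continuous_at:
  assumes U: "(\<sigma>1, \<sigma>2) \<in> gluing_domain D D1 D2" and \<epsilon>0: "0 < \<epsilon>0" "\<epsilon>0 < 1/8"
  shows "\<exists>V1 V2. openin (stab_topology C1) V1 \<and> openin (stab_topology C2) V2 \<and> \<sigma>1 \<in> V1 \<and> \<sigma>2 \<in> V2 \<and>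
    V1 \<times> V2 \<subseteq> gluing_domain D D1 D2 \<and> (\<forall>\<tau>1 \<in> V1. \<forall>\<tau>2 \<in> V2.
      gluing_map D D1 D2 (\<tau>1, \<tau>2) \<in> stab_ball D \<epsilon>0 (gluing_map D D1 D2 (\<sigma>1, \<sigma>2)))"
proof -
  interpret T1: triangulated_category C1 by (rule S1.sub_triangulated)
  interpret T2: triangulated_category C2 by (rule S2.sub_triangulated)
  obtain \<epsilon> where \<sigma>: "\<sigma>1 \<in> Stab C1" "\<sigma>2 \<in> Stab C2" "reasonable C1 \<sigma>1" "reasonable C2 \<sigma>2"
    and \<epsilon>: "0 < \<epsilon>" "compatible \<epsilon> (slices \<sigma>1) (slices \<sigma>2)" using U gluing_domain_iff by blast
  obtain c0 where p: "glue_pair D D1 D2 \<sigma>1 \<sigma>2 \<epsilon> c0" using glue_pair_of[OF \<sigma> \<epsilon>] .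
  define e where "e = min \<epsilon> 1 / 4"
  define d where "d = min (\<epsilon>0 / 2) (e / 2)"
  define C where "C = cos (pi * ((1 - e) / 2))"
  define k where "k = min (1/2) (min (sin (pi * \<epsilon>0)) (sin (pi * d)) * C)"
  have e: "0 < e" "e \<le> 1/4" "e < \<epsilon>" "e < \<epsilon> / 2" using \<epsilon> by (auto simp: e_def min_def)
  have d: "0 < d" "d \<le> e / 2" "d < \<epsilon>0" using e \<epsilon>0 by (auto simp: d_def min_def)
  interpret p: glue_pair D D1 D2 \<sigma>1 \<sigma>2 \<epsilon> c0 by (rule p)
  have C: "0 < C" unfolding C_def by (rule cos_pi_pos) (use e in auto)
  have k: "0 < k" "k \<le> 1/2"
    using C sin_pi_pos[of \<epsilon>0] sin_pi_pos[of d] \<epsilon>0 d e by (auto simp: k_def)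
  let ?V1 = "nbhd C1 k (e / 8) \<sigma>1" and ?V2 = "nbhd C2 k (e / 8) \<sigma>2"
  have dom: "\<tau>1 \<in> Stab C1 \<and> \<tau>2 \<in> Stab C2 \<and> reasonable C1 \<tau>1 \<and> reasonable C2 \<tau>2 \<and>
    compatible (\<epsilon> / 2) (slices \<tau>1) (slices \<tau>2)" if "\<tau>1 \<in> ?V1" "\<tau>2 \<in> ?V2" for \<tau>1 \<tau>2
    by (rule nbhd_subset_domain[OF \<sigma> \<epsilon> _ _ k(2) that]) (use e in auto)
  show ?thesis
  proof (rule exI[of _ ?V1], rule exI[of _ ?V2], intro conjI ballI)
    show "openin (stab_topology C1) ?V1" by (rule T1.openin_nbhd[OF \<sigma>(1)]) (use e in auto)
    show "openin (stab_topology C2) ?V2" by (rule T2.openin_nbhd[OF \<sigma>(2)]) (use e in auto)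
    show "\<sigma>1 \<in> ?V1" by (rule T1.nbhd_self[OF \<sigma>(1) k(1)]) (use e in auto)
    show "\<sigma>2 \<in> ?V2" by (rule T2.nbhd_self[OF \<sigma>(2) k(1)]) (use e in auto)
    show "?V1 \<times> ?V2 \<subseteq> gluing_domain D D1 D2"
    proof clarify
      fix \<tau>1 \<tau>2 assume "\<tau>1 \<in> ?V1" "\<tau>2 \<in> ?V2"
      then show "(\<tau>1, \<tau>2) \<in> gluing_domain D D1 D2"
        using dom gluing_domain_iff half_gt_zero[OF \<epsilon>(1)] by blast
    qed
    fix \<tau>1 \<tau>2 assume \<tau>: "\<tau>1 \<in> ?V1" "\<tau>2 \<in> ?V2"
    obtain k1 d1 where 1: "0 \<le> k1" "k1 < k" "close_charge C1 k1 \<sigma>1 \<tau>1"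
      "0 \<le> d1" "d1 < e / 8" "close_slicing C1 d1 (slices \<sigma>1) (slices \<tau>1)" using \<tau>(1) unfolding nbhd_def by blast
    obtain k2 d2 where 2: "0 \<le> k2" "k2 < k" "close_charge C2 k2 \<sigma>2 \<tau>2"
      "0 \<le> d2" "d2 < e / 8" "close_slicing C2 d2 (slices \<sigma>2) (slices \<tau>2)" using \<tau>(2) unfolding nbhd_def by blast
    define k' where "k' = max k1 k2"
    define d' where "d' = max d1 d2"
    have cc: "close_charge X k' s t" if "close_charge X k0 s t" "k0 \<le> k'" for X :: "('a, 'b) tcat" and k0 s t
      using that unfolding close_charge_def by (meson mult_right_mono norm_ge_zero order_trans)
    have cs: "close_slicing X d' s t" if "close_slicing X d0 s t" "d0 \<le> d'" for X :: "('a, 'b) tcat" and d0 s t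
      unfolding close_slicing_def
    proof
      fix \<phi>
      have "{\<phi> - d0..\<phi> + d0} \<subseteq> {\<phi> - d'..\<phi> + d'}" using that(2) by auto
      then show "t \<phi> \<subseteq> phase_range X s {\<phi> - d'..\<phi> + d'}"
        using that(1) phase_range_mono[of "{\<phi> - d0..\<phi> + d0}" "{\<phi> - d'..\<phi> + d'}" X s] unfolding close_slicing_def by blast
    qed
    obtain c0' where q: "glue_pair D D1 D2 \<tau>1 \<tau>2 (\<epsilon> / 2) c0'"
      using glue_pair_of[of \<tau>1 \<tau>2 "\<epsilon> / 2"] dom[OF \<tau>] half_gt_zero[OF \<epsilon>(1)] by blast
    interpret n: nearby_pairs D D1 D2 \<sigma>1 \<sigma>2 \<epsilon> c0 \<tau>1 \<tau>2 "\<epsilon> / 2" c0' e d' k'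
      by (intro nearby_pairs.intro nearby_pairs_axioms.intro p q)
        (use e 1 2 cc[OF 1(3)] cc[OF 2(3)] cs[OF 1(6)] cs[OF 2(6)] in \<open>auto simp: k'_def d'_def\<close>)
    have "k' < min (sin (pi * \<epsilon>0)) (sin (pi * d)) * C" using 1 2 by (auto simp: k'_def k_def)
    then have "n.\<kappa> < min (sin (pi * \<epsilon>0)) (sin (pi * d))"
      unfolding n.\<kappa>_def C_def[symmetric] by (simp only: pos_divide_less_eq[OF C])
    then show "gluing_map D D1 D2 (\<tau>1, \<tau>2) \<in> stab_ball D \<epsilon>0 (gluing_map D D1 D2 (\<sigma>1, \<sigma>2))"
      using n.glued_in_ball[OF \<epsilon>0 d] by simp
  qed
qed

end

theorem corollary4p4:
  fixes D :: "('o, 'm) tcat" and D1 D2 :: "'o set"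
  assumes "triangulated_category D"
    and "semiorthogonal_decomposition D D1 D2"
  shows "let T = prod_topology (stab_topology (full_subcategory D D1))
                               (stab_topology (full_subcategory D D2));
             U = gluing_domain D D1 D2
         in openin T U \<and>
            (\<forall>(\<sigma>1, \<sigma>2) \<in> U. (\<exists>!\<sigma>. glued_from D D1 D2 \<sigma>1 \<sigma>2 \<sigma>) \<and>
                              gluing_map D D1 D2 (\<sigma>1, \<sigma>2) \<in> Stab D) \<and>
            continuous_map (subtopology T U) (stab_topology D) (gluing_map D D1 D2)"
proof -
  interpret semiorthogonal D D1 D2
    using assms by (intro semiorthogonal.intro semiorthogonal_axioms.intro)
  let ?U = "gluing_domain D D1 D2" and ?gl = "gluing_map D D1 D2"
  let ?T = "prod_topology (stab_topology C1) (stab_topology C2)"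
  have glued: "(\<exists>!\<sigma>. glued_from D D1 D2 \<sigma>1 \<sigma>2 \<sigma>) \<and> ?gl (\<sigma>1, \<sigma>2) \<in> Stab D" if U: "(\<sigma>1, \<sigma>2) \<in> ?U" for \<sigma>1 \<sigma>2
  proof -
    obtain \<epsilon> where "\<sigma>1 \<in> Stab C1" "\<sigma>2 \<in> Stab C2" "reasonable C1 \<sigma>1" "reasonable C2 \<sigma>2" "0 < \<epsilon>"
      "compatible \<epsilon> (slices \<sigma>1) (slices \<sigma>2)" using U gluing_domain_iff[of \<sigma>1 \<sigma>2] by blast
    then obtain c0 where "glue_pair D D1 D2 \<sigma>1 \<sigma>2 \<epsilon> c0" using glue_pair_of by blast
    then interpret p: glue_pair D D1 D2 \<sigma>1 \<sigma>2 \<epsilon> c0 .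
    have "\<exists>!\<sigma>. glued_from D D1 D2 \<sigma>1 \<sigma>2 \<sigma>"
    proof (rule ex1I[of _ p.glued])
      show "glued_from D D1 D2 \<sigma>1 \<sigma>2 p.glued" by (rule p.glued_from_glued)
      show "\<tau> = p.glued" if "glued_from D D1 D2 \<sigma>1 \<sigma>2 \<tau>" for \<tau>
        by (rule p.glued_unique[OF that p.glued_from_glued])
    qed
    then show ?thesis using p.glued_Stab by simp
  qed
  have op: "openin ?T {x \<in> ?U. ?gl x \<in> W}" if W: "openin (stab_topology D) W" for W
    unfolding openin_prod_topology_alt
  proof (intro allI impI)
    fix \<sigma>1 \<sigma>2 assume "(\<sigma>1, \<sigma>2) \<in> {x \<in> ?U. ?gl x \<in> W}"
    then have U: "(\<sigma>1, \<sigma>2) \<in> ?U" and "?gl (\<sigma>1, \<sigma>2) \<in> W" by auto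
    then obtain \<epsilon>0 where \<epsilon>0: "0 < \<epsilon>0" "\<epsilon>0 < 1/8" "stab_ball D \<epsilon>0 (?gl (\<sigma>1, \<sigma>2)) \<subseteq> W"
      using W unfolding openin_stab_topology by blast
    obtain V1 V2 where V: "openin (stab_topology C1) V1" "openin (stab_topology C2) V2" "\<sigma>1 \<in> V1" "\<sigma>2 \<in> V2"
      "V1 \<times> V2 \<subseteq> ?U" "\<forall>\<tau>1 \<in> V1. \<forall>\<tau>2 \<in> V2. ?gl (\<tau>1, \<tau>2) \<in> stab_ball D \<epsilon>0 (?gl (\<sigma>1, \<sigma>2))"
      using gluing_continuous_at[OF U \<epsilon>0(1,2)] by blast
    then have "V1 \<times> V2 \<subseteq> {x \<in> ?U. ?gl x \<in> W}" using \<epsilon>0(3) by blast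
    then show "\<exists>V1 V2. openin (stab_topology C1) V1 \<and> openin (stab_topology C2) V2 \<and> \<sigma>1 \<in> V1 \<and> \<sigma>2 \<in> V2 \<and>
        V1 \<times> V2 \<subseteq> {x \<in> ?U. ?gl x \<in> W}" using V by blast
  qed
  have "{x \<in> ?U. ?gl x \<in> Stab D} = ?U" using glued by auto
  then have open_U: "openin ?T ?U" using op[of "Stab D"] openin_topspace[of "stab_topology D"] topspace_stab by simp
  have "continuous_map (subtopology ?T ?U) (stab_topology D) ?gl"
    unfolding continuous_map_def
  proof (intro conjI allI impI)
    have top: "topspace (subtopology ?T ?U) = ?U" using openin_subset[OF open_U] by (auto simp: topspace_subtopology)
    show "?gl \<in> topspace (subtopology ?T ?U) \<rightarrow> topspace (stab_topology D)"
      unfolding top topspace_stab using glued by auto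
    show "openin (subtopology ?T ?U) {x \<in> topspace (subtopology ?T ?U). ?gl x \<in> W}" if "openin (stab_topology D) W" for W
      unfolding top openin_open_subtopology[OF open_U] using op[OF that] by blast
  qed
  moreover have "case x of (\<sigma>1, \<sigma>2) \<Rightarrow> (\<exists>!\<sigma>. glued_from D D1 D2 \<sigma>1 \<sigma>2 \<sigma>) \<and> ?gl (\<sigma>1, \<sigma>2) \<in> Stab D"
    if "x \<in> ?U" for x
    using glued[of "fst x" "snd x"] that by (cases x) (simp only: prod.case fst_conv snd_conv)
  ultimately show ?thesis using open_U unfolding Let_def by blast
qed

end
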